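(* Let $\omega\in\Omega$ and let $V$ be a weight $A$-module with $\mathrm{Supp}(V)\subseteq\omega$. For an admissible form $F$ on $V$ let $\tilde F:V\to V^\sharp$ be the map $u\mapsto\tilde F_u$, where $\tilde F_u(v)=F(u,v)$ for $v\in V$. Then the map $F\mapsto\tilde F$ is an isomorphism of abelian groups between the space of admissible forms on $V$ and $\mathrm{Hom}_A(V,V^\sharp)$. Moreover, non-degenerate forms correspond to isomorphisms.
   Context: Setup. $R$ is a commutative ring with $1$; $*:R\to R$ is a ring automorphism of order $1$ or $2$; $\sigma:R\to R$ is a ring automorphism commuting with $*$; $t\in R$ satisfies $t^*=t$. The generalized Weyl algebra $A=R(\sigma,t)$ is the ring generated by $R\cup\{X,Y\}$ such that $R$ is a subring and $YX=t$, $XY=\sigma(t)$, $Xr=\sigma(r)X$, $Yr=\sigma^{-1}(r)Y$ for all $r\in R$. It is $\mathbb Z$-graded, $A=\bigoplus_n A_n$, with $\deg X=1$, $\deg Y=-1$, $\deg r=0$ for $r\in R$. The map $*$ extends to an involution of $A$ (additive, $(ab)^*=b^*a^*$, $a^{**}=a$) with $X^*=Y$, $Y^*=X$. $\Omega$ is the set of orbits of $\sigma$ acting on the set $\mathrm{Max}(R)$ of maximal ideals. For $\omega\in\Omega$, $R_\omega=\bigoplus_{\mathfrak m\in\omega}R/\mathfrak m$ (an $R$-module); $\sigma$ induces isomorphisms $R/\mathfrak m\to R/\sigma(\mathfrak m)$ and hence an additive map $\sigma:R_\omega\to R_\omega$. A weight module is an $A$-module $V=\bigoplus_{\mathfrak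 m\in\mathrm{Max}(R)}V_{\mathfrak m}$ with $V_{\mathfrak m}=\{v\in V:\mathfrak m v=0\}$; $\mathrm{Supp}(V)=\{\mathfrak m:V_{\mathfrak m}\ne0\}$. An admissible form on a weight module $V$ with $\mathrm{Supp}(V)\subseteq\omega$ is a map $F:V\times V\to R_\omega$, additive in each argument, with $F(rv,w)=rF(v,w)$ for $r\in R$, and $F(av,w)=\sigma^{\deg a}\big(F(v,a^*w)\big)$ for all homogeneous $a\in A$ and $v,w\in V$. Admissible forms are added pointwise. A form is non-degenerate if for any nonzero $v\in V$ there are $w_1,w_2\in V$ with $F(w_1,v)\ne0\ne F(v,w_2)$. The finitistic dual $V^\sharp$ is the set of all additive maps $\varphi:V\to R_\omega$ such that $\varphi(rv)=r^*\varphi(v)$ for all $r\in R,v\in V$ and $\varphi(V_{\mathfrak m})=0$ for all but finitely many $\mathfrak m\in\omega$. It is an $A$-module via $(r\varphi)(v)=\varphi(r^*v)=r\varphi(v)$, $(X\varphi)(v)=\sigma(\varphi(Yv))$, $(Y\varphi)(v)=\sigma^{-1}(\varphi(Xv))$.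
   Formalization: That a non-degenerate form gives an isomorphism is stated only when every weight space of V is finite-dimensional over R/m, since it fails otherwise (V = k^(N), X = Y = id, standard bilinear form); the group isomorphism and the converse hold without this. *)

theory Defs
  imports "HOL-Algebra.Algebra"
begin

section \<open>Generalized Weyl algebras with involution\<close>

locale gwa_data = cring R for R :: "'a ring" (structure) +
  fixes star :: "'a \<Rightarrow> 'a" and \<sigma> :: "'a \<Rightarrow> 'a" and t :: 'a
  assumes star_iso: "star \<in> ring_iso R R"
    and star_star: "r \<in> carrier R \<Longrightarrow> star (star r) = r"
    and sigma_iso: "\<sigma> \<in> ring_iso R R"
    and sigma_star: "r \<in> carrier R \<Longrightarrow> \<sigma> (star r) = star (\<sigma> r)"
    and t_closed: "t \<in> carrier R"
    and star_t: "star t = t"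

text \<open>
  The algebra is given by its presentation: ring expressions in the elements of \<open>R\<close> and
  in \<open>X\<close>, \<open>Y\<close>, modulo the least congruence containing the ring laws, the operations of
  \<open>R\<close> and the defining relations.
\<close>

datatype (coeffs: 'r) gwa_expr =
    Coeff 'r
  | GenX
  | GenY
  | Plus "'r gwa_expr" "'r gwa_expr"
  | Uminus "'r gwa_expr"
  | Times "'r gwa_expr" "'r gwa_expr"

definition gwa_exprs :: "'r ring \<Rightarrow> 'r gwa_expr set" where
  "gwa_exprs R = {e. coeffs e \<subseteq> carrier R}"

inductive_set gwa_rel :: "'r ring \<Rightarrow> ('r \<Rightarrow> 'r) \<Rightarrow> 'r \<Rightarrow> ('r gwa_expr \<times> 'r gwa_expr) set"
  for R :: "'r ring" and \<sigma> :: "'r \<Rightarrow> 'r" and t :: 'r where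
  refl: "e \<in> gwa_exprs R \<Longrightarrow> (e, e) \<in> gwa_rel R \<sigma> t"
| sym: "(e, f) \<in> gwa_rel R \<sigma> t \<Longrightarrow> (f, e) \<in> gwa_rel R \<sigma> t"
| trans: "\<lbrakk>(e, f) \<in> gwa_rel R \<sigma> t; (f, g) \<in> gwa_rel R \<sigma> t\<rbrakk> \<Longrightarrow> (e, g) \<in> gwa_rel R \<sigma> t"
| plus_cong: "\<lbrakk>(e, e') \<in> gwa_rel R \<sigma> t; (f, f') \<in> gwa_rel R \<sigma> t\<rbrakk>
    \<Longrightarrow> (Plus e f, Plus e' f') \<in> gwa_rel R \<sigma> t"
| uminus_cong: "(e, e') \<in> gwa_rel R \<sigma> t \<Longrightarrow> (Uminus e, Uminus e') \<in> gwa_rel R \<sigma> t"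
| times_cong: "\<lbrakk>(e, e') \<in> gwa_rel R \<sigma> t; (f, f') \<in> gwa_rel R \<sigma> t\<rbrakk>
    \<Longrightarrow> (Times e f, Times e' f') \<in> gwa_rel R \<sigma> t"
| plus_assoc: "\<lbrakk>e \<in> gwa_exprs R; f \<in> gwa_exprs R; g \<in> gwa_exprs R\<rbrakk>
    \<Longrightarrow> (Plus (Plus e f) g, Plus e (Plus f g)) \<in> gwa_rel R \<sigma> t"
| plus_comm: "\<lbrakk>e \<in> gwa_exprs R; f \<in> gwa_exprs R\<rbrakk> \<Longrightarrow> (Plus e f, Plus f e) \<in> gwa_rel R \<sigma> t"
| plus_zero: "e \<in> gwa_exprs R \<Longrightarrow> (Plus (Coeff \<zero>\<^bsub>R\<^esub>) e, e) \<in> gwa_rel R \<sigma> t"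
| plus_uminus: "e \<in> gwa_exprs R \<Longrightarrow> (Plus (Uminus e) e, Coeff \<zero>\<^bsub>R\<^esub>) \<in> gwa_rel R \<sigma> t"
| times_assoc: "\<lbrakk>e \<in> gwa_exprs R; f \<in> gwa_exprs R; g \<in> gwa_exprs R\<rbrakk>
    \<Longrightarrow> (Times (Times e f) g, Times e (Times f g)) \<in> gwa_rel R \<sigma> t"
| times_one_left: "e \<in> gwa_exprs R \<Longrightarrow> (Times (Coeff \<one>\<^bsub>R\<^esub>) e, e) \<in> gwa_rel R \<sigma> t"
| times_one_right: "e \<in> gwa_exprs R \<Longrightarrow> (Times e (Coeff \<one>\<^bsub>R\<^esub>), e) \<in> gwa_rel R \<sigma> t"
| distrib_left: "\<lbrakk>e \<in> gwa_exprs R; f \<in> gwa_exprs R; g \<in> gwa_exprs R\<rbrakk>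
    \<Longrightarrow> (Times e (Plus f g), Plus (Times e f) (Times e g)) \<in> gwa_rel R \<sigma> t"
| distrib_right: "\<lbrakk>e \<in> gwa_exprs R; f \<in> gwa_exprs R; g \<in> gwa_exprs R\<rbrakk>
    \<Longrightarrow> (Times (Plus e f) g, Plus (Times e g) (Times f g)) \<in> gwa_rel R \<sigma> t"
| coeff_plus: "\<lbrakk>a \<in> carrier R; b \<in> carrier R\<rbrakk>
    \<Longrightarrow> (Plus (Coeff a) (Coeff b), Coeff (a \<oplus>\<^bsub>R\<^esub> b)) \<in> gwa_rel R \<sigma> t"
| coeff_times: "\<lbrakk>a \<in> carrier R; b \<in> carrier R\<rbrakk>
    \<Longrightarrow> (Times (Coeff a) (Coeff b), Coeff (a \<otimes>\<^bsub>R\<^esub> b)) \<in> gwa_rel R \<sigma> t"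
| Y_X: "(Times GenY GenX, Coeff t) \<in> gwa_rel R \<sigma> t"
| X_Y: "(Times GenX GenY, Coeff (\<sigma> t)) \<in> gwa_rel R \<sigma> t"
| X_coeff: "r \<in> carrier R
    \<Longrightarrow> (Times GenX (Coeff r), Times (Coeff (\<sigma> r)) GenX) \<in> gwa_rel R \<sigma> t"
| Y_coeff: "r \<in> carrier R
    \<Longrightarrow> (Times GenY (Coeff r), Times (Coeff (inv_into (carrier R) \<sigma> r)) GenY) \<in> gwa_rel R \<sigma> t"

definition gwa_class :: "'r ring \<Rightarrow> ('r \<Rightarrow> 'r) \<Rightarrow> 'r \<Rightarrow> 'r gwa_expr \<Rightarrow> 'r gwa_expr set" where
  "gwa_class R \<sigma> t e = gwa_rel R \<sigma> t `` {e}"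

definition gwa :: "'r ring \<Rightarrow> ('r \<Rightarrow> 'r) \<Rightarrow> 'r \<Rightarrow> 'r gwa_expr set ring" where
  "gwa R \<sigma> t =
    \<lparr>carrier = gwa_exprs R // gwa_rel R \<sigma> t,
     monoid.mult = (\<lambda>P Q. \<Union>e\<in>P. \<Union>f\<in>Q. gwa_class R \<sigma> t (Times e f)),
     monoid.one = gwa_class R \<sigma> t (Coeff \<one>\<^bsub>R\<^esub>),
     ring.zero = gwa_class R \<sigma> t (Coeff \<zero>\<^bsub>R\<^esub>),
     ring.add = (\<lambda>P Q. \<Union>e\<in>P. \<Union>f\<in>Q. gwa_class R \<sigma> t (Plus e f))\<rparr>"

lemma gwa_exprs_simps [simp]:
  "Coeff r \<in> gwa_exprs R \<longleftrightarrow> r \<in> carrier R"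
  "GenX \<in> gwa_exprs R" "GenY \<in> gwa_exprs R"
  "Plus e f \<in> gwa_exprs R \<longleftrightarrow> e \<in> gwa_exprs R \<and> f \<in> gwa_exprs R"
  "Uminus e \<in> gwa_exprs R \<longleftrightarrow> e \<in> gwa_exprs R"
  "Times e f \<in> gwa_exprs R \<longleftrightarrow> e \<in> gwa_exprs R \<and> f \<in> gwa_exprs R"
  by (auto simp: gwa_exprs_def)

context gwa_data
begin

lemma star_closed: "r \<in> carrier R \<Longrightarrow> star r \<in> carrier R"
  using star_iso by (auto simp: ring_iso_def ring_hom_def)

lemma sigma_closed: "r \<in> carrier R \<Longrightarrow> \<sigma> r \<in> carrier R"
  using sigma_iso by (auto simp: ring_iso_def ring_hom_def)

lemma sigma_inv_closed: "r \<in> carrier R \<Longrightarrow> inv_into (carrier R) \<sigma> r \<in> carrier R"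
  using sigma_iso by (auto simp: ring_iso_def bij_betw_def intro: inv_into_into)

lemma sigma_sigma_inv: "r \<in> carrier R \<Longrightarrow> \<sigma> (inv_into (carrier R) \<sigma> r) = r"
  using sigma_iso by (auto simp: ring_iso_def bij_betw_def intro: f_inv_into_f)

lemma sigma_inv_sigma: "r \<in> carrier R \<Longrightarrow> inv_into (carrier R) \<sigma> (\<sigma> r) = r"
  using sigma_iso by (auto simp: ring_iso_def bij_betw_def intro: inv_into_f_f)

lemma sigma_inv_star:
  "r \<in> carrier R \<Longrightarrow> inv_into (carrier R) \<sigma> (star r) = star (inv_into (carrier R) \<sigma> r)"
  by (metis sigma_star sigma_sigma_inv sigma_inv_sigma sigma_inv_closed star_closed)

lemma gwa_rel_closed:
  "(e, f) \<in> gwa_rel R \<sigma> t \<Longrightarrow> e \<in> gwa_exprs R \<and> f \<in> gwa_exprs R"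
  by (induction rule: gwa_rel.induct) (auto simp: sigma_closed sigma_inv_closed t_closed)

lemma equiv_gwa_rel: "equiv (gwa_exprs R) (gwa_rel R \<sigma> t)"
  by (intro equivI refl_onI symI transI subsetI)
     (auto dest: gwa_rel_closed intro: gwa_rel.intros)

lemma gwa_class_eq_iff:
  assumes "e \<in> gwa_exprs R" "f \<in> gwa_exprs R"
  shows "gwa_class R \<sigma> t e = gwa_class R \<sigma> t f \<longleftrightarrow> (e, f) \<in> gwa_rel R \<sigma> t"
  using eq_equiv_class_iff[OF equiv_gwa_rel] assms by (auto simp: gwa_class_def)

lemma gwa_class_eqI: "(e, f) \<in> gwa_rel R \<sigma> t \<Longrightarrow> gwa_class R \<sigma> t e = gwa_class R \<sigma> t f"
  using gwa_class_eq_iff gwa_rel_closed by blast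

lemma carrier_gwa: "carrier (gwa R \<sigma> t) = gwa_class R \<sigma> t ` gwa_exprs R"
  by (auto simp: gwa_def gwa_class_def quotient_def)

lemma gwa_class_mult:
  assumes "e \<in> gwa_exprs R" "f \<in> gwa_exprs R"
  shows "gwa_class R \<sigma> t e \<otimes>\<^bsub>gwa R \<sigma> t\<^esub> gwa_class R \<sigma> t f = gwa_class R \<sigma> t (Times e f)"
  unfolding gwa_def monoid.simps gwa_class_def[of R \<sigma> t e] gwa_class_def[of R \<sigma> t f]
  by (rule UN_equiv_class2[OF equiv_gwa_rel equiv_gwa_rel _ assms])
     (auto intro!: congruent2I' gwa_class_eqI gwa_rel.times_cong)

lemma gwa_class_add:
  assumes "e \<in> gwa_exprs R" "f \<in> gwa_exprs R"
  shows "gwa_class R \<sigma> t e \<oplus>\<^bsub>gwa R \<sigma> t\<^esub> gwa_class R \<sigma> t f = gwa_class R \<sigma> t (Plus e f)"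
  unfolding gwa_def ring.simps gwa_class_def[of R \<sigma> t e] gwa_class_def[of R \<sigma> t f]
  by (rule UN_equiv_class2[OF equiv_gwa_rel equiv_gwa_rel _ assms])
     (auto intro!: congruent2I' gwa_class_eqI gwa_rel.plus_cong)

lemma gwa_one: "\<one>\<^bsub>gwa R \<sigma> t\<^esub> = gwa_class R \<sigma> t (Coeff \<one>)"
  and gwa_zero: "\<zero>\<^bsub>gwa R \<sigma> t\<^esub> = gwa_class R \<sigma> t (Coeff \<zero>)"
  by (simp_all add: gwa_def)

lemma ring_gwa: "ring (gwa R \<sigma> t)"
proof (rule ringI)
  show "abelian_group (gwa R \<sigma> t)"
  proof (rule abelian_groupI)
    fix x assume "x \<in> carrier (gwa R \<sigma> t)"
    then obtain e where e: "e \<in> gwa_exprs R" "x = gwa_class R \<sigma> t e"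
      by (auto simp: carrier_gwa)
    show "\<exists>y\<in>carrier (gwa R \<sigma> t). y \<oplus>\<^bsub>gwa R \<sigma> t\<^esub> x = \<zero>\<^bsub>gwa R \<sigma> t\<^esub>"
      by (rule bexI[of _ "gwa_class R \<sigma> t (Uminus e)"])
         (auto simp: e gwa_class_add gwa_zero carrier_gwa
           del: equalityI intro!: gwa_class_eqI gwa_rel.plus_uminus)
  qed (auto simp: carrier_gwa gwa_class_add gwa_zero
      del: equalityI intro!: gwa_class_eqI gwa_rel.plus_assoc gwa_rel.plus_comm gwa_rel.plus_zero)
  show "Group.monoid (gwa R \<sigma> t)"
    by (rule monoidI)
       (auto simp: carrier_gwa gwa_class_mult gwa_one
         del: equalityI intro!: gwa_class_eqI gwa_rel.times_assoc gwa_rel.times_one_left gwa_rel.times_one_right)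
qed (auto simp: carrier_gwa gwa_class_mult gwa_class_add
    del: equalityI intro!: gwa_class_eqI gwa_rel.distrib_left gwa_rel.distrib_right)

lemma Coeff_ring_hom: "(\<lambda>r. gwa_class R \<sigma> t (Coeff r)) \<in> ring_hom R (gwa R \<sigma> t)"
  by (rule ring_hom_memI)
     (auto simp: carrier_gwa gwa_class_mult gwa_class_add gwa_one
       del: equalityI intro!: gwa_class_eqI gwa_rel.sym[OF gwa_rel.coeff_plus] gwa_rel.sym[OF gwa_rel.coeff_times])

end

inductive gwa_homogeneous :: "int \<Rightarrow> 'r gwa_expr \<Rightarrow> bool" where
  "gwa_homogeneous 0 (Coeff r)"
| "gwa_homogeneous 1 GenX"
| "gwa_homogeneous (-1) GenY"
| "\<lbrakk>gwa_homogeneous n e; gwa_homogeneous n f\<rbrakk> \<Longrightarrow> gwa_homogeneous n (Plus e f)"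
| "gwa_homogeneous n e \<Longrightarrow> gwa_homogeneous n (Uminus e)"
| "\<lbrakk>gwa_homogeneous m e; gwa_homogeneous n f\<rbrakk> \<Longrightarrow> gwa_homogeneous (m + n) (Times e f)"

definition gwa_component :: "'r ring \<Rightarrow> ('r \<Rightarrow> 'r) \<Rightarrow> 'r \<Rightarrow> int \<Rightarrow> 'r gwa_expr set set" where
  "gwa_component R \<sigma> t n = gwa_class R \<sigma> t ` {e \<in> gwa_exprs R. gwa_homogeneous n e}"

primrec star_expr :: "('r \<Rightarrow> 'r) \<Rightarrow> 'r gwa_expr \<Rightarrow> 'r gwa_expr" where
  "star_expr star (Coeff r) = Coeff (star r)"
| "star_expr star GenX = GenY"
| "star_expr star GenY = GenX"
| "star_expr star (Plus e f) = Plus (star_expr star e) (star_expr star f)"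
| "star_expr star (Uminus e) = Uminus (star_expr star e)"
| "star_expr star (Times e f) = Times (star_expr star f) (star_expr star e)"

definition gwa_star ::
  "'r ring \<Rightarrow> ('r \<Rightarrow> 'r) \<Rightarrow> ('r \<Rightarrow> 'r) \<Rightarrow> 'r \<Rightarrow> 'r gwa_expr set \<Rightarrow> 'r gwa_expr set" where
  "gwa_star R star \<sigma> t P = (\<Union>e\<in>P. gwa_class R \<sigma> t (star_expr star e))"

lemma (in gwa_data) star_expr_closed: "e \<in> gwa_exprs R \<Longrightarrow> star_expr star e \<in> gwa_exprs R"
  by (induction e) (auto simp: star_closed)

lemma (in gwa_data) star_expr_rel:
  "(e, f) \<in> gwa_rel R \<sigma> t \<Longrightarrow> (star_expr star e, star_expr star f) \<in> gwa_rel R \<sigma> t"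
proof (induction rule: gwa_rel.induct)
  case (coeff_times a b)
  then show ?case
    using gwa_rel.coeff_times[of "star b" R "star a" \<sigma> t] star_iso
    by (simp add: star_closed ring_iso_def ring_hom_def m_comm)
next
  case (coeff_plus a b)
  then show ?case
    using gwa_rel.coeff_plus[of "star a" R "star b" \<sigma> t] star_iso
    by (simp add: star_closed ring_iso_def ring_hom_def)
next
  case X_Y
  then show ?case
    using gwa_rel.X_Y[of \<sigma> t R] sigma_star[OF t_closed] by (simp add: star_t)
next
  case (X_coeff r)
  then have "(Times GenY (Coeff (\<sigma> (star r))), Times (Coeff (star r)) GenY) \<in> gwa_rel R \<sigma> t"
    using gwa_rel.Y_coeff[of "\<sigma> (star r)" R \<sigma> t]
    by (simp add: sigma_closed star_closed sigma_inv_sigma)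
  then show ?case
    using X_coeff by (simp add: sigma_star gwa_rel.sym)
next
  case (Y_coeff r)
  then have "(Times GenX (Coeff (inv_into (carrier R) \<sigma> (star r))), Times (Coeff (star r)) GenX)
      \<in> gwa_rel R \<sigma> t"
    using gwa_rel.X_coeff[of "inv_into (carrier R) \<sigma> (star r)" R \<sigma> t]
    by (simp add: sigma_inv_closed star_closed sigma_sigma_inv)
  then show ?case
    using Y_coeff by (simp add: sigma_inv_star gwa_rel.sym)
next
  case (plus_zero e)
  have "star \<zero> = \<zero>"
    using star_iso ring_axioms by (auto simp: ring_iso_def intro: ring_hom_zero)
  then show ?case
    using plus_zero by (auto intro: gwa_rel.plus_zero star_expr_closed)
next
  case (plus_uminus e)
  have "star \<zero> = \<zero>"
    using star_iso ring_axioms by (auto simp: ring_iso_def intro: ring_hom_zero)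
  then show ?case
    using plus_uminus by (auto intro: gwa_rel.plus_uminus star_expr_closed)
next
  case (times_one_left e)
  have "star \<one> = \<one>"
    using star_iso by (auto simp: ring_iso_def ring_hom_def)
  then show ?case
    using times_one_left by (auto intro: gwa_rel.times_one_right star_expr_closed)
next
  case (times_one_right e)
  have "star \<one> = \<one>"
    using star_iso by (auto simp: ring_iso_def ring_hom_def)
  then show ?case
    using times_one_right by (auto intro: gwa_rel.times_one_left star_expr_closed)
qed (auto simp: star_t intro: gwa_rel.intros star_expr_closed)

lemma (in gwa_data) gwa_star_class:
  assumes "e \<in> gwa_exprs R"
  shows "gwa_star R star \<sigma> t (gwa_class R \<sigma> t e) = gwa_class R \<sigma> t (star_expr star e)"
  unfolding gwa_star_def gwa_class_def[of R \<sigma> t e]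
  by (rule UN_equiv_class[OF equiv_gwa_rel _ assms])
     (auto intro!: congruentI gwa_class_eqI star_expr_rel)

lemma (in gwa_data) gwa_star_mult:
  assumes "a \<in> carrier (gwa R \<sigma> t)" "b \<in> carrier (gwa R \<sigma> t)"
  shows "gwa_star R star \<sigma> t (a \<otimes>\<^bsub>gwa R \<sigma> t\<^esub> b) =
    gwa_star R star \<sigma> t b \<otimes>\<^bsub>gwa R \<sigma> t\<^esub> gwa_star R star \<sigma> t a"
  using assms by (auto simp: carrier_gwa gwa_class_mult gwa_star_class star_expr_closed)

lemma (in gwa_data) gwa_star_star:
  assumes "a \<in> carrier (gwa R \<sigma> t)"
  shows "gwa_star R star \<sigma> t (gwa_star R star \<sigma> t a) = a"
proof -
  have "star_expr star (star_expr star e) = e" if "e \<in> gwa_exprs R" for e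
    using that by (induction e) (auto simp: star_star)
  then show ?thesis
    using assms by (auto simp: carrier_gwa gwa_star_class star_expr_closed)
qed

section \<open>Orbits of maximal ideals and the module of residues\<close>

definition int_iterate :: "'b set \<Rightarrow> ('b \<Rightarrow> 'b) \<Rightarrow> int \<Rightarrow> 'b \<Rightarrow> 'b" where
  "int_iterate S f n = (if 0 \<le> n then f ^^ nat n else inv_into S f ^^ nat (- n))"

definition max_ideals :: "'r ring \<Rightarrow> 'r set set" where
  "max_ideals R = {m. maximalideal m R}"

definition sigma_orbits :: "'r ring \<Rightarrow> ('r \<Rightarrow> 'r) \<Rightarrow> 'r set set set" where
  "sigma_orbits R \<sigma> =
    orbits integer_group (max_ideals R) (\<lambda>n m. int_iterate (carrier R) \<sigma> n ` m)"

text \<open>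
  The direct sum of the residue fields is an \<open>R\<close>-module; the multiplicative part of the
  record is irrelevant and left unspecified.
\<close>

definition residues_module :: "'r ring \<Rightarrow> 'r set set \<Rightarrow> ('r, 'r set \<Rightarrow> 'r set) module" where
  "residues_module R \<omega> =
    \<lparr>carrier = {x \<in> \<Pi>\<^sub>E m\<in>\<omega>. carrier (R Quot m). finite {m \<in> \<omega>. x m \<noteq> \<zero>\<^bsub>R Quot m\<^esub>}},
     monoid.mult = undefined, monoid.one = undefined,
     ring.zero = (\<lambda>m\<in>\<omega>. \<zero>\<^bsub>R Quot m\<^esub>),
     ring.add = (\<lambda>x y. \<lambda>m\<in>\<omega>. x m \<oplus>\<^bsub>R Quot m\<^esub> y m),
     smult = (\<lambda>r x. \<lambda>m\<in>\<omega>. (m +>\<^bsub>R\<^esub> r) \<otimes>\<^bsub>R Quot m\<^esub> x m)\<rparr>"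

text \<open>
  The component at \<open>m\<close> of the shifted element is the image under \<open>\<sigma>\<close> of the component
  at the preimage of \<open>m\<close>; on cosets, the induced map is the direct image.
\<close>

definition residues_shift ::
  "'r ring \<Rightarrow> ('r \<Rightarrow> 'r) \<Rightarrow> 'r set set \<Rightarrow> ('r set \<Rightarrow> 'r set) \<Rightarrow> ('r set \<Rightarrow> 'r set)" where
  "residues_shift R \<sigma> \<omega> x = (\<lambda>m\<in>\<omega>. \<sigma> ` x (\<sigma> -` m \<inter> carrier R))"

definition residues_shift_power ::
  "'r ring \<Rightarrow> ('r \<Rightarrow> 'r) \<Rightarrow> 'r set set \<Rightarrow> int \<Rightarrow> ('r set \<Rightarrow> 'r set) \<Rightarrow> ('r set \<Rightarrow> 'r set)" where
  "residues_shift_power R \<sigma> \<omega> =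
    int_iterate (carrier (residues_module R \<omega>)) (residues_shift R \<sigma> \<omega>)"

section \<open>Weight modules\<close>

text \<open>The library's \<open>module\<close> requires commutative scalars.\<close>

locale left_module = A?: ring A + V?: abelian_group V
  for A :: "('a, 'c) ring_scheme" (structure)
    and V :: "('a, 'b, 'd) module_scheme" (structure) +
  assumes smult_closed: "\<lbrakk>a \<in> carrier A; v \<in> carrier V\<rbrakk> \<Longrightarrow> a \<odot>\<^bsub>V\<^esub> v \<in> carrier V"
    and smult_l_distr: "\<lbrakk>a \<in> carrier A; b \<in> carrier A; v \<in> carrier V\<rbrakk>
      \<Longrightarrow> (a \<oplus>\<^bsub>A\<^esub> b) \<odot>\<^bsub>V\<^esub> v = a \<odot>\<^bsub>V\<^esub> v \<oplus>\<^bsub>V\<^esub> b \<odot>\<^bsub>V\<^esub> v"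
    and smult_r_distr: "\<lbrakk>a \<in> carrier A; v \<in> carrier V; w \<in> carrier V\<rbrakk>
      \<Longrightarrow> a \<odot>\<^bsub>V\<^esub> (v \<oplus>\<^bsub>V\<^esub> w) = a \<odot>\<^bsub>V\<^esub> v \<oplus>\<^bsub>V\<^esub> a \<odot>\<^bsub>V\<^esub> w"
    and smult_assoc: "\<lbrakk>a \<in> carrier A; b \<in> carrier A; v \<in> carrier V\<rbrakk>
      \<Longrightarrow> (a \<otimes>\<^bsub>A\<^esub> b) \<odot>\<^bsub>V\<^esub> v = a \<odot>\<^bsub>V\<^esub> (b \<odot>\<^bsub>V\<^esub> v)"
    and smult_one: "v \<in> carrier V \<Longrightarrow> \<one>\<^bsub>A\<^esub> \<odot>\<^bsub>V\<^esub> v = v"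

definition scalar_mult ::
  "'r ring \<Rightarrow> ('r \<Rightarrow> 'r) \<Rightarrow> 'r \<Rightarrow> ('r gwa_expr set, 'v) module \<Rightarrow> 'r \<Rightarrow> 'v \<Rightarrow> 'v" where
  "scalar_mult R \<sigma> t V r v = gwa_class R \<sigma> t (Coeff r) \<odot>\<^bsub>V\<^esub> v"

definition weight_space ::
  "'r ring \<Rightarrow> ('r \<Rightarrow> 'r) \<Rightarrow> 'r \<Rightarrow> ('r gwa_expr set, 'v) module \<Rightarrow> 'r set \<Rightarrow> 'v set" where
  "weight_space R \<sigma> t V m = {v \<in> carrier V. \<forall>r\<in>m. scalar_mult R \<sigma> t V r v = \<zero>\<^bsub>V\<^esub>}"

definition weight_support ::
  "'r ring \<Rightarrow> ('r \<Rightarrow> 'r) \<Rightarrow> 'r \<Rightarrow> ('r gwa_expr set, 'v) module \<Rightarrow> 'r set set" where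
  "weight_support R \<sigma> t V = {m \<in> max_ideals R. weight_space R \<sigma> t V m \<noteq> {\<zero>\<^bsub>V\<^esub>}}"

definition weight_module ::
  "'r ring \<Rightarrow> ('r \<Rightarrow> 'r) \<Rightarrow> 'r \<Rightarrow> ('r gwa_expr set, 'v) module \<Rightarrow> bool" where
  "weight_module R \<sigma> t V \<longleftrightarrow>
    left_module (gwa R \<sigma> t) V \<and>
    (\<forall>v\<in>carrier V. \<exists>!c. c \<in> (\<Pi>\<^sub>E m\<in>max_ideals R. weight_space R \<sigma> t V m) \<and>
      finite {m \<in> max_ideals R. c m \<noteq> \<zero>\<^bsub>V\<^esub>} \<and>
      v = finsum V c {m \<in> max_ideals R. c m \<noteq> \<zero>\<^bsub>V\<^esub>})"

text \<open>
  Since \<open>R\<close> acts on the weight space of \<open>m\<close> through \<open>R/m\<close>, its \<open>R/m\<close>-linear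
  combinations are the same as its \<open>R\<close>-linear combinations. Finite dimension is needed for
  a non-degenerate form to induce a surjection onto the dual: over a field \<open>R\<close> with
  \<open>\<sigma>\<close> and \<open>*\<close> trivial, \<open>t = 1\<close> and \<open>X\<close> acting as the identity, the dual is the
  full linear dual, which is strictly larger in infinite dimension.
\<close>

definition finite_dim_weight_space ::
  "'r ring \<Rightarrow> ('r \<Rightarrow> 'r) \<Rightarrow> 'r \<Rightarrow> ('r gwa_expr set, 'v) module \<Rightarrow> 'r set \<Rightarrow> bool" where
  "finite_dim_weight_space R \<sigma> t V m \<longleftrightarrow>
    (\<exists>B. finite B \<and> B \<subseteq> weight_space R \<sigma> t V m \<and>
      (\<forall>v\<in>weight_space R \<sigma> t V m. \<exists>c\<in>B \<rightarrow> carrier R.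
        v = finsum V (\<lambda>b. scalar_mult R \<sigma> t V (c b) b) B))"

section \<open>Admissible forms\<close>

definition admissible_forms ::
  "'r ring \<Rightarrow> ('r \<Rightarrow> 'r) \<Rightarrow> ('r \<Rightarrow> 'r) \<Rightarrow> 'r \<Rightarrow> 'r set set \<Rightarrow> ('r gwa_expr set, 'v) module
    \<Rightarrow> ('v \<times> 'v \<Rightarrow> 'r set \<Rightarrow> 'r set) set" where
  "admissible_forms R star \<sigma> t \<omega> V =
    {F \<in> carrier V \<times> carrier V \<rightarrow>\<^sub>E carrier (residues_module R \<omega>).
      (\<forall>u\<in>carrier V. \<forall>v\<in>carrier V. \<forall>w\<in>carrier V.
        F (u \<oplus>\<^bsub>V\<^esub> v, w) = F (u, w) \<oplus>\<^bsub>residues_module R \<omega>\<^esub> F (v, w)) \<and>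
      (\<forall>u\<in>carrier V. \<forall>v\<in>carrier V. \<forall>w\<in>carrier V.
        F (u, v \<oplus>\<^bsub>V\<^esub> w) = F (u, v) \<oplus>\<^bsub>residues_module R \<omega>\<^esub> F (u, w)) \<and>
      (\<forall>r\<in>carrier R. \<forall>v\<in>carrier V. \<forall>w\<in>carrier V.
        F (scalar_mult R \<sigma> t V r v, w) = r \<odot>\<^bsub>residues_module R \<omega>\<^esub> F (v, w)) \<and>
      (\<forall>n. \<forall>a\<in>gwa_component R \<sigma> t n. \<forall>v\<in>carrier V. \<forall>w\<in>carrier V.
        F (a \<odot>\<^bsub>V\<^esub> v, w) =
          residues_shift_power R \<sigma> \<omega> n (F (v, gwa_star R star \<sigma> t a \<odot>\<^bsub>V\<^esub> w)))}"

definition admissible_form_group ::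
  "'r ring \<Rightarrow> ('r \<Rightarrow> 'r) \<Rightarrow> ('r \<Rightarrow> 'r) \<Rightarrow> 'r \<Rightarrow> 'r set set \<Rightarrow> ('r gwa_expr set, 'v) module
    \<Rightarrow> ('v \<times> 'v \<Rightarrow> 'r set \<Rightarrow> 'r set) monoid" where
  "admissible_form_group R star \<sigma> t \<omega> V =
    \<lparr>carrier = admissible_forms R star \<sigma> t \<omega> V,
     monoid.mult = (\<lambda>F G. \<lambda>x\<in>carrier V \<times> carrier V. F x \<oplus>\<^bsub>residues_module R \<omega>\<^esub> G x),
     monoid.one = (\<lambda>x\<in>carrier V \<times> carrier V. \<zero>\<^bsub>residues_module R \<omega>\<^esub>)\<rparr>"

definition nondegenerate ::
  "'r ring \<Rightarrow> 'r set set \<Rightarrow> ('r gwa_expr set, 'v) module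
    \<Rightarrow> ('v \<times> 'v \<Rightarrow> 'r set \<Rightarrow> 'r set) \<Rightarrow> bool" where
  "nondegenerate R \<omega> V F \<longleftrightarrow>
    (\<forall>v\<in>carrier V. v \<noteq> \<zero>\<^bsub>V\<^esub> \<longrightarrow>
      (\<exists>w\<^sub>1\<in>carrier V. \<exists>w\<^sub>2\<in>carrier V.
        F (w\<^sub>1, v) \<noteq> \<zero>\<^bsub>residues_module R \<omega>\<^esub> \<and> F (v, w\<^sub>2) \<noteq> \<zero>\<^bsub>residues_module R \<omega>\<^esub>))"

section \<open>The finitistic dual\<close>

definition finitistic_functionals ::
  "'r ring \<Rightarrow> ('r \<Rightarrow> 'r) \<Rightarrow> ('r \<Rightarrow> 'r) \<Rightarrow> 'r \<Rightarrow> 'r set set \<Rightarrow> ('r gwa_expr set, 'v) module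
    \<Rightarrow> ('v \<Rightarrow> 'r set \<Rightarrow> 'r set) set" where
  "finitistic_functionals R star \<sigma> t \<omega> V =
    {\<phi> \<in> carrier V \<rightarrow>\<^sub>E carrier (residues_module R \<omega>).
      (\<forall>v\<in>carrier V. \<forall>w\<in>carrier V.
        \<phi> (v \<oplus>\<^bsub>V\<^esub> w) = \<phi> v \<oplus>\<^bsub>residues_module R \<omega>\<^esub> \<phi> w) \<and>
      (\<forall>r\<in>carrier R. \<forall>v\<in>carrier V.
        \<phi> (scalar_mult R \<sigma> t V r v) = star r \<odot>\<^bsub>residues_module R \<omega>\<^esub> \<phi> v) \<and>
      finite {m \<in> \<omega>. \<exists>v\<in>weight_space R \<sigma> t V m. \<phi> v \<noteq> \<zero>\<^bsub>residues_module R \<omega>\<^esub>}}"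

text \<open>The action is prescribed on the generators; this is its extension to all expressions.\<close>

primrec dual_action ::
  "'r ring \<Rightarrow> ('r \<Rightarrow> 'r) \<Rightarrow> ('r \<Rightarrow> 'r) \<Rightarrow> 'r \<Rightarrow> 'r set set \<Rightarrow> ('r gwa_expr set, 'v) module
    \<Rightarrow> 'r gwa_expr \<Rightarrow> ('v \<Rightarrow> 'r set \<Rightarrow> 'r set) \<Rightarrow> ('v \<Rightarrow> 'r set \<Rightarrow> 'r set)" where
  "dual_action R star \<sigma> t \<omega> V (Coeff r) =
    (\<lambda>\<phi>. \<lambda>v\<in>carrier V. \<phi> (scalar_mult R \<sigma> t V (star r) v))"
| "dual_action R star \<sigma> t \<omega> V GenX =
    (\<lambda>\<phi>. \<lambda>v\<in>carrier V.
      residues_shift_power R \<sigma> \<omega> 1 (\<phi> (gwa_class R \<sigma> t GenY \<odot>\<^bsub>V\<^esub> v)))"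
| "dual_action R star \<sigma> t \<omega> V GenY =
    (\<lambda>\<phi>. \<lambda>v\<in>carrier V.
      residues_shift_power R \<sigma> \<omega> (-1) (\<phi> (gwa_class R \<sigma> t GenX \<odot>\<^bsub>V\<^esub> v)))"
| "dual_action R star \<sigma> t \<omega> V (Plus e f) =
    (\<lambda>\<phi>. \<lambda>v\<in>carrier V. dual_action R star \<sigma> t \<omega> V e \<phi> v
      \<oplus>\<^bsub>residues_module R \<omega>\<^esub> dual_action R star \<sigma> t \<omega> V f \<phi> v)"
| "dual_action R star \<sigma> t \<omega> V (Uminus e) =
    (\<lambda>\<phi>. \<lambda>v\<in>carrier V. \<ominus>\<^bsub>residues_module R \<omega>\<^esub> dual_action R star \<sigma> t \<omega> V e \<phi> v)"
| "dual_action R star \<sigma> t \<omega> V (Times e f) =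
    (\<lambda>\<phi>. dual_action R star \<sigma> t \<omega> V e (dual_action R star \<sigma> t \<omega> V f \<phi>))"

text \<open>
  On functionals in the dual all representatives of an element of the algebra act alike, so
  \<open>the_elem\<close> selects their common value.
\<close>

definition finitistic_dual ::
  "'r ring \<Rightarrow> ('r \<Rightarrow> 'r) \<Rightarrow> ('r \<Rightarrow> 'r) \<Rightarrow> 'r \<Rightarrow> 'r set set \<Rightarrow> ('r gwa_expr set, 'v) module
    \<Rightarrow> ('r gwa_expr set, 'v \<Rightarrow> 'r set \<Rightarrow> 'r set) module" where
  "finitistic_dual R star \<sigma> t \<omega> V =
    \<lparr>carrier = finitistic_functionals R star \<sigma> t \<omega> V,
     monoid.mult = undefined, monoid.one = undefined,
     ring.zero = (\<lambda>v\<in>carrier V. \<zero>\<^bsub>residues_module R \<omega>\<^esub>),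
     ring.add = (\<lambda>\<phi> \<psi>. \<lambda>v\<in>carrier V. \<phi> v \<oplus>\<^bsub>residues_module R \<omega>\<^esub> \<psi> v),
     smult = (\<lambda>P \<phi>. the_elem ((\<lambda>e. dual_action R star \<sigma> t \<omega> V e \<phi>) ` P))\<rparr>"

section \<open>Module homomorphisms\<close>

definition left_module_hom ::
  "'a ring \<Rightarrow> ('a, 'v) module \<Rightarrow> ('a, 'w) module \<Rightarrow> ('v \<Rightarrow> 'w) set" where
  "left_module_hom A V W =
    {h \<in> carrier V \<rightarrow>\<^sub>E carrier W.
      (\<forall>v\<in>carrier V. \<forall>w\<in>carrier V. h (v \<oplus>\<^bsub>V\<^esub> w) = h v \<oplus>\<^bsub>W\<^esub> h w) \<and>
      (\<forall>a\<in>carrier A. \<forall>v\<in>carrier V. h (a \<odot>\<^bsub>V\<^esub> v) = a \<odot>\<^bsub>W\<^esub> h v)}"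

definition left_module_hom_group ::
  "'a ring \<Rightarrow> ('a, 'v) module \<Rightarrow> ('a, 'w) module \<Rightarrow> ('v \<Rightarrow> 'w) monoid" where
  "left_module_hom_group A V W =
    \<lparr>carrier = left_module_hom A V W,
     monoid.mult = (\<lambda>g h. \<lambda>v\<in>carrier V. g v \<oplus>\<^bsub>W\<^esub> h v),
     monoid.one = (\<lambda>v\<in>carrier V. \<zero>\<^bsub>W\<^esub>)\<rparr>"

definition left_module_iso ::
  "'a ring \<Rightarrow> ('a, 'v) module \<Rightarrow> ('a, 'w) module \<Rightarrow> ('v \<Rightarrow> 'w) set" where
  "left_module_iso A V W = {h \<in> left_module_hom A V W. bij_betw h (carrier V) (carrier W)}"

definition form_to_hom ::
  "('r gwa_expr set, 'v) module \<Rightarrow> ('v \<times> 'v \<Rightarrow> 'r set \<Rightarrow> 'r set)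
    \<Rightarrow> 'v \<Rightarrow> 'v \<Rightarrow> 'r set \<Rightarrow> 'r set" where
  "form_to_hom V F = (\<lambda>u\<in>carrier V. \<lambda>v\<in>carrier V. F (u, v))"

end

(* By admissibility a form F is determined by, and amounts to, its action on the generators of the
   algebra, and the conditions on the generators say precisely that u |-> F(u, .) commutes with r, X
   and Y acting on the dual. That F(u, .) has finite support is a statement about weight vectors u:
   if u has weight n and v weight m, then F(u,v) is killed by n and by m^*, so it vanishes unless
   n = m^*.

   If F induces an isomorphism, left non-degeneracy is injectivity. For the other side one needs a
   functional that does not vanish at a given v /= 0: by Zorn there is a maximal R-submodule W avoiding
   v, and then V = W + R v with V/W one-dimensional over some R/m, m in the orbit; the functional reads
   off the conjugated coefficient of v. It takes values in R/m^*, which occurs in R_omega because the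
   orbit is closed under * as soon as V has one nonzero functional.

   Conversely, if F is non-degenerate, then V_{m^*} is a space of functionals on V_m that separates
   points, hence consists of all of them when V_m is finite dimensional; a functional is supported on
   finitely many V_m and the representing vectors can be added up. *)
theory Submission
  imports Defs
begin

section \<open>Iterates of a bijection\<close>

text \<open>Elements of the algebra are classes of expressions and the dual is acted on through
  expressions, so its scalar multiplication has a usable value only once every defining relation has
  been checked on functionals. Signed powers of the shift behave as powers because the shift is a
  bijection of the residue module; hence the separate treatment of iterates of a bijection. Vectors
  are hardly ever decomposed into weight components. A property of vectors is turned into an
  R-submodule of V that contains all weight spaces and therefore equals V. This bounds supports,
  compares functionals and locates vectors in a sum of submodules. Residue fields are avoided as
  scalar fields in the same spirit: their elements are replaced by ring elements, determined up to
  the maximal ideal. No basis of a weight space is chosen. A maximal submodule avoiding v replaces a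
  basis through v, and the separation argument in finite dimension works with spanning families that
  may be dependent.\<close>

lemma int_iterate_0 [simp]: "int_iterate S f 0 x = x"
  by (simp add: int_iterate_def)

lemma int_iterate_1 [simp]: "int_iterate S f 1 x = f x"
  by (simp add: int_iterate_def)

context
  fixes S :: "'b set" and f :: "'b \<Rightarrow> 'b"
  assumes bij: "bij_betw f S S"
begin

lemma inv_into_mem_bij: "x \<in> S \<Longrightarrow> inv_into S f x \<in> S"
  using bij by (auto simp: bij_betw_def intro: inv_into_into)

lemma f_inv_into_bij: "x \<in> S \<Longrightarrow> f (inv_into S f x) = x"
  using bij by (auto simp: bij_betw_def intro: f_inv_into_f)

lemma inv_into_f_bij: "x \<in> S \<Longrightarrow> inv_into S f (f x) = x"
  using bij by (auto simp: bij_betw_def intro: inv_into_f_f)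

lemma f_mem_bij: "x \<in> S \<Longrightarrow> f x \<in> S"
  using bij by (auto simp: bij_betw_def)

lemma int_iterate_closed: "x \<in> S \<Longrightarrow> int_iterate S f n x \<in> S"
proof -
  assume x: "x \<in> S"
  have "(f ^^ k) x \<in> S" "(inv_into S f ^^ k) x \<in> S" for k
    by (induction k) (simp_all add: x f_mem_bij inv_into_mem_bij)
  then show ?thesis
    by (simp add: int_iterate_def)
qed

text \<open>The definition treats positive and negative exponents by different formulas; this
  recursion joins them, so that later facts follow by induction on integers in both
  directions.\<close>

lemma int_iterate_succ:
  assumes "x \<in> S"
  shows "int_iterate S f (n + 1) x = f (int_iterate S f n x)"
proof (cases "0 \<le> n")
  case True
  then have "nat (n + 1) = Suc (nat n)"
    by simp
  then show ?thesis
    using True by (simp add: int_iterate_def)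
next
  case False
  \<comment> \<open>With n = -(k+1) the exponent n+1 is -k, and one application of \<open>f\<close>
    cancels the outermost inverse, since the iterates stay in \<open>S\<close>.\<close>
  then obtain k where n: "n = - int (Suc k)"
    by (metis int_cases not_le of_nat_0_le_iff)
  have "int_iterate S f (- int k) x = (inv_into S f ^^ k) x"
    by (cases "k = 0") (simp_all add: int_iterate_def)
  moreover have "(inv_into S f ^^ k) x \<in> S"
    by (induction k) (simp_all add: assms inv_into_mem_bij)
  moreover have "nat (int k + 1) = Suc k"
    by simp
  ultimately show ?thesis
    by (simp add: n f_inv_into_bij) (simp add: int_iterate_def f_inv_into_bij)
qed

lemma int_iterate_pred:
  assumes "x \<in> S"
  shows "int_iterate S f (n - 1) x = inv_into S f (int_iterate S f n x)"
  using int_iterate_succ[OF assms, of "n - 1"]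
  by (simp add: assms int_iterate_closed inv_into_f_bij)

lemma int_iterate_add:
  assumes "x \<in> S"
  shows "int_iterate S f (m + n) x = int_iterate S f m (int_iterate S f n x)"
proof (induction m rule: int_induct[where k = 0])
  case (step1 i)
  then show ?case
    using int_iterate_succ[OF assms, of "i + n"] int_iterate_succ[OF int_iterate_closed[OF assms], of i n]
    by (simp add: add.commute add.left_commute)
next
  case (step2 i)
  then show ?case
    using int_iterate_pred[OF assms, of "i + n"] int_iterate_pred[OF int_iterate_closed[OF assms], of i n]
    by (simp add: diff_add_eq)
qed simp

text \<open>The inverse of a bijection compatible with \<open>g\<close> is again compatible with
  \<open>g\<close>, so the induction also runs downwards. With \<open>g\<close> the addition of
  residues, all powers of the shift become additive.\<close>

lemma int_iterate_hom:
  assumes g: "\<And>x y. x \<in> S \<Longrightarrow> y \<in> S \<Longrightarrow> g x y \<in> S"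
    and f: "\<And>x y. x \<in> S \<Longrightarrow> y \<in> S \<Longrightarrow> f (g x y) = g (f x) (f y)"
    and xy: "x \<in> S" "y \<in> S"
  shows "int_iterate S f n (g x y) = g (int_iterate S f n x) (int_iterate S f n y)"
proof (induction n rule: int_induct[where k = 0])
  case (step1 i)
  then show ?case
    by (simp add: int_iterate_succ int_iterate_closed g f xy)
next
  case (step2 i)
  have "inv_into S f (g a b) = g (inv_into S f a) (inv_into S f b)" if "a \<in> S" "b \<in> S" for a b
    using that f[of "inv_into S f a" "inv_into S f b"] inv_into_f_bij
    by (metis f_inv_into_bij g inv_into_mem_bij)
  then show ?case
    using step2 by (simp add: int_iterate_pred int_iterate_closed g xy)
qed simp

end

section \<open>Additive maps and maximal ideals\<close>

text \<open>Formulated for bare functions so that it applies alike to \<open>star\<close>, to scalar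
  multiplication in either variable, to functionals, to the shift and to each argument of a
  form.\<close>

lemma additive_zero:
  assumes "abelian_group G" "abelian_group H"
    and "\<And>x. x \<in> carrier G \<Longrightarrow> h x \<in> carrier H"
    and "\<And>x y. x \<in> carrier G \<Longrightarrow> y \<in> carrier G \<Longrightarrow> h (x \<oplus>\<^bsub>G\<^esub> y) = h x \<oplus>\<^bsub>H\<^esub> h y"
  shows "h \<zero>\<^bsub>G\<^esub> = \<zero>\<^bsub>H\<^esub>"
proof -
  interpret G: abelian_group G by fact
  interpret H: abelian_group H by fact
  have "h \<zero>\<^bsub>G\<^esub> \<oplus>\<^bsub>H\<^esub> h \<zero>\<^bsub>G\<^esub> = h \<zero>\<^bsub>G\<^esub>"
    using assms(4)[of "\<zero>\<^bsub>G\<^esub>" "\<zero>\<^bsub>G\<^esub>"] by simp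
  then show ?thesis
    using assms(3)[of "\<zero>\<^bsub>G\<^esub>"] H.add.r_cancel_one by simp
qed

lemma additive_uminus:
  assumes "abelian_group G" "abelian_group H"
    and "\<And>x. x \<in> carrier G \<Longrightarrow> h x \<in> carrier H"
    and "\<And>x y. x \<in> carrier G \<Longrightarrow> y \<in> carrier G \<Longrightarrow> h (x \<oplus>\<^bsub>G\<^esub> y) = h x \<oplus>\<^bsub>H\<^esub> h y"
    and "x \<in> carrier G"
  shows "h (\<ominus>\<^bsub>G\<^esub> x) = \<ominus>\<^bsub>H\<^esub> h x"
proof -
  interpret G: abelian_group G by fact
  interpret H: abelian_group H by fact
  have "h (\<ominus>\<^bsub>G\<^esub> x) \<oplus>\<^bsub>H\<^esub> h x = \<zero>\<^bsub>H\<^esub>"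
    using assms(4)[of "\<ominus>\<^bsub>G\<^esub> x" x] additive_zero[of G H h] assms by (simp add: G.l_neg)
  then show ?thesis
    using assms(3,5) by (metis G.a_inv_closed H.minus_equality)
qed

text \<open>The image under a bijection is the preimage under its inverse, and preimages of ideals
  under ring homomorphisms are ideals.\<close>

lemma (in ring) ring_iso_image_ideal:
  assumes h: "h \<in> ring_iso R R" and "ideal I R"
  shows "ideal (h ` I) R"
proof -
  interpret h: ring_hom_ring R R h
    using h by (auto simp: ring_iso_def intro!: ring_hom_ringI2 ring_axioms)
  let ?k = "inv_into (carrier R) h"
  have k: "?k \<in> ring_iso R R"
    by (rule ring_iso_set_sym[OF ring_axioms h])
  interpret k: ring_hom_ring R R ?k
    using k by (auto simp: ring_iso_def intro!: ring_hom_ringI2 ring_axioms)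
  have bij: "bij_betw h (carrier R) (carrier R)"
    using h by (simp add: ring_iso_def)
  have "I \<subseteq> carrier R"
    using assms(2) by (simp add: ideal.Icarr subsetI)
  then have "h ` I \<subseteq> {r \<in> carrier R. ?k r \<in> I}"
    using inv_into_f_bij[OF bij] by auto
  moreover have "{r \<in> carrier R. ?k r \<in> I} \<subseteq> h ` I"
    using f_inv_into_bij[OF bij] by (auto intro: image_eqI[OF HOL.sym])
  ultimately have "h ` I = {r \<in> carrier R. ?k r \<in> I}"
    by (rule subset_antisym)
  then show ?thesis
    using k.ideal_vimage[OF assms(2)] by simp
qed

text \<open>An ideal above the image of \<open>I\<close> is carried by the inverse automorphism to
  an ideal above \<open>I\<close>, where maximality of \<open>I\<close> decides.\<close>

lemma (in ring) ring_iso_image_maximalideal: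
  assumes h: "h \<in> ring_iso R R" and "maximalideal I R"
  shows "maximalideal (h ` I) R"
proof -
  interpret I: maximalideal I R by fact
  let ?k = "inv_into (carrier R) h"
  have k: "?k \<in> ring_iso R R"
    by (rule ring_iso_set_sym[OF ring_axioms h])
  have bij: "bij_betw h (carrier R) (carrier R)"
    using h by (simp add: ring_iso_def)
  have kh: "?k ` h ` J = J" and hk: "h ` ?k ` J = J" if "J \<subseteq> carrier R" for J
    using that inv_into_f_bij[OF bij] f_inv_into_bij[OF bij] by (force simp: image_iff subset_iff)+
  have him: "h ` carrier R = carrier R"
    using bij by (simp add: bij_betw_def)
  have Isub: "I \<subseteq> carrier R"
    by (simp add: I.Icarr subsetI)
  show ?thesis
  proof (rule maximalidealI)
    show "ideal (h ` I) R"
      by (rule ring_iso_image_ideal[OF h I.is_ideal])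
    show "carrier R \<noteq> h ` I"
      using kh[OF Isub] kh[of "carrier R"] him I.I_notcarr by auto
  next
    fix J assume J: "ideal J R" "h ` I \<subseteq> J" "J \<subseteq> carrier R"
    have "I \<subseteq> ?k ` J"
      using J(2) kh[OF Isub] by blast
    moreover have "?k ` J \<subseteq> carrier R"
      using J(3) inv_into_mem_bij[OF bij] by blast
    ultimately have "?k ` J = I \<or> ?k ` J = carrier R"
      using I.I_maximal[OF ring_iso_image_ideal[OF k J(1)]] by simp
    then show "J = h ` I \<or> J = carrier R"
      using hk[OF J(3)] him by auto
  qed
qed

text \<open>Because zero is the coset \<open>I\<close> itself, vanishing of a component of a residue
  family is written \<open>x m = m\<close> from here on.\<close>

lemma zero_FactRing: "\<zero>\<^bsub>R Quot I\<^esub> = I"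
  by (simp add: FactRing_def)

lemma carrier_FactRing: "carrier (R Quot I) = (\<lambda>r. I +>\<^bsub>R\<^esub> r) ` carrier R"
  by (auto simp: FactRing_def A_RCOSETS_def')

text \<open>Invertibility in the residue field, phrased with representatives because what acts on a
  weight space is an element of \<open>R\<close> and not a residue.\<close>

lemma (in cring) maximalideal_inverse:
  assumes "maximalideal m R" "r \<in> carrier R" "r \<notin> m"
  obtains s where "s \<in> carrier R" "m +> s \<otimes> r = m +> \<one>"
proof -
  interpret m: maximalideal m R by fact
  interpret K: field "R Quot m"
    by (rule m.quotient_is_field[OF is_cring])
  interpret h: ring_hom_ring R "R Quot m" "(+>) m"
    by (rule m.rcos_ring_hom_ring)
  have "m +> r \<noteq> m"
    using m.a_rcos_self[OF assms(2)] assms(3) by auto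
  then have "m +> r \<in> Units (R Quot m)"
    using h.hom_closed[OF assms(2)] unfolding K.field_Units zero_FactRing by blast
  then obtain y where y: "y \<in> carrier (R Quot m)" "y \<otimes>\<^bsub>R Quot m\<^esub> (m +> r) = \<one>\<^bsub>R Quot m\<^esub>"
    by (auto simp: Units_def)
  then obtain s where "s \<in> carrier R" "y = m +> s"
    unfolding carrier_FactRing by blast
  then show thesis
    using y(2) assms(2) by (intro that[of s]) simp_all
qed

text \<open>Maximality forbids a proper inclusion between the two ideals. The element obtained is
  zero in one residue field and invertible in the other.\<close>

lemma (in cring) maximalideal_separate:
  assumes "maximalideal m R" "maximalideal n R" "m \<noteq> n"
  obtains r where "r \<in> m" "r \<in> carrier R" "r \<notin> n"
proof -
  interpret m: maximalideal m R by fact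
  interpret n: maximalideal n R by fact
  have "\<not> m \<subseteq> n"
  proof
    assume "m \<subseteq> n"
    then have "n = m \<or> n = carrier R"
      by (intro m.I_maximal n.is_ideal) (auto intro: n.Icarr)
    then show False
      using assms(3) n.I_notcarr by blast
  qed
  then show thesis
    using that m.Icarr by blast
qed

section \<open>The module of residues\<close>

locale gwa_orbit = gwa_data R star \<sigma> t for R :: "'r ring" (structure) and star \<sigma> t +
  fixes \<omega> :: "'r set set"
  assumes orbit: "\<omega> \<in> sigma_orbits R \<sigma>"
begin

abbreviation M where "M \<equiv> residues_module R \<omega>"
abbreviation \<tau> where "\<tau> \<equiv> inv_into (carrier R) \<sigma>"
abbreviation shift where "shift \<equiv> residues_shift_power R \<sigma> \<omega>"

section \<open>The orbit, its maximal ideals and the induced maps on them\<close>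

lemma bij_sigma: "bij_betw \<sigma> (carrier R) (carrier R)"
  using sigma_iso by (simp add: ring_iso_def)

lemma tau_iso: "\<tau> \<in> ring_iso R R"
  by (rule ring_iso_set_sym[OF ring_axioms sigma_iso])

lemma sigma_mult: "a \<in> carrier R \<Longrightarrow> b \<in> carrier R \<Longrightarrow> \<sigma> (a \<otimes> b) = \<sigma> a \<otimes> \<sigma> b"
  and sigma_add: "a \<in> carrier R \<Longrightarrow> b \<in> carrier R \<Longrightarrow> \<sigma> (a \<oplus> b) = \<sigma> a \<oplus> \<sigma> b"
  and star_mult: "a \<in> carrier R \<Longrightarrow> b \<in> carrier R \<Longrightarrow> star (a \<otimes> b) = star a \<otimes> star b"
  and star_add: "a \<in> carrier R \<Longrightarrow> b \<in> carrier R \<Longrightarrow> star (a \<oplus> b) = star a \<oplus> star b"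
  and star_one: "star \<one> = \<one>"
  using sigma_iso star_iso by (auto simp: ring_iso_def ring_hom_def)

lemma star_minus: "a \<in> carrier R \<Longrightarrow> star (\<ominus> a) = \<ominus> star a"
  and star_zero: "star \<zero> = \<zero>"
  using additive_uminus[OF abelian_group_axioms abelian_group_axioms star_closed star_add]
    additive_zero[OF abelian_group_axioms abelian_group_axioms star_closed star_add] by blast+

lemma orbit_eq:
  obtains m0 where "maximalideal m0 R" "\<omega> = range (\<lambda>n. int_iterate (carrier R) \<sigma> n ` m0)"
  using orbit unfolding sigma_orbits_def orbits_def orbit_def max_ideals_def by auto

lemma image_iterate:
  assumes "m0 \<subseteq> carrier R"
  shows "\<sigma> ` int_iterate (carrier R) \<sigma> n ` m0 = int_iterate (carrier R) \<sigma> (n + 1) ` m0"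
    and "\<tau> ` int_iterate (carrier R) \<sigma> n ` m0 = int_iterate (carrier R) \<sigma> (n - 1) ` m0"
proof -
  have "r \<in> carrier R" if "r \<in> m0" for r
    using that assms by blast
  then show "\<sigma> ` int_iterate (carrier R) \<sigma> n ` m0 = int_iterate (carrier R) \<sigma> (n + 1) ` m0"
    and "\<tau> ` int_iterate (carrier R) \<sigma> n ` m0 = int_iterate (carrier R) \<sigma> (n - 1) ` m0"
    unfolding image_image
    by (simp_all add: int_iterate_succ[OF bij_sigma] int_iterate_pred[OF bij_sigma] cong: image_cong)
qed

lemma maximalideal_subset: "maximalideal m R \<Longrightarrow> m \<subseteq> carrier R"
  by (meson additive_subgroup.a_subset ideal.axioms(1) maximalideal.axioms(1))

lemma omega_sigma: "m \<in> \<omega> \<Longrightarrow> \<sigma> ` m \<in> \<omega>"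
  and omega_tau: "m \<in> \<omega> \<Longrightarrow> \<tau> ` m \<in> \<omega>"
  by (rule orbit_eq, use image_iterate maximalideal_subset in force)+

text \<open>Any two points of an orbit are joined by steps of \<sigma> and \<tau>. This spreads
  maximality from the base point, and closure under \<open>star\<close> from a single ideal, to the
  whole orbit.\<close>

lemma omega_induct:
  assumes m: "m \<in> \<omega>" "P m" and k: "k \<in> \<omega>"
    and \<sigma>: "\<And>m. m \<in> \<omega> \<Longrightarrow> P m \<Longrightarrow> P (\<sigma> ` m)"
    and \<tau>: "\<And>m. m \<in> \<omega> \<Longrightarrow> P m \<Longrightarrow> P (\<tau> ` m)"
  shows "P k"
proof (rule orbit_eq)
  fix m0 assume m0: "maximalideal m0 R" and \<omega>: "\<omega> = range (\<lambda>n. int_iterate (carrier R) \<sigma> n ` m0)"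
  obtain n where n: "m = int_iterate (carrier R) \<sigma> n ` m0"
    using m(1) \<omega> by auto
  obtain l where l: "k = int_iterate (carrier R) \<sigma> l ` m0"
    using k \<omega> by auto
  have "P (int_iterate (carrier R) \<sigma> l ` m0)"
  \<comment> \<open>The induction starts at n, the position of \<open>m\<close> relative to
    \<open>m0\<close>, and runs in both directions to the position l of \<open>k\<close>.\<close>
  proof (induction l rule: int_induct[where k = n])
    case base
    then show ?case
      using m(2) n by simp
  next
    case (step1 i)
    then show ?case
      using \<sigma>[of "int_iterate (carrier R) \<sigma> i ` m0"] image_iterate(1)[OF maximalideal_subset[OF m0]]
      by (simp add: \<omega>)
  next
    case (step2 i)
    then show ?case
      using \<tau>[of "int_iterate (carrier R) \<sigma> i ` m0"] image_iterate(2)[OF maximalideal_subset[OF m0]]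
      by (simp add: \<omega>)
  qed
  then show "P k"
    by (simp add: l)
qed

lemma omega_maximal: "m \<in> \<omega> \<Longrightarrow> maximalideal m R"
proof (rule orbit_eq)
  fix m0 assume m: "m \<in> \<omega>"
    and m0: "maximalideal m0 R" and \<omega>: "\<omega> = range (\<lambda>n. int_iterate (carrier R) \<sigma> n ` m0)"
  have "m0 \<in> \<omega>"
    unfolding \<omega> by (rule range_eqI[of _ _ 0]) simp
  then show "maximalideal m R"
    using m0 m ring_iso_image_maximalideal[OF sigma_iso] ring_iso_image_maximalideal[OF tau_iso]
    by (rule omega_induct)
qed

lemma omega_subset: "m \<in> \<omega> \<Longrightarrow> m \<subseteq> carrier R"
  by (simp add: maximalideal_subset omega_maximal)

lemma star_image_maximal: "m \<in> \<omega> \<Longrightarrow> maximalideal (star ` m) R"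
  by (rule ring_iso_image_maximalideal[OF star_iso omega_maximal])

lemma omega_ideal: "m \<in> \<omega> \<Longrightarrow> ideal m R"
  by (meson omega_maximal maximalideal.axioms(1))

text \<open>The shift is defined through preimages, whereas the orbit is closed under images; this
  translates one description into the other.\<close>

lemma sigma_vimage:
  assumes "m \<subseteq> carrier R"
  shows "\<sigma> -` m \<inter> carrier R = \<tau> ` m" "\<tau> -` m \<inter> carrier R = \<sigma> ` m"
proof -
  have "x \<in> \<tau> ` m" if "\<sigma> x \<in> m" "x \<in> carrier R" for x
    using imageI[OF that(1), of \<tau>] that(2) by (simp add: sigma_inv_sigma)
  then show "\<sigma> -` m \<inter> carrier R = \<tau> ` m"
    using assms sigma_sigma_inv sigma_inv_closed by auto
  have "x \<in> \<sigma> ` m" if "\<tau> x \<in> m" "x \<in> carrier R" for x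
    using imageI[OF that(1), of \<sigma>] that(2) by (simp add: sigma_sigma_inv)
  then show "\<tau> -` m \<inter> carrier R = \<sigma> ` m"
    using assms sigma_inv_sigma sigma_closed by auto
qed

lemma sigma_tau_image:
  assumes "m \<subseteq> carrier R"
  shows "\<sigma> ` \<tau> ` m = m" "\<tau> ` \<sigma> ` m = m"
proof -
  have "\<sigma> ` \<tau> ` m = id ` m" "\<tau> ` \<sigma> ` m = id ` m"
    unfolding image_image
    using assms by (auto intro!: image_cong simp: subset_iff sigma_sigma_inv sigma_inv_sigma)
  then show "\<sigma> ` \<tau> ` m = m" "\<tau> ` \<sigma> ` m = m"
    by simp_all
qed

lemma star_star_image: "m \<subseteq> carrier R \<Longrightarrow> star ` star ` m = m"
  unfolding image_image using star_star by (force simp: image_iff subset_iff)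

lemma image_coset:
  assumes "h \<in> ring_iso R R" "m \<subseteq> carrier R" "r \<in> carrier R"
  shows "h ` (m +> r) = h ` m +> h r"
proof -
  have "h (a \<oplus> r) = h a \<oplus> h r" if "a \<in> m" for a
    using that assms by (auto simp: ring_iso_def ring_hom_def)
  then show ?thesis
    unfolding a_r_coset_def' by force
qed

section \<open>Componentwise structure of the residue module\<close>

lemma carrier_M:
  "x \<in> carrier M \<longleftrightarrow> x \<in> extensional \<omega> \<and> (\<forall>m\<in>\<omega>. x m \<in> carrier (R Quot m)) \<and>
    finite {m \<in> \<omega>. x m \<noteq> m}"
  by (auto simp: residues_module_def PiE_iff zero_FactRing)

lemma M_eqI:
  "x \<in> carrier M \<Longrightarrow> y \<in> carrier M \<Longrightarrow> (\<And>m. m \<in> \<omega> \<Longrightarrow> x m = y m) \<Longrightarrow> x = y"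
  by (auto simp: carrier_M intro: extensionalityI)

lemma M_component: "x \<in> carrier M \<Longrightarrow> m \<in> \<omega> \<Longrightarrow> x m \<in> carrier (R Quot m)"
  by (auto simp: carrier_M)

lemma M_add: "m \<in> \<omega> \<Longrightarrow> (x \<oplus>\<^bsub>M\<^esub> y) m = x m \<oplus>\<^bsub>R Quot m\<^esub> y m"
  and M_zero: "m \<in> \<omega> \<Longrightarrow> \<zero>\<^bsub>M\<^esub> m = m"
  and M_smult: "m \<in> \<omega> \<Longrightarrow> (r \<odot>\<^bsub>M\<^esub> x) m = (m +> r) \<otimes>\<^bsub>R Quot m\<^esub> x m"
  by (simp_all add: residues_module_def zero_FactRing)

lemma M_zero_closed: "\<zero>\<^bsub>M\<^esub> \<in> carrier M"
proof -
  have "m \<in> carrier (R Quot m)" if "m \<in> \<omega>" for m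
    using ring.ring_simprules(2)[OF ideal.quotient_is_ring[OF omega_ideal[OF that]]]
    by (simp add: zero_FactRing)
  then show ?thesis
    by (auto simp: carrier_M) (auto simp: residues_module_def zero_FactRing)
qed

lemma M_add_closed:
  assumes "x \<in> carrier M" "y \<in> carrier M"
  shows "x \<oplus>\<^bsub>M\<^esub> y \<in> carrier M"
proof -
  have "(x \<oplus>\<^bsub>M\<^esub> y) m \<in> carrier (R Quot m)" if "m \<in> \<omega>" for m
    using ring.ring_simprules(1)[OF ideal.quotient_is_ring[OF omega_ideal[OF that]]] that assms
    by (simp add: M_add M_component)
  moreover have "(x \<oplus>\<^bsub>M\<^esub> y) m = m" if "m \<in> \<omega>" "x m = m" "y m = m" for m
    using ring.ring_simprules(8,2)[OF ideal.quotient_is_ring[OF omega_ideal[OF that(1)]]] that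
    by (simp add: M_add zero_FactRing)
  then have "{m \<in> \<omega>. (x \<oplus>\<^bsub>M\<^esub> y) m \<noteq> m} \<subseteq> {m \<in> \<omega>. x m \<noteq> m} \<union> {m \<in> \<omega>. y m \<noteq> m}"
    by blast
  then have "finite {m \<in> \<omega>. (x \<oplus>\<^bsub>M\<^esub> y) m \<noteq> m}"
    using assms by (auto simp: carrier_M intro: finite_subset)
  moreover have "x \<oplus>\<^bsub>M\<^esub> y \<in> extensional \<omega>"
    by (simp add: residues_module_def)
  ultimately show ?thesis
    by (simp add: carrier_M)
qed

lemma coset_hom: "m \<in> \<omega> \<Longrightarrow> ring_hom_ring R (R Quot m) ((+>) m)"
  by (rule ideal.rcos_ring_hom_ring[OF omega_ideal])

lemma coset_closed: "m \<in> \<omega> \<Longrightarrow> r \<in> carrier R \<Longrightarrow> m +> r \<in> carrier (R Quot m)"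
  by (simp add: carrier_FactRing)

lemma cring_Quot: "m \<in> \<omega> \<Longrightarrow> cring (R Quot m)"
  by (rule ideal.quotient_is_cring[OF omega_ideal is_cring])

lemma field_Quot: "m \<in> \<omega> \<Longrightarrow> field (R Quot m)"
  by (rule maximalideal.quotient_is_field[OF omega_maximal is_cring])

lemma coset_eq_self_iff:
  assumes "m \<in> \<omega>" "r \<in> carrier R"
  shows "m +> r = m \<longleftrightarrow> r \<in> m"
proof -
  interpret m: ideal m R
    by (rule omega_ideal[OF assms(1)])
  show ?thesis
    using m.a_rcos_self[OF assms(2)] a_coset_join2[OF assms(2) m.a_subgroup] by blast
qed

lemma M_smult_closed:
  assumes "r \<in> carrier R" "x \<in> carrier M"
  shows "r \<odot>\<^bsub>M\<^esub> x \<in> carrier M"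
proof -
  have "(r \<odot>\<^bsub>M\<^esub> x) m \<in> carrier (R Quot m)" if "m \<in> \<omega>" for m
    using ring.ring_simprules(5)[OF ideal.quotient_is_ring[OF omega_ideal[OF that]]] that assms
    by (simp add: M_smult M_component coset_closed)
  moreover have "(r \<odot>\<^bsub>M\<^esub> x) m = m" if "m \<in> \<omega>" "x m = m" for m
    using ring.ring_simprules(25)[OF ideal.quotient_is_ring[OF omega_ideal[OF that(1)]]] that
      coset_closed[OF that(1) assms(1)]
    by (simp add: M_smult zero_FactRing)
  then have "{m \<in> \<omega>. (r \<odot>\<^bsub>M\<^esub> x) m \<noteq> m} \<subseteq> {m \<in> \<omega>. x m \<noteq> m}"
    by blast
  then have "finite {m \<in> \<omega>. (r \<odot>\<^bsub>M\<^esub> x) m \<noteq> m}"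
    using assms by (auto simp: carrier_M intro: finite_subset)
  moreover have "r \<odot>\<^bsub>M\<^esub> x \<in> extensional \<omega>"
    by (simp add: residues_module_def)
  ultimately show ?thesis
    by (simp add: carrier_M)
qed

lemmas M_closed = M_zero_closed M_add_closed M_smult_closed

text \<open>Every axiom is checked at each component, in a quotient ring, where the scalar enters
  through the coset homomorphism.\<close>

lemma M_module: "module R M"
proof (rule moduleI)
  show "abelian_group M"
  proof (rule abelian_groupI)
    fix x assume x: "x \<in> carrier M"
    show "\<zero>\<^bsub>M\<^esub> \<oplus>\<^bsub>M\<^esub> x = x"
    proof (rule M_eqI)
      fix m assume m: "m \<in> \<omega>"
      interpret Q: cring "R Quot m"
        by (rule cring_Quot[OF m])
      show "(\<zero>\<^bsub>M\<^esub> \<oplus>\<^bsub>M\<^esub> x) m = x m"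
        using Q.l_zero[OF M_component[OF x m]] by (simp add: m M_add M_zero zero_FactRing)
    qed (simp_all add: x M_closed)
    show "\<exists>y\<in>carrier M. y \<oplus>\<^bsub>M\<^esub> x = \<zero>\<^bsub>M\<^esub>"
    proof
      \<comment> \<open>The negative is taken as the multiple by -1, since closure under scalars
        already supplies its finite support.\<close>
      let ?y = "(\<ominus> \<one>) \<odot>\<^bsub>M\<^esub> x"
      show y: "?y \<in> carrier M"
        by (simp add: x M_closed)
      show "?y \<oplus>\<^bsub>M\<^esub> x = \<zero>\<^bsub>M\<^esub>"
      proof (rule M_eqI)
        fix m assume m: "m \<in> \<omega>"
        interpret Q: cring "R Quot m"
          by (rule cring_Quot[OF m])
        interpret h: ring_hom_ring R "R Quot m" "(+>) m"
          by (rule coset_hom[OF m])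
        show "(?y \<oplus>\<^bsub>M\<^esub> x) m = \<zero>\<^bsub>M\<^esub> m"
          using M_component[OF x m]
          by (simp add: m M_add M_zero M_smult Q.l_minus Q.l_neg zero_FactRing)
      qed (simp_all add: x y M_closed)
    qed
  next
    fix x y assume xy: "x \<in> carrier M" "y \<in> carrier M"
    show "x \<oplus>\<^bsub>M\<^esub> y = y \<oplus>\<^bsub>M\<^esub> x"
    proof (rule M_eqI)
      fix m assume m: "m \<in> \<omega>"
      interpret Q: cring "R Quot m"
        by (rule cring_Quot[OF m])
      show "(x \<oplus>\<^bsub>M\<^esub> y) m = (y \<oplus>\<^bsub>M\<^esub> x) m"
        using xy m by (simp add: M_add Q.a_comm M_component)
    qed (simp_all add: xy M_closed)
  next
    fix x y z assume xyz: "x \<in> carrier M" "y \<in> carrier M" "z \<in> carrier M"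
    show "(x \<oplus>\<^bsub>M\<^esub> y) \<oplus>\<^bsub>M\<^esub> z = x \<oplus>\<^bsub>M\<^esub> (y \<oplus>\<^bsub>M\<^esub> z)"
    proof (rule M_eqI)
      fix m assume m: "m \<in> \<omega>"
      interpret Q: cring "R Quot m"
        by (rule cring_Quot[OF m])
      show "((x \<oplus>\<^bsub>M\<^esub> y) \<oplus>\<^bsub>M\<^esub> z) m = (x \<oplus>\<^bsub>M\<^esub> (y \<oplus>\<^bsub>M\<^esub> z)) m"
        using xyz m by (simp add: M_add Q.a_assoc M_component)
    qed (simp_all add: xyz M_closed)
  qed (simp_all add: M_closed)
next
  fix a b x assume ab: "a \<in> carrier R" "b \<in> carrier R" and x: "x \<in> carrier M"
  show "(a \<oplus> b) \<odot>\<^bsub>M\<^esub> x = a \<odot>\<^bsub>M\<^esub> x \<oplus>\<^bsub>M\<^esub> b \<odot>\<^bsub>M\<^esub> x"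
  proof (rule M_eqI)
    fix m assume m: "m \<in> \<omega>"
    interpret Q: cring "R Quot m"
      by (rule cring_Quot[OF m])
    interpret h: ring_hom_ring R "R Quot m" "(+>) m"
      by (rule coset_hom[OF m])
    show "((a \<oplus> b) \<odot>\<^bsub>M\<^esub> x) m = (a \<odot>\<^bsub>M\<^esub> x \<oplus>\<^bsub>M\<^esub> b \<odot>\<^bsub>M\<^esub> x) m"
      using M_component[OF x m] ab by (simp add: m M_add M_smult Q.l_distr)
  qed (simp_all add: ab x M_closed)
  show "(a \<otimes> b) \<odot>\<^bsub>M\<^esub> x = a \<odot>\<^bsub>M\<^esub> (b \<odot>\<^bsub>M\<^esub> x)"
  proof (rule M_eqI)
    fix m assume m: "m \<in> \<omega>"
    interpret Q: cring "R Quot m"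
      by (rule cring_Quot[OF m])
    interpret h: ring_hom_ring R "R Quot m" "(+>) m"
      by (rule coset_hom[OF m])
    show "((a \<otimes> b) \<odot>\<^bsub>M\<^esub> x) m = (a \<odot>\<^bsub>M\<^esub> (b \<odot>\<^bsub>M\<^esub> x)) m"
      using M_component[OF x m] ab by (simp add: m M_smult Q.m_assoc)
  qed (simp_all add: ab x M_closed)
next
  fix a x y assume a: "a \<in> carrier R" and xy: "x \<in> carrier M" "y \<in> carrier M"
  show "a \<odot>\<^bsub>M\<^esub> (x \<oplus>\<^bsub>M\<^esub> y) = a \<odot>\<^bsub>M\<^esub> x \<oplus>\<^bsub>M\<^esub> a \<odot>\<^bsub>M\<^esub> y"
  proof (rule M_eqI)
    fix m assume m: "m \<in> \<omega>"
    interpret Q: cring "R Quot m"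
      by (rule cring_Quot[OF m])
    show "(a \<odot>\<^bsub>M\<^esub> (x \<oplus>\<^bsub>M\<^esub> y)) m = (a \<odot>\<^bsub>M\<^esub> x \<oplus>\<^bsub>M\<^esub> a \<odot>\<^bsub>M\<^esub> y) m"
      using xy a m by (simp add: M_add M_smult Q.r_distr M_component coset_closed)
  qed (simp_all add: a xy M_closed)
next
  fix x assume x: "x \<in> carrier M"
  show "\<one> \<odot>\<^bsub>M\<^esub> x = x"
  proof (rule M_eqI)
    fix m assume m: "m \<in> \<omega>"
    interpret Q: cring "R Quot m"
      by (rule cring_Quot[OF m])
    interpret h: ring_hom_ring R "R Quot m" "(+>) m"
      by (rule coset_hom[OF m])
    show "(\<one> \<odot>\<^bsub>M\<^esub> x) m = x m"
      using M_component[OF x m] by (simp add: m M_smult)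
  qed (simp_all add: x M_closed)
qed (simp_all add: M_closed is_cring)

sublocale M: module R M
  by (rule M_module)

section \<open>Elements killed by a maximal ideal\<close>

definition annihilated_by :: "'r set \<Rightarrow> ('r set \<Rightarrow> 'r set) \<Rightarrow> bool" where
  "annihilated_by k x \<longleftrightarrow> (\<forall>r\<in>k. r \<odot>\<^bsub>M\<^esub> x = \<zero>\<^bsub>M\<^esub>)"

text \<open>An element of \<open>k\<close> outside \<open>m\<close> acts on the field R/m by a
  nonzero scalar, so it can kill only a zero component. The ideal \<open>k\<close> may lie outside
  \<omega>, as conjugates of ideals of the orbit can; then the lemma forces all of \<open>x\<close>
  to vanish.\<close>

lemma annihilated_by_component:
  assumes k: "maximalideal k R" and x: "x \<in> carrier M" "annihilated_by k x"
    and m: "m \<in> \<omega>" "m \<noteq> k"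
  shows "x m = m"
proof -
  obtain r where r: "r \<in> k" "r \<in> carrier R" "r \<notin> m"
    using maximalideal_separate[OF k omega_maximal[OF m(1)]] m(2) by metis
  interpret Q: field "R Quot m"
    by (rule field_Quot[OF m(1)])
  have "(m +> r) \<otimes>\<^bsub>R Quot m\<^esub> x m = \<zero>\<^bsub>R Quot m\<^esub>"
    using x(2) r(1) M_smult[OF m(1), of r x] M_zero[OF m(1)]
    by (simp add: annihilated_by_def zero_FactRing)
  moreover have "m +> r \<noteq> m"
    by (simp add: coset_eq_self_iff m r)
  ultimately show ?thesis
    using Q.integral[OF _ coset_closed[OF m(1) r(2)] M_component[OF x(1) m(1)]]
    by (simp add: zero_FactRing)
qed

text \<open>The elements killed by \<open>k\<close> live in the single summand R/k, which is
  one-dimensional over itself. This replaces division in the residue field when values of a form are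
  compared.\<close>

lemma annihilated_by_scalar:
  assumes k: "maximalideal k R" and x: "x \<in> carrier M" "annihilated_by k x" "x \<noteq> \<zero>\<^bsub>M\<^esub>"
    and y: "y \<in> carrier M" "annihilated_by k y"
  obtains r where "r \<in> carrier R" "y = r \<odot>\<^bsub>M\<^esub> x"
proof -
  have off: "x m = m" "y m = m" if "m \<in> \<omega>" "m \<noteq> k" for m
    using that annihilated_by_component k x y by blast+
  \<comment> \<open>If \<open>k\<close> were not in the orbit, or \<open>x\<close> vanished there,
    all components of \<open>x\<close> would be zero.\<close>
  have "k \<in> \<omega> \<and> x k \<noteq> k"
    using x(3) M_eqI[OF x(1) M_zero_closed] off M_zero by metis
  then have k\<omega>: "k \<in> \<omega>" and xk: "x k \<noteq> k"
    by auto
  interpret Q: field "R Quot k"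
    by (rule field_Quot[OF k\<omega>])
  note xQ = M_component[OF x(1) k\<omega>] and yQ = M_component[OF y(1) k\<omega>]
  have "x k \<in> Units (R Quot k)"
    using xk xQ unfolding Q.field_Units zero_FactRing by blast
  then have "y k = (y k \<otimes>\<^bsub>R Quot k\<^esub> inv\<^bsub>R Quot k\<^esub> x k) \<otimes>\<^bsub>R Quot k\<^esub> x k"
    using xQ yQ by (simp add: Q.m_assoc)
  moreover obtain r where r: "r \<in> carrier R" "y k \<otimes>\<^bsub>R Quot k\<^esub> inv\<^bsub>R Quot k\<^esub> x k = k +> r"
    using Q.m_closed[OF yQ Q.Units_inv_closed[OF \<open>x k \<in> Units (R Quot k)\<close>]]
    unfolding carrier_FactRing by blast
  ultimately have yk: "y k = (k +> r) \<otimes>\<^bsub>R Quot k\<^esub> x k"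
    by simp
  have "y = r \<odot>\<^bsub>M\<^esub> x"
  proof (rule M_eqI)
    fix m assume m: "m \<in> \<omega>"
    interpret Qm: cring "R Quot m"
      by (rule cring_Quot[OF m])
    show "y m = (r \<odot>\<^bsub>M\<^esub> x) m"
      using yk off[OF m] Qm.r_null[OF coset_closed[OF m r(1)]]
      by (cases "m = k") (simp_all add: m k\<omega> M_smult zero_FactRing)
  qed (simp_all add: y r x)
  with r show thesis
    by (rule_tac that)
qed

section \<open>The map from \<open>R\<close> through one residue field into the direct sum\<close>

definition residue_at :: "'r set \<Rightarrow> 'r \<Rightarrow> 'r set \<Rightarrow> 'r set" where
  "residue_at k r = (\<lambda>m\<in>\<omega>. if m = k then k +> r else m)"

lemma residue_at_closed:
  assumes "r \<in> carrier R"
  shows "residue_at k r \<in> carrier M"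
proof -
  have "finite {m \<in> \<omega>. residue_at k r m \<noteq> m}"
    by (rule finite_subset[of _ "{k}"]) (auto simp: residue_at_def)
  moreover have "m \<in> carrier (R Quot m)" if "m \<in> \<omega>" for m
    using ring.ring_simprules(2)[OF ideal.quotient_is_ring[OF omega_ideal[OF that]]]
    by (simp add: zero_FactRing)
  ultimately show ?thesis
    using assms by (auto simp: carrier_M residue_at_def coset_closed)
qed

lemma residue_at_add:
  assumes "k \<in> \<omega>" "r \<in> carrier R" "s \<in> carrier R"
  shows "residue_at k (r \<oplus> s) = residue_at k r \<oplus>\<^bsub>M\<^esub> residue_at k s"
proof (rule M_eqI)
  fix m assume m: "m \<in> \<omega>"
  interpret Q: cring "R Quot m"
    by (rule cring_Quot[OF m])
  interpret h: ring_hom_ring R "R Quot k" "(+>) k"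
    by (rule coset_hom[OF assms(1)])
  show "residue_at k (r \<oplus> s) m = (residue_at k r \<oplus>\<^bsub>M\<^esub> residue_at k s) m"
    using assms m Q.r_zero[OF Q.zero_closed] by (simp add: M_add residue_at_def zero_FactRing)
qed (simp_all add: assms residue_at_closed)

lemma residue_at_smult:
  assumes "k \<in> \<omega>" "r \<in> carrier R" "s \<in> carrier R"
  shows "residue_at k (r \<otimes> s) = r \<odot>\<^bsub>M\<^esub> residue_at k s"
proof (rule M_eqI)
  fix m assume m: "m \<in> \<omega>"
  interpret Q: cring "R Quot m"
    by (rule cring_Quot[OF m])
  interpret h: ring_hom_ring R "R Quot k" "(+>) k"
    by (rule coset_hom[OF assms(1)])
  show "residue_at k (r \<otimes> s) m = (r \<odot>\<^bsub>M\<^esub> residue_at k s) m"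
    using assms m Q.r_null[OF coset_closed[OF m assms(2)]]
    by (cases "m = k") (simp_all add: M_smult residue_at_def zero_FactRing)
qed (simp_all add: assms residue_at_closed)

lemma residue_at_one: "k \<in> \<omega> \<Longrightarrow> residue_at k \<one> \<noteq> \<zero>\<^bsub>M\<^esub>"
proof
  assume k: "k \<in> \<omega>" and "residue_at k \<one> = \<zero>\<^bsub>M\<^esub>"
  then have "residue_at k \<one> k = \<zero>\<^bsub>M\<^esub> k"
    by simp
  then have "k +> \<one> = k"
    unfolding M_zero[OF k] using k by (simp add: residue_at_def)
  interpret Q: field "R Quot k"
    by (rule field_Quot[OF k])
  interpret h: ring_hom_ring R "R Quot k" "(+>) k"
    by (rule coset_hom[OF k])
  show False
    using \<open>k +> \<one> = k\<close> Q.zero_not_one h.hom_one unfolding zero_FactRing by metis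
qed

lemma residue_at_mem:
  assumes "k \<in> \<omega>" "r \<in> k"
  shows "residue_at k r = \<zero>\<^bsub>M\<^esub>"
proof (rule M_eqI)
  have r: "r \<in> carrier R"
    using assms omega_subset by blast
  show "residue_at k r \<in> carrier M"
    by (rule residue_at_closed[OF r])
next
  fix m assume m: "m \<in> \<omega>"
  have "k +> r = k"
    using assms coset_eq_self_iff[OF assms(1)] omega_subset[OF assms(1)] by blast
  then show "residue_at k r m = \<zero>\<^bsub>M\<^esub> m"
    by (simp add: m M_zero residue_at_def)
qed (rule M_zero_closed)

section \<open>The shift on residues\<close>

text \<open>Proved for a general automorphism that permutes the orbit, because the inverse of the
  shift is the same construction along \<tau>. Finite support survives since a nonzero component at
  \<open>m\<close> comes from one at the preimage of \<open>m\<close>.\<close>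

lemma residues_shift_closed_iso:
  assumes h: "h \<in> ring_iso R R" and \<omega>: "\<And>m. m \<in> \<omega> \<Longrightarrow> h -` m \<inter> carrier R \<in> \<omega>"
    and inj: "\<And>m. m \<in> \<omega> \<Longrightarrow> h ` (h -` m \<inter> carrier R) = m"
    and x: "x \<in> carrier M"
  shows "residues_shift R h \<omega> x \<in> carrier M"
proof -
  let ?p = "\<lambda>m. h -` m \<inter> carrier R"
  have "h ` x (?p m) \<in> carrier (R Quot m)" if m: "m \<in> \<omega>" for m
  proof -
    obtain r where r: "r \<in> carrier R" "x (?p m) = ?p m +> r"
      using M_component[OF x \<omega>[OF m]] unfolding carrier_FactRing by blast
    have "h ` x (?p m) = m +> h r"
      using image_coset[OF h _ r(1), of "?p m"] inj[OF m] by (simp add: r(2))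
    then show ?thesis
      using h r(1) coset_closed[OF m] by (simp add: ring_iso_memE(1))
  qed
  moreover have "finite {m \<in> \<omega>. h ` x (?p m) \<noteq> m}"
  proof (rule finite_subset)
    show "{m \<in> \<omega>. h ` x (?p m) \<noteq> m} \<subseteq> (\<lambda>m. h ` m) ` {m \<in> \<omega>. x m \<noteq> m}"
    proof
      fix m assume m: "m \<in> {m \<in> \<omega>. h ` x (?p m) \<noteq> m}"
      then have "x (?p m) \<noteq> ?p m"
        using inj[of m] by auto
      then show "m \<in> (\<lambda>m. h ` m) ` {m \<in> \<omega>. x m \<noteq> m}"
        using m \<omega>[of m] inj[of m] by (intro image_eqI[of _ _ "?p m"]) auto
    qed
    show "finite ((\<lambda>m. h ` m) ` {m \<in> \<omega>. x m \<noteq> m})"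
      using x by (simp add: carrier_M)
  qed
  ultimately show ?thesis
    by (simp add: carrier_M residues_shift_def cong: conj_cong)
qed

lemma residues_shift_apply: "m \<in> \<omega> \<Longrightarrow> residues_shift R \<sigma> \<omega> x m = \<sigma> ` x (\<tau> ` m)"
  by (simp add: residues_shift_def sigma_vimage omega_subset)

lemma residues_shift_coset:
  assumes "m \<in> \<omega>" "x (\<tau> ` m) = \<tau> ` m +> r" "r \<in> carrier R"
  shows "residues_shift R \<sigma> \<omega> x m = m +> \<sigma> r"
  unfolding residues_shift_apply[OF assms(1)] assms(2)
    image_coset[OF sigma_iso omega_subset[OF omega_tau[OF assms(1)]] assms(3)]
    sigma_tau_image(1)[OF omega_subset[OF assms(1)]] ..

lemma residues_shift_closed: "x \<in> carrier M \<Longrightarrow> residues_shift R \<sigma> \<omega> x \<in> carrier M"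
  by (rule residues_shift_closed_iso[OF sigma_iso]) (simp_all add: sigma_vimage omega_subset omega_tau sigma_tau_image)

text \<open>The shift along \<tau> is a two-sided inverse: the induced maps on cosets are direct
  images, and these cancel on subsets of \<open>carrier R\<close>. Bijectivity gives the negative
  powers in \<open>residues_shift_power\<close> their meaning.\<close>

lemma bij_residues_shift: "bij_betw (residues_shift R \<sigma> \<omega>) (carrier M) (carrier M)"
proof (rule bij_betw_byWitness[where f' = "residues_shift R \<tau> \<omega>"])
  have Q: "x m \<subseteq> carrier R" if xm: "x \<in> carrier M" "m \<in> \<omega>" for x m
  proof -
    obtain r where "r \<in> carrier R" "x m = m +> r"
      using M_component[OF xm] unfolding carrier_FactRing by blast
    then show ?thesis
      using a_r_coset_subset_G omega_subset[OF xm(2)] by auto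
  qed
  have closed: "residues_shift R \<tau> \<omega> x \<in> carrier M" if "x \<in> carrier M" for x
    using that
    by (intro residues_shift_closed_iso[OF tau_iso]) (simp_all add: sigma_vimage omega_subset omega_sigma sigma_tau_image)
  show "residues_shift R \<tau> \<omega> ` carrier M \<subseteq> carrier M"
    using closed by blast
  show "residues_shift R \<sigma> \<omega> ` carrier M \<subseteq> carrier M"
    using residues_shift_closed by blast
  have \<tau>: "residues_shift R \<tau> \<omega> x m = \<tau> ` x (\<sigma> ` m)" if "m \<in> \<omega>" for x m
    using that by (simp add: residues_shift_def sigma_vimage omega_subset)
  show "\<forall>x\<in>carrier M. residues_shift R \<tau> \<omega> (residues_shift R \<sigma> \<omega> x) = x"
  proof
    fix x assume x: "x \<in> carrier M"
    show "residues_shift R \<tau> \<omega> (residues_shift R \<sigma> \<omega> x) = x"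
      by (rule M_eqI[OF closed[OF residues_shift_closed[OF x]] x])
        (simp add: \<tau> residues_shift_apply omega_sigma sigma_tau_image omega_subset Q[OF x])
  qed
  show "\<forall>x\<in>carrier M. residues_shift R \<sigma> \<omega> (residues_shift R \<tau> \<omega> x) = x"
  proof
    fix x assume x: "x \<in> carrier M"
    show "residues_shift R \<sigma> \<omega> (residues_shift R \<tau> \<omega> x) = x"
      by (rule M_eqI[OF residues_shift_closed[OF closed[OF x]] x])
        (simp add: \<tau> residues_shift_apply omega_tau sigma_tau_image omega_subset Q[OF x])
  qed
qed

lemma residues_shift_add:
  assumes "x \<in> carrier M" "y \<in> carrier M"
  shows "residues_shift R \<sigma> \<omega> (x \<oplus>\<^bsub>M\<^esub> y) =
    residues_shift R \<sigma> \<omega> x \<oplus>\<^bsub>M\<^esub> residues_shift R \<sigma> \<omega> y"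
proof (rule M_eqI)
  fix m assume m: "m \<in> \<omega>"
  have m': "\<tau> ` m \<in> \<omega>"
    by (rule omega_tau[OF m])
  interpret h: ring_hom_ring R "R Quot m" "(+>) m"
    by (rule coset_hom[OF m])
  interpret h': ring_hom_ring R "R Quot (\<tau> ` m)" "(+>) (\<tau> ` m)"
    by (rule coset_hom[OF m'])
  obtain a b where a: "a \<in> carrier R" "x (\<tau> ` m) = \<tau> ` m +> a"
    and b: "b \<in> carrier R" "y (\<tau> ` m) = \<tau> ` m +> b"
    using M_component[OF assms(1) m'] M_component[OF assms(2) m'] unfolding carrier_FactRing by blast
  have "(x \<oplus>\<^bsub>M\<^esub> y) (\<tau> ` m) = \<tau> ` m +> (a \<oplus> b)"
    by (simp add: M_add m' a b)
  then show "residues_shift R \<sigma> \<omega> (x \<oplus>\<^bsub>M\<^esub> y) m =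
      (residues_shift R \<sigma> \<omega> x \<oplus>\<^bsub>M\<^esub> residues_shift R \<sigma> \<omega> y) m"
    using residues_shift_coset[of m x a, OF m a(2,1)] residues_shift_coset[of m y b, OF m b(2,1)]
      residues_shift_coset[OF m, of "x \<oplus>\<^bsub>M\<^esub> y" "a \<oplus> b"] a b
    by (simp add: M_add m sigma_add sigma_closed)
qed (simp_all add: assms residues_shift_closed)

lemma residues_shift_smult:
  assumes "r \<in> carrier R" "x \<in> carrier M"
  shows "residues_shift R \<sigma> \<omega> (r \<odot>\<^bsub>M\<^esub> x) = \<sigma> r \<odot>\<^bsub>M\<^esub> residues_shift R \<sigma> \<omega> x"
proof (rule M_eqI)
  fix m assume m: "m \<in> \<omega>"
  have m': "\<tau> ` m \<in> \<omega>"
    by (rule omega_tau[OF m])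
  interpret h: ring_hom_ring R "R Quot m" "(+>) m"
    by (rule coset_hom[OF m])
  interpret h': ring_hom_ring R "R Quot (\<tau> ` m)" "(+>) (\<tau> ` m)"
    by (rule coset_hom[OF m'])
  obtain a where a: "a \<in> carrier R" "x (\<tau> ` m) = \<tau> ` m +> a"
    using M_component[OF assms(2) m'] unfolding carrier_FactRing by blast
  have "(r \<odot>\<^bsub>M\<^esub> x) (\<tau> ` m) = \<tau> ` m +> (r \<otimes> a)"
    by (simp add: M_smult m' a assms)
  then show "residues_shift R \<sigma> \<omega> (r \<odot>\<^bsub>M\<^esub> x) m = (\<sigma> r \<odot>\<^bsub>M\<^esub> residues_shift R \<sigma> \<omega> x) m"
    using residues_shift_coset[of m x a, OF m a(2,1)]
      residues_shift_coset[OF m, of "r \<odot>\<^bsub>M\<^esub> x" "r \<otimes> a"] a assms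
    by (simp add: M_smult m sigma_mult sigma_closed)
qed (simp_all add: assms residues_shift_closed sigma_closed)

lemma shift_closed: "x \<in> carrier M \<Longrightarrow> shift n x \<in> carrier M"
  unfolding residues_shift_power_def by (rule int_iterate_closed[OF bij_residues_shift])

lemma shift_0: "shift 0 x = x"
  by (simp add: residues_shift_power_def)

lemma shift_shift: "x \<in> carrier M \<Longrightarrow> shift m (shift n x) = shift (m + n) x"
  unfolding residues_shift_power_def by (simp add: int_iterate_add[OF bij_residues_shift])

lemma shift_add:
  "x \<in> carrier M \<Longrightarrow> y \<in> carrier M \<Longrightarrow> shift n (x \<oplus>\<^bsub>M\<^esub> y) = shift n x \<oplus>\<^bsub>M\<^esub> shift n y"
  unfolding residues_shift_power_def
  by (rule int_iterate_hom[OF bij_residues_shift]) (auto simp: residues_shift_add)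

lemma shift_zero: "shift n \<zero>\<^bsub>M\<^esub> = \<zero>\<^bsub>M\<^esub>"
  by (rule additive_zero[OF M.abelian_group_axioms M.abelian_group_axioms])
    (simp_all add: shift_closed shift_add)

lemma shift_uminus: "x \<in> carrier M \<Longrightarrow> shift n (\<ominus>\<^bsub>M\<^esub> x) = \<ominus>\<^bsub>M\<^esub> shift n x"
  by (rule additive_uminus[OF M.abelian_group_axioms M.abelian_group_axioms])
    (simp_all add: shift_closed shift_add)

lemma shift_1_smult:
  "r \<in> carrier R \<Longrightarrow> x \<in> carrier M \<Longrightarrow> shift 1 (r \<odot>\<^bsub>M\<^esub> x) = \<sigma> r \<odot>\<^bsub>M\<^esub> shift 1 x"
  by (simp add: residues_shift_power_def residues_shift_smult)

lemma shift_minus_1_smult: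
  assumes "r \<in> carrier R" "x \<in> carrier M"
  shows "shift (- 1) (r \<odot>\<^bsub>M\<^esub> x) = \<tau> r \<odot>\<^bsub>M\<^esub> shift (- 1) x"
proof -
  \<comment> \<open>Instead of analysing the inverse shift, its argument is recognised as the shift
    of the claimed value.\<close>
  have "r \<odot>\<^bsub>M\<^esub> x = shift 1 (\<tau> r \<odot>\<^bsub>M\<^esub> shift (- 1) x)"
    using assms
    by (simp add: shift_1_smult sigma_inv_closed shift_closed sigma_sigma_inv shift_shift shift_0)
  then show ?thesis
    using assms by (simp add: shift_shift shift_0 sigma_inv_closed shift_closed)
qed

end

section \<open>Weight modules and the finitistic dual\<close>

locale gwa_weight = gwa_orbit R star \<sigma> t \<omega> for R :: "'r ring" (structure) and star \<sigma> t \<omega> +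
  fixes V :: "('r gwa_expr set, 'v) module"
  assumes weight: "weight_module R \<sigma> t V"
    and supp: "weight_support R \<sigma> t V \<subseteq> \<omega>"
begin

abbreviation A where "A \<equiv> gwa R \<sigma> t"
abbreviation smul where "smul \<equiv> scalar_mult R \<sigma> t V"
abbreviation wt where "wt \<equiv> weight_space R \<sigma> t V"
abbreviation VD where "VD \<equiv> finitistic_functionals R star \<sigma> t \<omega> V"
abbreviation D where "D \<equiv> finitistic_dual R star \<sigma> t \<omega> V"
abbreviation da where "da \<equiv> dual_action R star \<sigma> t \<omega> V"

text \<open>Letting expressions act directly turns each defining relation into an equation between
  actions, by \<open>act_rel\<close>, and permits induction on expressions.\<close>

definition act :: "'r gwa_expr \<Rightarrow> 'v \<Rightarrow> 'v" where
  "act e v = gwa_class R \<sigma> t e \<odot>\<^bsub>V\<^esub> v"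

lemma V_left_module: "left_module A V"
  using weight by (simp add: weight_module_def)

sublocale V: abelian_group V
  using V_left_module by (simp add: left_module_def)

lemma act_Coeff: "act (Coeff r) = smul r"
  by (simp add: fun_eq_iff act_def scalar_mult_def)

lemma act_closed: "e \<in> gwa_exprs R \<Longrightarrow> v \<in> carrier V \<Longrightarrow> act e v \<in> carrier V"
  using left_module.smult_closed[OF V_left_module] by (simp add: act_def carrier_gwa)

lemma act_rel: "(e, f) \<in> gwa_rel R \<sigma> t \<Longrightarrow> act e v = act f v"
  by (simp add: act_def gwa_class_eqI)

lemma act_Plus:
  "\<lbrakk>e \<in> gwa_exprs R; f \<in> gwa_exprs R; v \<in> carrier V\<rbrakk> \<Longrightarrow> act (Plus e f) v = act e v \<oplus>\<^bsub>V\<^esub> act f v"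
  using left_module.smult_l_distr[OF V_left_module, of "gwa_class R \<sigma> t e" "gwa_class R \<sigma> t f"]
  by (simp add: act_def carrier_gwa gwa_class_add)

lemma act_Times:
  "\<lbrakk>e \<in> gwa_exprs R; f \<in> gwa_exprs R; v \<in> carrier V\<rbrakk> \<Longrightarrow> act (Times e f) v = act e (act f v)"
  using left_module.smult_assoc[OF V_left_module, of "gwa_class R \<sigma> t e" "gwa_class R \<sigma> t f"]
  by (simp add: act_def carrier_gwa gwa_class_mult)

lemma act_add:
  "\<lbrakk>e \<in> gwa_exprs R; v \<in> carrier V; w \<in> carrier V\<rbrakk> \<Longrightarrow> act e (v \<oplus>\<^bsub>V\<^esub> w) = act e v \<oplus>\<^bsub>V\<^esub> act e w"
  using left_module.smult_r_distr[OF V_left_module, of "gwa_class R \<sigma> t e"]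
  by (simp add: act_def carrier_gwa)

lemma act_zero: "e \<in> gwa_exprs R \<Longrightarrow> act e \<zero>\<^bsub>V\<^esub> = \<zero>\<^bsub>V\<^esub>"
  by (rule additive_zero[OF V.abelian_group_axioms V.abelian_group_axioms])
    (simp_all add: act_closed act_add)

lemma smul_closed: "r \<in> carrier R \<Longrightarrow> v \<in> carrier V \<Longrightarrow> smul r v \<in> carrier V"
  using act_closed[of "Coeff r" v] by (simp add: act_Coeff)

lemma smul_add: "\<lbrakk>r \<in> carrier R; v \<in> carrier V; w \<in> carrier V\<rbrakk>
    \<Longrightarrow> smul r (v \<oplus>\<^bsub>V\<^esub> w) = smul r v \<oplus>\<^bsub>V\<^esub> smul r w"
  using act_add[of "Coeff r" v w] by (simp add: act_Coeff)

lemma smul_zero: "r \<in> carrier R \<Longrightarrow> smul r \<zero>\<^bsub>V\<^esub> = \<zero>\<^bsub>V\<^esub>"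
  using act_zero[of "Coeff r"] by (simp add: act_Coeff)

lemma add_smul: "\<lbrakk>r \<in> carrier R; s \<in> carrier R; v \<in> carrier V\<rbrakk>
    \<Longrightarrow> smul (r \<oplus> s) v = smul r v \<oplus>\<^bsub>V\<^esub> smul s v"
  using act_Plus[of "Coeff r" "Coeff s" v] act_rel[OF gwa_rel.coeff_plus, of r s v]
  by (simp add: act_Coeff)

lemma mult_smul: "\<lbrakk>r \<in> carrier R; s \<in> carrier R; v \<in> carrier V\<rbrakk>
    \<Longrightarrow> smul (r \<otimes> s) v = smul r (smul s v)"
  using act_Times[of "Coeff r" "Coeff s" v] act_rel[OF gwa_rel.coeff_times, of r s v]
  by (simp add: act_Coeff)

lemma one_smul: "v \<in> carrier V \<Longrightarrow> smul \<one> v = v"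
  using left_module.smult_one[OF V_left_module, of v] by (simp add: gwa_one scalar_mult_def)

lemma smul_uminus: "r \<in> carrier R \<Longrightarrow> v \<in> carrier V \<Longrightarrow> smul r (\<ominus>\<^bsub>V\<^esub> v) = \<ominus>\<^bsub>V\<^esub> smul r v"
  using additive_uminus[OF V.abelian_group_axioms V.abelian_group_axioms, of "smul r"]
  by (simp add: smul_closed smul_add)

lemma zero_smul: "v \<in> carrier V \<Longrightarrow> smul \<zero> v = \<zero>\<^bsub>V\<^esub>"
  using additive_zero[OF abelian_group_axioms V.abelian_group_axioms, of "\<lambda>r. smul r v"]
  by (simp add: smul_closed add_smul)

lemma minus_smul: "r \<in> carrier R \<Longrightarrow> v \<in> carrier V \<Longrightarrow> smul (\<ominus> r) v = \<ominus>\<^bsub>V\<^esub> smul r v"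
  using additive_uminus[OF abelian_group_axioms V.abelian_group_axioms, of "\<lambda>r. smul r v"]
  by (simp add: smul_closed add_smul)

text \<open>The module axioms do not mention \<open>Uminus\<close>; it is the relation
  \<open>plus_uminus\<close> that identifies its action as the additive inverse.\<close>

lemma act_Uminus:
  assumes "e \<in> gwa_exprs R" "v \<in> carrier V"
  shows "act (Uminus e) v = \<ominus>\<^bsub>V\<^esub> act e v"
proof -
  have "act (Uminus e) v \<oplus>\<^bsub>V\<^esub> act e v = \<zero>\<^bsub>V\<^esub>"
    using act_Plus[of "Uminus e" e v] act_rel[OF gwa_rel.plus_uminus[OF assms(1)], of v] assms
    by (simp add: act_Coeff zero_smul)
  then show ?thesis
    using assms by (simp add: V.minus_equality act_closed)
qed

lemma act_X_smul: "r \<in> carrier R \<Longrightarrow> v \<in> carrier V \<Longrightarrow> act GenX (smul r v) = smul (\<sigma> r) (act GenX v)"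
  using act_rel[OF gwa_rel.X_coeff, of r v] by (simp add: act_Times sigma_closed act_Coeff)

lemma act_Y_smul: "r \<in> carrier R \<Longrightarrow> v \<in> carrier V \<Longrightarrow> act GenY (smul r v) = smul (\<tau> r) (act GenY v)"
  using act_rel[OF gwa_rel.Y_coeff, of r v] by (simp add: act_Times sigma_inv_closed act_Coeff)

lemma act_X_Y: "v \<in> carrier V \<Longrightarrow> act GenX (act GenY v) = smul (\<sigma> t) v"
  using act_rel[OF gwa_rel.X_Y, of v] by (simp add: act_Times act_Coeff)

lemma act_Y_X: "v \<in> carrier V \<Longrightarrow> act GenY (act GenX v) = smul t v"
  using act_rel[OF gwa_rel.Y_X, of v] by (simp add: act_Times act_Coeff)

section \<open>Weight spaces and coefficient submodules\<close>

lemma wt_carrier: "v \<in> wt m \<Longrightarrow> v \<in> carrier V"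
  by (simp add: weight_space_def)

lemma wt_smul_zero: "v \<in> wt m \<Longrightarrow> r \<in> m \<Longrightarrow> smul r v = \<zero>\<^bsub>V\<^esub>"
  by (simp add: weight_space_def)

lemma wt_X: "m \<in> \<omega> \<Longrightarrow> v \<in> wt m \<Longrightarrow> act GenX v \<in> wt (\<sigma> ` m)"
  using omega_subset act_X_smul[of _ v, symmetric]
  by (auto simp: weight_space_def act_closed act_zero subset_iff)

lemma wt_Y: "m \<in> \<omega> \<Longrightarrow> v \<in> wt m \<Longrightarrow> act GenY v \<in> wt (\<tau> ` m)"
  using omega_subset act_Y_smul[of _ v, symmetric]
  by (auto simp: weight_space_def act_closed act_zero subset_iff)

text \<open>Submodules over the coefficients \<open>R\<close> alone, with no stability under
  \<open>GenX\<close> and \<open>GenY\<close>: weight spaces, kernels of functionals and hyperplanes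
  are of this kind.\<close>

definition rsub :: "'v set \<Rightarrow> bool" where
  "rsub W \<longleftrightarrow> W \<subseteq> carrier V \<and> \<zero>\<^bsub>V\<^esub> \<in> W \<and> (\<forall>v\<in>W. \<forall>w\<in>W. v \<oplus>\<^bsub>V\<^esub> w \<in> W) \<and>
    (\<forall>r\<in>carrier R. \<forall>v\<in>W. smul r v \<in> W)"

lemma rsubD:
  assumes "rsub W"
  shows "v \<in> W \<Longrightarrow> v \<in> carrier V" "\<zero>\<^bsub>V\<^esub> \<in> W" "v \<in> W \<Longrightarrow> w \<in> W \<Longrightarrow> v \<oplus>\<^bsub>V\<^esub> w \<in> W"
    "r \<in> carrier R \<Longrightarrow> v \<in> W \<Longrightarrow> smul r v \<in> W" "v \<in> W \<Longrightarrow> \<ominus>\<^bsub>V\<^esub> v \<in> W"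
    "v \<in> W \<Longrightarrow> w \<in> W \<Longrightarrow> v \<ominus>\<^bsub>V\<^esub> w \<in> W"
proof -
  show 1: "v \<in> W \<Longrightarrow> v \<in> carrier V" "\<zero>\<^bsub>V\<^esub> \<in> W" "v \<in> W \<Longrightarrow> w \<in> W \<Longrightarrow> v \<oplus>\<^bsub>V\<^esub> w \<in> W"
    "r \<in> carrier R \<Longrightarrow> v \<in> W \<Longrightarrow> smul r v \<in> W" for v w r
    using assms unfolding rsub_def by blast+
  show "v \<in> W \<Longrightarrow> \<ominus>\<^bsub>V\<^esub> v \<in> W" for v
    using 1(4)[of "\<ominus> \<one>" v] 1(1) by (simp add: minus_smul one_smul)
  then show "v \<in> W \<Longrightarrow> w \<in> W \<Longrightarrow> v \<ominus>\<^bsub>V\<^esub> w \<in> W"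
    by (simp add: a_minus_def 1(3))
qed

lemma rsub_finsum:
  assumes "rsub W" "finite I" "\<And>i. i \<in> I \<Longrightarrow> c i \<in> W"
  shows "finsum V c I \<in> W"
  using assms(2,3)
proof (induction I rule: finite_induct)
  case empty
  then show ?case
    by (simp add: rsubD(2)[OF assms(1)])
next
  case (insert i I)
  have "c \<in> I \<rightarrow> carrier V" "c i \<in> carrier V"
    using insert.prems rsubD(1)[OF assms(1)] by auto
  then show ?case
    using insert rsubD(3)[OF assms(1)] by (simp add: V.finsum_insert)
qed

text \<open>Every vector is a finite sum of weight vectors, and an ideal with a nonzero weight
  component belongs to the support, hence to \<omega>. This is the form in which the weight
  decomposition is used.\<close>

lemma rsub_all:
  assumes W: "rsub W" and wt: "\<And>m. m \<in> \<omega> \<Longrightarrow> wt m \<subseteq> W" and v: "v \<in> carrier V"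
  shows "v \<in> W"
proof -
  obtain c where c: "c \<in> (\<Pi>\<^sub>E m\<in>max_ideals R. wt m)"
    and fin: "finite {m \<in> max_ideals R. c m \<noteq> \<zero>\<^bsub>V\<^esub>}"
    and v_eq: "v = finsum V c {m \<in> max_ideals R. c m \<noteq> \<zero>\<^bsub>V\<^esub>}"
    using weight v unfolding weight_module_def by meson
  have "c m \<in> W" if "m \<in> {m \<in> max_ideals R. c m \<noteq> \<zero>\<^bsub>V\<^esub>}" for m
  proof -
    have "m \<in> max_ideals R" "c m \<noteq> \<zero>\<^bsub>V\<^esub>" "c m \<in> wt m"
      using that c by auto
    then have "m \<in> weight_support R \<sigma> t V"
      by (auto simp: weight_support_def)
    then show ?thesis
      using supp wt \<open>c m \<in> wt m\<close> by blast
  qed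
  then show ?thesis
    unfolding v_eq by (rule rsub_finsum[OF W fin])
qed

section \<open>Semilinear functionals and the dual\<close>

definition semilinear :: "('v \<Rightarrow> 'r set \<Rightarrow> 'r set) \<Rightarrow> bool" where
  "semilinear \<phi> \<longleftrightarrow> \<phi> \<in> carrier V \<rightarrow>\<^sub>E carrier M \<and>
    (\<forall>v\<in>carrier V. \<forall>w\<in>carrier V. \<phi> (v \<oplus>\<^bsub>V\<^esub> w) = \<phi> v \<oplus>\<^bsub>M\<^esub> \<phi> w) \<and>
    (\<forall>r\<in>carrier R. \<forall>v\<in>carrier V. \<phi> (smul r v) = star r \<odot>\<^bsub>M\<^esub> \<phi> v)"

definition fsupp :: "('v \<Rightarrow> 'r set \<Rightarrow> 'r set) \<Rightarrow> 'r set set" where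
  "fsupp \<phi> = {m \<in> \<omega>. \<exists>v\<in>wt m. \<phi> v \<noteq> \<zero>\<^bsub>M\<^esub>}"

text \<open>Finiteness of the support is split off because a form yields functionals that are
  visibly semilinear before their supports are known to be finite.\<close>

lemma VD_iff: "\<phi> \<in> VD \<longleftrightarrow> semilinear \<phi> \<and> finite (fsupp \<phi>)"
  by (auto simp: finitistic_functionals_def semilinear_def fsupp_def)

lemma semilinearD:
  assumes "semilinear \<phi>"
  shows "v \<in> carrier V \<Longrightarrow> \<phi> v \<in> carrier M"
    "v \<in> carrier V \<Longrightarrow> w \<in> carrier V \<Longrightarrow> \<phi> (v \<oplus>\<^bsub>V\<^esub> w) = \<phi> v \<oplus>\<^bsub>M\<^esub> \<phi> w"
    "r \<in> carrier R \<Longrightarrow> v \<in> carrier V \<Longrightarrow> \<phi> (smul r v) = star r \<odot>\<^bsub>M\<^esub> \<phi> v"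
  using assms by (auto simp: semilinear_def)

lemma semilinear_zero: "semilinear \<phi> \<Longrightarrow> \<phi> \<zero>\<^bsub>V\<^esub> = \<zero>\<^bsub>M\<^esub>"
  by (rule additive_zero[OF V.abelian_group_axioms M.abelian_group_axioms]) (simp_all add: semilinearD)

lemma semilinearI:
  assumes "\<And>v. v \<in> carrier V \<Longrightarrow> f v \<in> carrier M"
    and "\<And>v w. v \<in> carrier V \<Longrightarrow> w \<in> carrier V \<Longrightarrow> f (v \<oplus>\<^bsub>V\<^esub> w) = f v \<oplus>\<^bsub>M\<^esub> f w"
    and "\<And>r v. r \<in> carrier R \<Longrightarrow> v \<in> carrier V \<Longrightarrow> f (smul r v) = star r \<odot>\<^bsub>M\<^esub> f v"
  shows "semilinear (\<lambda>v\<in>carrier V. f v)"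
  using assms by (auto simp: semilinear_def smul_closed)

lemma semilinear_eqI:
  assumes "semilinear \<phi>" "semilinear \<psi>" "\<And>v. v \<in> carrier V \<Longrightarrow> \<phi> v = \<psi> v"
  shows "\<phi> = \<psi>"
  using assms unfolding semilinear_def by (meson PiE_ext)

lemma semilinear_agree_rsub:
  assumes "semilinear \<phi>" "semilinear \<psi>"
  shows "rsub {v \<in> carrier V. \<phi> v = \<psi> v}"
  using assms by (auto simp: rsub_def semilinear_zero semilinearD smul_closed)

lemma semilinear_eq_on_weights:
  assumes "semilinear \<phi>" "semilinear \<psi>" "\<And>m v. m \<in> \<omega> \<Longrightarrow> v \<in> wt m \<Longrightarrow> \<phi> v = \<psi> v"
  shows "\<phi> = \<psi>"
proof (rule semilinear_eqI[OF assms(1,2)])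
  fix v assume "v \<in> carrier V"
  then have "v \<in> {v \<in> carrier V. \<phi> v = \<psi> v}"
    using assms(3) wt_carrier by (intro rsub_all[OF semilinear_agree_rsub[OF assms(1,2)]]) auto
  then show "\<phi> v = \<psi> v"
    by simp
qed

text \<open>If \<open>r\<close> kills \<open>v\<close>, then \<open>star r\<close> kills the value
  at \<open>v\<close>. So the values on a weight space all lie in the summand at the conjugate
  ideal, and they vanish if that ideal is not in \<omega>.\<close>

lemma semilinear_annihilated:
  assumes "semilinear \<phi>" "m \<subseteq> carrier R" "v \<in> wt m"
  shows "annihilated_by (star ` m) (\<phi> v)"
  using assms semilinear_zero[OF assms(1)] semilinearD(3)[OF assms(1), of _ v, symmetric]
  by (auto simp: annihilated_by_def wt_carrier wt_smul_zero subset_iff)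

lemma VD_semilinear: "\<phi> \<in> VD \<Longrightarrow> semilinear \<phi>"
  by (simp add: VD_iff)

lemmas VD_D = semilinearD[OF VD_semilinear]

lemma VD_eqI: "\<lbrakk>\<phi> \<in> VD; \<psi> \<in> VD; \<And>v. v \<in> carrier V \<Longrightarrow> \<phi> v = \<psi> v\<rbrakk> \<Longrightarrow> \<phi> = \<psi>"
  by (rule semilinear_eqI) (auto simp: VD_iff)

lemma fsupp_add:
  assumes "f = (\<lambda>v\<in>carrier V. \<phi> v \<oplus>\<^bsub>M\<^esub> \<psi> v)"
  shows "fsupp f \<subseteq> fsupp \<phi> \<union> fsupp \<psi>"
  using assms by (auto simp: fsupp_def wt_carrier)

lemma VD_add:
  assumes "\<phi> \<in> VD" "\<psi> \<in> VD"
  shows "(\<lambda>v\<in>carrier V. \<phi> v \<oplus>\<^bsub>M\<^esub> \<psi> v) \<in> VD"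
  unfolding VD_iff
proof
  show "semilinear (\<lambda>v\<in>carrier V. \<phi> v \<oplus>\<^bsub>M\<^esub> \<psi> v)"
    using assms
    by (intro semilinearI) (auto simp: VD_D M.a_ac M.smult_r_distr star_closed)
  show "finite (fsupp (\<lambda>v\<in>carrier V. \<phi> v \<oplus>\<^bsub>M\<^esub> \<psi> v))"
    using assms by (auto simp: VD_iff intro: finite_subset[OF fsupp_add[OF HOL.refl]])
qed

lemma VD_uminus:
  assumes "\<phi> \<in> VD"
  shows "(\<lambda>v\<in>carrier V. \<ominus>\<^bsub>M\<^esub> \<phi> v) \<in> VD"
  unfolding VD_iff
proof
  show "semilinear (\<lambda>v\<in>carrier V. \<ominus>\<^bsub>M\<^esub> \<phi> v)"
    using assms
    by (intro semilinearI) (auto simp: VD_D M.minus_add M.smult_r_minus star_closed)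
  have "fsupp (\<lambda>v\<in>carrier V. \<ominus>\<^bsub>M\<^esub> \<phi> v) \<subseteq> fsupp \<phi>"
    by (auto simp: fsupp_def wt_carrier) (metis M.minus_equality M.r_zero M.zero_closed)
  then show "finite (fsupp (\<lambda>v\<in>carrier V. \<ominus>\<^bsub>M\<^esub> \<phi> v))"
    using assms by (auto simp: VD_iff intro: finite_subset)
qed

section \<open>The action of expressions on the dual\<close>

lemma da_Coeff: "\<phi> \<in> VD \<Longrightarrow> v \<in> carrier V \<Longrightarrow> r \<in> carrier R \<Longrightarrow> da (Coeff r) \<phi> v = r \<odot>\<^bsub>M\<^esub> \<phi> v"
  by (simp add: VD_D star_closed star_star)

lemma da_X: "v \<in> carrier V \<Longrightarrow> da GenX \<phi> v = shift 1 (\<phi> (act GenY v))"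
  and da_Y: "v \<in> carrier V \<Longrightarrow> da GenY \<phi> v = shift (- 1) (\<phi> (act GenX v))"
  by (simp_all add: act_def)

lemma da_Plus: "v \<in> carrier V \<Longrightarrow> da (Plus e f) \<phi> v = da e \<phi> v \<oplus>\<^bsub>M\<^esub> da f \<phi> v"
  and da_Uminus: "v \<in> carrier V \<Longrightarrow> da (Uminus e) \<phi> v = \<ominus>\<^bsub>M\<^esub> da e \<phi> v"
  by simp_all

lemma da_Times: "da (Times e f) \<phi> = da e (da f \<phi>)"
  by simp

lemma da_Coeff_closed:
  assumes "r \<in> carrier R" "\<phi> \<in> VD"
  shows "da (Coeff r) \<phi> \<in> VD"
  unfolding VD_iff
proof
  \<comment> \<open>The definition evaluates at \<open>smul (star r) v\<close>; semilinearity
    conjugates the coefficient a second time and returns \<open>r\<close>.\<close>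
  have eq: "da (Coeff r) \<phi> = (\<lambda>v\<in>carrier V. r \<odot>\<^bsub>M\<^esub> \<phi> v)"
    using assms by (auto simp: VD_D star_closed star_star)
  have "r \<odot>\<^bsub>M\<^esub> (star s \<odot>\<^bsub>M\<^esub> x) = star s \<odot>\<^bsub>M\<^esub> (r \<odot>\<^bsub>M\<^esub> x)" if "s \<in> carrier R" "x \<in> carrier M" for s x
    using that assms(1) by (simp flip: M.smult_assoc1 add: m_comm star_closed)
  then show "semilinear (da (Coeff r) \<phi>)"
    unfolding eq using assms
    by (intro semilinearI) (simp_all add: VD_D M.smult_r_distr star_closed)
  have "fsupp (da (Coeff r) \<phi>) \<subseteq> fsupp \<phi>"
    unfolding eq using assms(1) by (auto simp: fsupp_def wt_carrier)
  then show "finite (fsupp (da (Coeff r) \<phi>))"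
    using assms by (auto simp: VD_iff intro: finite_subset)
qed

text \<open>Passing \<open>r\<close> through \<open>GenY\<close> gives \<tau> r, the functional
  conjugates it, and the shift applies \<sigma>; as \<sigma> commutes with \<open>star\<close>, the
  result is \<open>star r\<close>. The value on the weight space at \<open>m\<close> is read off at
  the image of \<open>m\<close> under \<tau>, so the support moves along \<sigma>.\<close>

lemma da_X_closed:
  assumes "\<phi> \<in> VD"
  shows "da GenX \<phi> \<in> VD"
  unfolding VD_iff
proof
  have eq: "da GenX \<phi> = (\<lambda>v\<in>carrier V. shift 1 (\<phi> (act GenY v)))"
    by (simp add: act_def)
  show "semilinear (da GenX \<phi>)"
    unfolding eq using assms
    by (intro semilinearI)
      (simp_all add: VD_D act_closed act_add shift_closed shift_add act_Y_smul sigma_inv_closed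
        shift_1_smult star_closed sigma_star sigma_sigma_inv)
  have "fsupp (da GenX \<phi>) \<subseteq> (`) \<sigma> ` fsupp \<phi>"
  proof
    fix m assume "m \<in> fsupp (da GenX \<phi>)"
    then obtain v where v: "m \<in> \<omega>" "v \<in> wt m" "shift 1 (\<phi> (act GenY v)) \<noteq> \<zero>\<^bsub>M\<^esub>"
      unfolding eq by (auto simp: fsupp_def wt_carrier)
    then have "\<tau> ` m \<in> fsupp \<phi>"
      using wt_Y omega_tau shift_zero by (force simp: fsupp_def)
    then show "m \<in> (`) \<sigma> ` fsupp \<phi>"
      using sigma_tau_image(1)[OF omega_subset[OF v(1)]] by (metis imageI)
  qed
  then show "finite (fsupp (da GenX \<phi>))"
    using assms by (auto simp: VD_iff intro: finite_subset)
qed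

lemma da_Y_closed:
  assumes "\<phi> \<in> VD"
  shows "da GenY \<phi> \<in> VD"
  unfolding VD_iff
proof
  have eq: "da GenY \<phi> = (\<lambda>v\<in>carrier V. shift (- 1) (\<phi> (act GenX v)))"
    by (simp add: act_def)
  show "semilinear (da GenY \<phi>)"
    unfolding eq using assms
    by (intro semilinearI)
      (simp_all add: VD_D act_closed act_add shift_closed shift_add act_X_smul sigma_closed
        shift_minus_1_smult star_closed sigma_inv_star sigma_inv_sigma)
  have "fsupp (da GenY \<phi>) \<subseteq> (`) \<tau> ` fsupp \<phi>"
  proof
    fix m assume "m \<in> fsupp (da GenY \<phi>)"
    then obtain v where v: "m \<in> \<omega>" "v \<in> wt m" "shift (- 1) (\<phi> (act GenX v)) \<noteq> \<zero>\<^bsub>M\<^esub>"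
      unfolding eq by (auto simp: fsupp_def wt_carrier)
    then have "\<sigma> ` m \<in> fsupp \<phi>"
      using wt_X omega_sigma shift_zero by (force simp: fsupp_def)
    then show "m \<in> (`) \<tau> ` fsupp \<phi>"
      using sigma_tau_image(2)[OF omega_subset[OF v(1)]] by (metis imageI)
  qed
  then show "finite (fsupp (da GenY \<phi>))"
    using assms by (auto simp: VD_iff intro: finite_subset)
qed

lemma da_closed: "e \<in> gwa_exprs R \<Longrightarrow> \<phi> \<in> VD \<Longrightarrow> da e \<phi> \<in> VD"
proof (induction e arbitrary: \<phi>)
  case (Coeff r)
  then show ?case
    by (intro da_Coeff_closed) simp_all
next
  case GenX
  then show ?case
    by (intro da_X_closed)
next
  case GenY
  then show ?case
    by (intro da_Y_closed)
qed (simp_all add: VD_add VD_uminus)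

lemma da_val: "e \<in> gwa_exprs R \<Longrightarrow> \<phi> \<in> VD \<Longrightarrow> v \<in> carrier V \<Longrightarrow> da e \<phi> v \<in> carrier M"
  by (simp add: VD_D da_closed)

text \<open>Additivity in the functional is what the relation \<open>distrib_left\<close> demands,
  since there \<open>da e\<close> is applied to a sum.\<close>

lemma da_add:
  assumes "e \<in> gwa_exprs R" "\<phi> \<in> VD" "\<psi> \<in> VD" "v \<in> carrier V"
  shows "da e (\<lambda>v\<in>carrier V. \<phi> v \<oplus>\<^bsub>M\<^esub> \<psi> v) v = da e \<phi> v \<oplus>\<^bsub>M\<^esub> da e \<psi> v"
  using assms
proof (induction e arbitrary: \<phi> \<psi> v)
  case (Coeff r)
  then show ?case
    by (simp add: smul_closed star_closed)
next
  case GenX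
  then show ?case
    by (simp add: da_X act_closed VD_D shift_add del: dual_action.simps)
next
  case GenY
  then show ?case
    by (simp add: da_Y act_closed VD_D shift_add del: dual_action.simps)
next
  case (Plus e f)
  then show ?case
    by (simp add: da_val M.a_ac)
next
  case (Uminus e)
  then show ?case
    by (simp add: da_val M.minus_add)
next
  case (Times e f)
  \<comment> \<open>\<open>da e\<close> takes a whole function as its argument, so the pointwise
    equation for \<open>f\<close> is first upgraded to an equality of functions.\<close>
  have "da f (\<lambda>v\<in>carrier V. \<phi> v \<oplus>\<^bsub>M\<^esub> \<psi> v) = (\<lambda>v\<in>carrier V. da f \<phi> v \<oplus>\<^bsub>M\<^esub> da f \<psi> v)"
  proof (rule VD_eqI)
    fix v assume v: "v \<in> carrier V"
    show "da f (\<lambda>v\<in>carrier V. \<phi> v \<oplus>\<^bsub>M\<^esub> \<psi> v) v = (\<lambda>v\<in>carrier V. da f \<phi> v \<oplus>\<^bsub>M\<^esub> da f \<psi> v) v"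
      unfolding restrict_apply'[OF v] using Times.prems(1) by (intro Times.IH(2) Times.prems(2,3) v) simp
  qed (use Times.prems in \<open>auto intro!: da_closed VD_add simp del: restrict_apply\<close>)
  moreover have "da e (\<lambda>v\<in>carrier V. da f \<phi> v \<oplus>\<^bsub>M\<^esub> da f \<psi> v) v = da e (da f \<phi>) v \<oplus>\<^bsub>M\<^esub> da e (da f \<psi>) v"
    using Times.prems by (intro Times.IH(1) da_closed) simp_all
  ultimately show ?case
    by (simp only: da_Times)
qed

text \<open>Most relations reduce to module laws of the residues. In \<open>Y_X\<close> and
  \<open>X_Y\<close> the opposite shifts cancel and \<open>t\<close> and its image under \<sigma>
  are fixed by \<open>star\<close>; in \<open>coeff_times\<close> the factors come out reversed and
  commutativity of \<open>R\<close> restores them.\<close>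

lemma da_rel:
  assumes "(e, f) \<in> gwa_rel R \<sigma> t" "\<phi> \<in> VD"
  shows "da e \<phi> = da f \<phi>"
  using assms
proof (induction arbitrary: \<phi> rule: gwa_rel.induct)
  case (times_cong e e' f f')
  then show ?case
    by (simp add: da_closed gwa_rel_closed)
next
  case (plus_assoc e f g)
  then show ?case
    by (intro VD_eqI da_closed) (simp_all add: da_val M.a_assoc)
next
  case (plus_comm e f)
  then show ?case
    by (intro VD_eqI da_closed) (simp_all add: da_val M.a_comm)
next
  case (plus_zero e)
  then show ?case
    by (intro VD_eqI da_closed) (simp_all add: da_Coeff da_Plus da_val VD_D del: dual_action.simps)
next
  case (plus_uminus e)
  then show ?case
    by (intro VD_eqI da_closed)
      (simp_all add: da_Coeff da_Plus da_Uminus da_val VD_D M.l_neg del: dual_action.simps)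
next
  case (times_one_left e)
  then show ?case
    by (intro VD_eqI da_closed) (simp_all add: da_closed da_val star_one one_smul)
next
  case (times_one_right e)
  have "da (Coeff \<one>) \<phi> = \<phi>"
    using times_one_right by (intro VD_eqI da_closed) (simp_all add: star_one one_smul)
  then show ?case
    by simp
next
  case (distrib_left e f g)
  then show ?case
    by (intro VD_eqI da_closed) (simp_all add: da_add da_closed)
next
  case (coeff_plus a b)
  then show ?case
    by (intro VD_eqI da_closed)
      (simp_all add: da_Coeff da_Plus VD_D M.smult_l_distr del: dual_action.simps)
next
  case (coeff_times a b)
  then show ?case
    by (intro VD_eqI da_closed)
      (simp_all add: star_mult mult_smul[symmetric] m_comm star_closed smul_closed)
next
  case Y_X
  then show ?case
    by (intro VD_eqI da_closed)
      (simp_all add: t_closed star_t da_X da_Y act_closed shift_shift shift_0 VD_D act_Y_X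
        flip: act_def)
next
  case X_Y
  then show ?case
    by (intro VD_eqI da_closed)
      (simp_all add: t_closed star_t sigma_closed act_closed shift_shift shift_0 VD_D act_X_Y
        flip: act_def sigma_star)
next
  case (X_coeff r)
  then show ?case
    by (intro VD_eqI da_closed)
      (simp_all add: sigma_closed da_Times da_X da_Coeff da_X_closed da_Coeff_closed act_closed VD_D
        shift_1_smult del: dual_action.simps)
next
  case (Y_coeff r)
  then show ?case
    by (intro VD_eqI da_closed)
      (simp_all add: sigma_inv_closed da_Times da_Y da_Coeff da_Y_closed da_Coeff_closed act_closed VD_D
        shift_minus_1_smult del: dual_action.simps)
qed (auto simp: distrib_right)

text \<open>By \<open>da_rel\<close> the image of the class is a singleton, so
  \<open>the_elem\<close> returns the value at any chosen representative.\<close>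

lemma D_smult:
  assumes "e \<in> gwa_exprs R" "\<phi> \<in> VD"
  shows "gwa_class R \<sigma> t e \<odot>\<^bsub>D\<^esub> \<phi> = da e \<phi>"
proof -
  have "(\<lambda>f. da f \<phi>) ` gwa_class R \<sigma> t e = {da e \<phi>}"
    using da_rel[OF _ assms(2), of e] gwa_rel.refl[OF assms(1)] by (auto simp: gwa_class_def)
  then show ?thesis
    by (simp add: finitistic_dual_def)
qed

end

section \<open>Forms and homomorphisms\<close>

context gwa_weight
begin

abbreviation forms where "forms \<equiv> admissible_forms R star \<sigma> t \<omega> V"
abbreviation FG where "FG \<equiv> admissible_form_group R star \<sigma> t \<omega> V"
abbreviation HG where "HG \<equiv> left_module_hom_group A V D"

section \<open>Admissibility reduced to the generators\<close>

definition biadditive :: "('v \<times> 'v \<Rightarrow> 'r set \<Rightarrow> 'r set) \<Rightarrow> bool" where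
  "biadditive F \<longleftrightarrow> F \<in> carrier V \<times> carrier V \<rightarrow>\<^sub>E carrier M \<and>
    (\<forall>u\<in>carrier V. \<forall>v\<in>carrier V. \<forall>w\<in>carrier V. F (u \<oplus>\<^bsub>V\<^esub> v, w) = F (u, w) \<oplus>\<^bsub>M\<^esub> F (v, w)) \<and>
    (\<forall>u\<in>carrier V. \<forall>v\<in>carrier V. \<forall>w\<in>carrier V. F (u, v \<oplus>\<^bsub>V\<^esub> w) = F (u, v) \<oplus>\<^bsub>M\<^esub> F (u, w))"

lemma biadditiveD:
  assumes "biadditive F" "u \<in> carrier V" "v \<in> carrier V"
  shows "F (u, v) \<in> carrier M"
    "w \<in> carrier V \<Longrightarrow> F (u \<oplus>\<^bsub>V\<^esub> v, w) = F (u, w) \<oplus>\<^bsub>M\<^esub> F (v, w)"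
    "w \<in> carrier V \<Longrightarrow> F (u, v \<oplus>\<^bsub>V\<^esub> w) = F (u, v) \<oplus>\<^bsub>M\<^esub> F (u, w)"
  using assms unfolding biadditive_def by auto

lemma biadditive_zero:
  assumes "biadditive F" "v \<in> carrier V"
  shows "F (\<zero>\<^bsub>V\<^esub>, v) = \<zero>\<^bsub>M\<^esub>" "F (v, \<zero>\<^bsub>V\<^esub>) = \<zero>\<^bsub>M\<^esub>"
  using assms additive_zero[OF V.abelian_group_axioms M.abelian_group_axioms, of "\<lambda>u. F (u, v)"]
    additive_zero[OF V.abelian_group_axioms M.abelian_group_axioms, of "\<lambda>u. F (v, u)"]
  by (simp_all add: biadditiveD)

lemma biadditive_uminus:
  assumes "biadditive F" "u \<in> carrier V" "v \<in> carrier V"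
  shows "F (\<ominus>\<^bsub>V\<^esub> u, v) = \<ominus>\<^bsub>M\<^esub> F (u, v)" "F (u, \<ominus>\<^bsub>V\<^esub> v) = \<ominus>\<^bsub>M\<^esub> F (u, v)"
  using assms additive_uminus[OF V.abelian_group_axioms M.abelian_group_axioms, of "\<lambda>u. F (u, v)"]
    additive_uminus[OF V.abelian_group_axioms M.abelian_group_axioms, of "\<lambda>v. F (u, v)"]
  by (simp_all add: biadditiveD)

text \<open>The conjugate-linear law in the second argument does not occur literally in the
  definition of a form: it combines admissibility in degree zero with linearity in the first
  argument. Conversely, the two scalar laws together give back the case of a coefficient.\<close>

definition admissible_on_generators :: "('v \<times> 'v \<Rightarrow> 'r set \<Rightarrow> 'r set) \<Rightarrow> bool" where
  "admissible_on_generators F \<longleftrightarrow> (\<forall>v\<in>carrier V. \<forall>w\<in>carrier V.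
    (\<forall>r\<in>carrier R. F (smul r v, w) = r \<odot>\<^bsub>M\<^esub> F (v, w)) \<and>
    (\<forall>r\<in>carrier R. F (v, smul r w) = star r \<odot>\<^bsub>M\<^esub> F (v, w)) \<and>
    F (act GenX v, w) = shift 1 (F (v, act GenY w)) \<and>
    F (act GenY v, w) = shift (- 1) (F (v, act GenX w)))"

text \<open>Induction on the derivation of homogeneity. In a product the factors cross to the other
  side one after the other, which is the reversal made by \<open>star_expr\<close>, and their
  degrees add as exponents of the shift.\<close>

lemma admissible_homogeneous:
  assumes F: "biadditive F" "admissible_on_generators F"
    and "gwa_homogeneous n e" "e \<in> gwa_exprs R" "v \<in> carrier V" "w \<in> carrier V"
  shows "F (act e v, w) = shift n (F (v, act (star_expr star e) w))"
  using assms(3-)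
proof (induction arbitrary: v w rule: gwa_homogeneous.induct)
  case (1 r)
  then show ?case
    using F(2) by (simp add: admissible_on_generators_def act_Coeff shift_0 star_closed star_star)
next
  case 2
  then show ?case
    using F(2) by (simp add: admissible_on_generators_def)
next
  case 3
  then show ?case
    using F(2) by (simp add: admissible_on_generators_def)
next
  case (4 n e f)
  then show ?case
    by (simp add: act_Plus act_closed star_expr_closed biadditiveD[OF F(1)] shift_add)
next
  case (5 n e)
  then show ?case
    by (simp add: act_Uminus act_closed star_expr_closed biadditiveD[OF F(1)]
        biadditive_uminus[OF F(1)] shift_uminus)
next
  case (6 m e n f)
  then show ?case
    by (simp add: act_Times act_closed star_expr_closed biadditiveD[OF F(1)] shift_shift)
qed

lemma forms_iff: "F \<in> forms \<longleftrightarrow> biadditive F \<and> admissible_on_generators F"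
proof
  assume F: "F \<in> forms"
  have hom: "F (act e v, w) = shift n (F (v, act (star_expr star e) w))"
    if "gwa_homogeneous n e" "e \<in> gwa_exprs R" "v \<in> carrier V" "w \<in> carrier V" for n e v w
  proof -
    have "gwa_class R \<sigma> t e \<in> gwa_component R \<sigma> t n"
      using that by (auto simp: gwa_component_def)
    then show ?thesis
      using F that unfolding admissible_forms_def act_def
      by (simp add: gwa_star_class[symmetric])
  qed
  have sm: "F (smul r v, w) = r \<odot>\<^bsub>M\<^esub> F (v, w)"
    if "r \<in> carrier R" "v \<in> carrier V" "w \<in> carrier V" for r v w
    using F that by (simp add: admissible_forms_def)
  \<comment> \<open>Moving the degree-zero coefficient \<open>star r\<close> across gives the left
    side, while linearity in the first argument gives the right side.\<close>
  have "F (v, smul r w) = star r \<odot>\<^bsub>M\<^esub> F (v, w)"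
    if "r \<in> carrier R" "v \<in> carrier V" "w \<in> carrier V" for r v w
    using that hom[OF gwa_homogeneous.intros(1), of "star r" v w] sm[of "star r" v w]
    by (simp add: act_Coeff star_closed star_star shift_0)
  moreover have "biadditive F"
    using F by (auto simp: admissible_forms_def biadditive_def)
  ultimately show "biadditive F \<and> admissible_on_generators F"
    using sm hom[OF gwa_homogeneous.intros(2)] hom[OF gwa_homogeneous.intros(3)]
    by (simp add: admissible_on_generators_def)
next
  assume F: "biadditive F \<and> admissible_on_generators F"
  have "F (a \<odot>\<^bsub>V\<^esub> v, w) = shift n (F (v, gwa_star R star \<sigma> t a \<odot>\<^bsub>V\<^esub> w))"
    if "a \<in> gwa_component R \<sigma> t n" "v \<in> carrier V" "w \<in> carrier V" for n a v w
    using that admissible_homogeneous[of F n _ v w] F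
    by (auto simp: gwa_component_def gwa_star_class act_def)
  then show "F \<in> forms"
    using F by (auto simp: admissible_forms_def biadditive_def admissible_on_generators_def)
qed

lemma forms_biadditive: "F \<in> forms \<Longrightarrow> biadditive F"
  by (simp add: forms_iff)

lemmas forms_D = biadditiveD[OF forms_biadditive]
  and forms_zero = biadditive_zero[OF forms_biadditive]

lemma forms_generators:
  assumes "F \<in> forms" "v \<in> carrier V" "w \<in> carrier V"
  shows "r \<in> carrier R \<Longrightarrow> F (smul r v, w) = r \<odot>\<^bsub>M\<^esub> F (v, w)"
    "r \<in> carrier R \<Longrightarrow> F (v, smul r w) = star r \<odot>\<^bsub>M\<^esub> F (v, w)"
    "F (act GenX v, w) = shift 1 (F (v, act GenY w))"
    "F (act GenY v, w) = shift (- 1) (F (v, act GenX w))"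
  using assms by (simp_all add: forms_iff admissible_on_generators_def)

lemma forms_extensional: "F \<in> forms \<Longrightarrow> F \<in> extensional (carrier V \<times> carrier V)"
  by (auto simp: forms_iff biadditive_def PiE_iff)

lemma forms_eqI:
  "\<lbrakk>F \<in> forms; G \<in> forms; \<And>u v. u \<in> carrier V \<Longrightarrow> v \<in> carrier V \<Longrightarrow> F (u, v) = G (u, v)\<rbrakk> \<Longrightarrow> F = G"
  by (rule extensionalityI[OF forms_extensional forms_extensional]) auto

lemma formsI:
  assumes "\<And>u v. \<lbrakk>u \<in> carrier V; v \<in> carrier V\<rbrakk> \<Longrightarrow> f u v \<in> carrier M"
    and "\<And>u v w. \<lbrakk>u \<in> carrier V; v \<in> carrier V; w \<in> carrier V\<rbrakk> \<Longrightarrow> f (u \<oplus>\<^bsub>V\<^esub> v) w = f u w \<oplus>\<^bsub>M\<^esub> f v w"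
    and "\<And>u v w. \<lbrakk>u \<in> carrier V; v \<in> carrier V; w \<in> carrier V\<rbrakk> \<Longrightarrow> f u (v \<oplus>\<^bsub>V\<^esub> w) = f u v \<oplus>\<^bsub>M\<^esub> f u w"
    and "\<And>r v w. \<lbrakk>r \<in> carrier R; v \<in> carrier V; w \<in> carrier V\<rbrakk> \<Longrightarrow> f (smul r v) w = r \<odot>\<^bsub>M\<^esub> f v w"
    and "\<And>r v w. \<lbrakk>r \<in> carrier R; v \<in> carrier V; w \<in> carrier V\<rbrakk> \<Longrightarrow> f v (smul r w) = star r \<odot>\<^bsub>M\<^esub> f v w"
    and "\<And>v w. \<lbrakk>v \<in> carrier V; w \<in> carrier V\<rbrakk> \<Longrightarrow> f (act GenX v) w = shift 1 (f v (act GenY w))"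
    and "\<And>v w. \<lbrakk>v \<in> carrier V; w \<in> carrier V\<rbrakk> \<Longrightarrow> f (act GenY v) w = shift (- 1) (f v (act GenX w))"
    and "F = (\<lambda>x\<in>carrier V \<times> carrier V. f (fst x) (snd x))"
  shows "F \<in> forms"
  using assms(1-7) unfolding assms(8) forms_iff biadditive_def admissible_on_generators_def
  by (auto simp: smul_closed act_closed)

section \<open>Forms as a commutative group\<close>

lemma forms_add:
  assumes "F \<in> forms" "G \<in> forms"
  shows "(\<lambda>x\<in>carrier V \<times> carrier V. F x \<oplus>\<^bsub>M\<^esub> G x) \<in> forms"
  by (rule formsI[where f = "\<lambda>u v. F (u, v) \<oplus>\<^bsub>M\<^esub> G (u, v)"])
    (simp_all add: assms forms_D forms_generators M.smult_r_distr star_closed act_closed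
      shift_add M.a_ac)

lemma forms_uminus:
  assumes "F \<in> forms"
  shows "(\<lambda>x\<in>carrier V \<times> carrier V. \<ominus>\<^bsub>M\<^esub> F x) \<in> forms"
  by (rule formsI[where f = "\<lambda>u v. \<ominus>\<^bsub>M\<^esub> F (u, v)"])
    (simp_all add: assms forms_D forms_generators M.smult_r_minus star_closed act_closed
      shift_uminus M.minus_add)

lemma forms_null: "(\<lambda>x\<in>carrier V \<times> carrier V. \<zero>\<^bsub>M\<^esub>) \<in> forms"
  by (rule formsI[where f = "\<lambda>u v. \<zero>\<^bsub>M\<^esub>"]) (simp_all add: shift_zero star_closed)

lemma comm_group_forms: "comm_group FG"
proof (rule comm_groupI)
  fix F G H assume "F \<in> carrier FG" "G \<in> carrier FG" "H \<in> carrier FG"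
  then have FGH: "F \<in> forms" "G \<in> forms" "H \<in> forms"
    by (simp_all add: admissible_form_group_def)
  show "F \<otimes>\<^bsub>FG\<^esub> G \<in> carrier FG"
    using FGH by (simp add: admissible_form_group_def forms_add)
  show "F \<otimes>\<^bsub>FG\<^esub> G \<otimes>\<^bsub>FG\<^esub> H = F \<otimes>\<^bsub>FG\<^esub> (G \<otimes>\<^bsub>FG\<^esub> H)"
    using FGH by (auto simp: admissible_form_group_def forms_D M.a_assoc)
  show "F \<otimes>\<^bsub>FG\<^esub> G = G \<otimes>\<^bsub>FG\<^esub> F"
    using FGH by (auto simp: admissible_form_group_def forms_D M.a_comm)
next
  fix F assume "F \<in> carrier FG"
  then have F: "F \<in> forms"
    by (simp add: admissible_form_group_def)
  show "\<one>\<^bsub>FG\<^esub> \<otimes>\<^bsub>FG\<^esub> F = F"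
    using F by (intro extensionalityI[OF _ forms_extensional[OF F]])
      (auto simp: admissible_form_group_def forms_D)
  show "\<exists>G\<in>carrier FG. G \<otimes>\<^bsub>FG\<^esub> F = \<one>\<^bsub>FG\<^esub>"
    using F by (intro bexI[of _ "\<lambda>x\<in>carrier V \<times> carrier V. \<ominus>\<^bsub>M\<^esub> F x"])
      (auto simp: admissible_form_group_def forms_uminus forms_D M.l_neg)
qed (simp add: admissible_form_group_def forms_null)

section \<open>The correspondence between forms and homomorphisms\<close>

lemma forms_annihilated:
  assumes "F \<in> forms" "u \<in> wt n" "n \<subseteq> carrier R" "v \<in> carrier V"
  shows "annihilated_by n (F (u, v))"
  using assms forms_generators(1)[OF assms(1) wt_carrier[OF assms(2)] assms(4), symmetric]
  by (auto simp: annihilated_by_def wt_smul_zero forms_zero subset_iff)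

lemma form_to_hom_apply:
  "u \<in> carrier V \<Longrightarrow> v \<in> carrier V \<Longrightarrow> form_to_hom V F u v = F (u, v)"
  by (simp add: form_to_hom_def)

lemma form_semilinear:
  assumes "F \<in> forms" "u \<in> carrier V"
  shows "semilinear (form_to_hom V F u)"
proof -
  have "semilinear (\<lambda>v\<in>carrier V. F (u, v))"
    using assms by (intro semilinearI) (simp_all add: forms_D forms_generators)
  then show ?thesis
    using assms(2) by (simp add: form_to_hom_def)
qed

lemma form_weights:
  assumes F: "F \<in> forms" and "maximalideal n R" "u \<in> wt n" "m \<in> \<omega>" "v \<in> wt m" and nz: "F (u, v) \<noteq> \<zero>\<^bsub>M\<^esub>"
  shows "n = star ` m"
proof (rule ccontr)
  assume neq: "n \<noteq> star ` m"
  note m = star_image_maximal[OF assms(4)]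
  have x: "F (u, v) \<in> carrier M"
    using assms by (simp add: forms_D wt_carrier)
  have 1: "annihilated_by n (F (u, v))"
    using assms by (simp add: forms_annihilated maximalideal_subset wt_carrier)
  have 2: "annihilated_by (star ` m) (F (u, v))"
    using semilinear_annihilated[OF form_semilinear[OF F wt_carrier[OF assms(3)]] omega_subset assms(5)] assms
    by (simp add: form_to_hom_apply wt_carrier)
  have "F (u, v) = \<zero>\<^bsub>M\<^esub>"
  proof (rule M_eqI[OF x M_zero_closed])
    fix k assume k: "k \<in> \<omega>"
    \<comment> \<open>At each k at least one of the two distinct maximal ideals differs from k, and
      that one forces the component to be zero.\<close>
    show "F (u, v) k = \<zero>\<^bsub>M\<^esub> k"
      using annihilated_by_component[OF m x 2 k] annihilated_by_component[OF assms(2) x 1 k]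
        neq by (auto simp: M_zero k)
  qed
  with nz show False ..
qed

text \<open>The vectors whose functional has finite support form a submodule, and for a weight
  vector the support has at most one element, the conjugate of its weight.\<close>

lemma form_functional:
  assumes F: "F \<in> forms" and u: "u \<in> carrier V"
  shows "form_to_hom V F u \<in> VD"
proof -
  let ?W = "{u \<in> carrier V. finite (fsupp (form_to_hom V F u))}"
  have "rsub ?W"
    unfolding rsub_def
  proof (intro conjI ballI)
    have "fsupp (form_to_hom V F \<zero>\<^bsub>V\<^esub>) = {}"
      using forms_zero(1)[OF F] by (auto simp: fsupp_def form_to_hom_apply wt_carrier)
    then show "\<zero>\<^bsub>V\<^esub> \<in> ?W"
      by simp
  next
    fix v w assume vw: "v \<in> ?W" "w \<in> ?W"
    then have "form_to_hom V F (v \<oplus>\<^bsub>V\<^esub> w)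
        = (\<lambda>x\<in>carrier V. form_to_hom V F v x \<oplus>\<^bsub>M\<^esub> form_to_hom V F w x)"
      by (auto simp: form_to_hom_def forms_D[OF F])
    from fsupp_add[OF this] show "v \<oplus>\<^bsub>V\<^esub> w \<in> ?W"
      using vw by (auto intro: finite_subset)
  next
    fix r v assume rv: "r \<in> carrier R" "v \<in> ?W"
    then have "fsupp (form_to_hom V F (smul r v)) \<subseteq> fsupp (form_to_hom V F v)"
      by (auto simp: fsupp_def form_to_hom_apply wt_carrier smul_closed forms_generators[OF F])
    then show "smul r v \<in> ?W"
      using rv by (auto simp: smul_closed intro: finite_subset)
  qed simp
  moreover have "wt n \<subseteq> ?W" if n: "n \<in> \<omega>" for n
  proof
    fix u assume u: "u \<in> wt n"
    have "fsupp (form_to_hom V F u) \<subseteq> {star ` n}"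
    proof
      fix m assume "m \<in> fsupp (form_to_hom V F u)"
      then obtain v where v: "m \<in> \<omega>" "v \<in> wt m" "F (u, v) \<noteq> \<zero>\<^bsub>M\<^esub>"
        using u by (auto simp: fsupp_def form_to_hom_apply wt_carrier)
      then have "n = star ` m"
        by (rule form_weights[OF F omega_maximal[OF n] u])
      then show "m \<in> {star ` n}"
        using star_star_image[OF omega_subset[OF v(1)]] by simp
    qed
    then show "u \<in> ?W"
      using u by (auto simp: wt_carrier intro: finite_subset)
  qed
  ultimately have "u \<in> ?W"
    using u by (rule rsub_all)
  then show ?thesis
    using form_semilinear[OF F u] by (simp add: VD_iff)
qed

text \<open>The shifts are built into \<open>da\<close>, so the laws on generators extend by
  induction to inhomogeneous expressions as well, sums being treated termwise.\<close>

lemma form_act: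
  assumes F: "F \<in> forms" and "e \<in> gwa_exprs R" "u \<in> carrier V"
  shows "form_to_hom V F (act e u) = da e (form_to_hom V F u)"
  using assms(2-)
proof (induction e arbitrary: u)
  case (Coeff r)
  then show ?case
    by (intro VD_eqI da_closed form_functional[OF F] act_closed)
      (simp_all add: da_Coeff form_functional[OF F] form_to_hom_apply act_Coeff smul_closed
        forms_generators[OF F] del: dual_action.simps)
next
  case GenX
  then show ?case
    by (intro VD_eqI da_closed form_functional[OF F] act_closed)
      (simp_all add: da_X form_to_hom_apply act_closed forms_generators[OF F] del: dual_action.simps)
next
  case GenY
  then show ?case
    by (intro VD_eqI da_closed form_functional[OF F] act_closed)
      (simp_all add: da_Y form_to_hom_apply act_closed forms_generators[OF F] del: dual_action.simps)
next
  case (Plus e f)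
  show ?case
  proof (intro VD_eqI da_closed form_functional[OF F] act_closed)
    fix v assume v: "v \<in> carrier V"
    have "F (act e u, v) = da e (form_to_hom V F u) v" "F (act f u, v) = da f (form_to_hom V F u) v"
      using Plus v by (simp_all add: act_closed flip: form_to_hom_apply)
    then show "form_to_hom V F (act (Plus e f) u) v = da (Plus e f) (form_to_hom V F u) v"
      using Plus.prems v by (simp add: act_Plus act_closed form_to_hom_apply forms_D[OF F])
  qed (use Plus.prems in simp_all)
next
  case (Uminus e)
  show ?case
  proof (intro VD_eqI da_closed form_functional[OF F] act_closed)
    fix v assume v: "v \<in> carrier V"
    have "F (act e u, v) = da e (form_to_hom V F u) v"
      using Uminus v by (simp add: act_closed flip: form_to_hom_apply)
    then show "form_to_hom V F (act (Uminus e) u) v = da (Uminus e) (form_to_hom V F u) v"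
      using Uminus.prems v biadditive_uminus(1)[OF forms_biadditive[OF F]]
      by (simp add: act_Uminus act_closed form_to_hom_apply)
  qed (use Uminus.prems in simp_all)
next
  case (Times e f)
  then show ?case
    by (simp add: act_Times act_closed)
qed

lemma carrier_D: "carrier D = VD"
  and add_D: "\<phi> \<oplus>\<^bsub>D\<^esub> \<psi> = (\<lambda>v\<in>carrier V. \<phi> v \<oplus>\<^bsub>M\<^esub> \<psi> v)"
  and zero_D: "\<zero>\<^bsub>D\<^esub> = (\<lambda>v\<in>carrier V. \<zero>\<^bsub>M\<^esub>)"
  by (simp_all add: finitistic_dual_def)

lemma form_to_hom_in_hom:
  assumes F: "F \<in> forms"
  shows "form_to_hom V F \<in> left_module_hom A V D"
proof -
  have "form_to_hom V F (a \<odot>\<^bsub>V\<^esub> v) = a \<odot>\<^bsub>D\<^esub> form_to_hom V F v"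
    if "a \<in> carrier A" "v \<in> carrier V" for a v
  proof -
    obtain e where "e \<in> gwa_exprs R" "a = gwa_class R \<sigma> t e"
      using \<open>a \<in> carrier A\<close> by (auto simp: carrier_gwa)
    then show ?thesis
      using form_act[OF F, of e v] that by (simp add: D_smult form_functional[OF F] act_def)
  qed
  moreover have "form_to_hom V F (v \<oplus>\<^bsub>V\<^esub> w) = form_to_hom V F v \<oplus>\<^bsub>D\<^esub> form_to_hom V F w"
    if "v \<in> carrier V" "w \<in> carrier V" for v w
    using that by (auto simp: add_D form_to_hom_def forms_D[OF F])
  moreover have "form_to_hom V F \<in> carrier V \<rightarrow>\<^sub>E carrier D"
    using form_functional[OF F] by (auto simp: carrier_D) (simp add: form_to_hom_def)
  ultimately show ?thesis
    by (simp add: left_module_hom_def)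
qed

text \<open>Uncurrying inverts \<open>form_to_hom\<close>. The laws in the second argument hold
  because each \<open>h v\<close> lies in the dual, those in the first because \<open>h\<close> is
  additive and commutes with coefficients and generators.\<close>

lemma hom_to_form:
  assumes h: "h \<in> left_module_hom A V D"
  defines "F \<equiv> \<lambda>x\<in>carrier V \<times> carrier V. h (fst x) (snd x)"
  shows "F \<in> forms" "form_to_hom V F = h"
proof -
  have VD: "h u \<in> VD" if "u \<in> carrier V" for u
    using h that by (auto simp: left_module_hom_def carrier_D)
  have add: "h (v \<oplus>\<^bsub>V\<^esub> w) = h v \<oplus>\<^bsub>D\<^esub> h w" if "v \<in> carrier V" "w \<in> carrier V" for v w
    using h that by (simp add: left_module_hom_def)
  have act: "h (act e v) = da e (h v)" if "e \<in> gwa_exprs R" "v \<in> carrier V" for e v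
    using h that D_smult[OF that(1) VD[OF that(2)]]
    by (simp add: left_module_hom_def carrier_gwa act_def)
  show F: "F \<in> forms"
  proof (rule formsI[where f = h])
    show "h (smul r v) w = r \<odot>\<^bsub>M\<^esub> h v w" if "r \<in> carrier R" "v \<in> carrier V" "w \<in> carrier V" for r v w
      using act[of "Coeff r" v] that da_Coeff[OF VD, of v w r] by (simp add: act_Coeff)
    show "h (act GenX v) w = shift 1 (h v (act GenY w))" if "v \<in> carrier V" "w \<in> carrier V" for v w
      using act[of GenX v] that da_X[of w] by simp
    show "h (act GenY v) w = shift (- 1) (h v (act GenX w))" if "v \<in> carrier V" "w \<in> carrier V" for v w
      using act[of GenY v] that da_Y[of w] by simp
  qed (simp_all add: VD VD_D add add_D F_def)
  show "form_to_hom V F = h"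
  proof (rule extensionalityI)
    show "form_to_hom V F \<in> extensional (carrier V)"
      by (simp add: form_to_hom_def)
    show "h \<in> extensional (carrier V)"
      using h by (auto simp: left_module_hom_def PiE_iff)
    fix u assume u: "u \<in> carrier V"
    show "form_to_hom V F u = h u"
      by (rule VD_eqI[OF form_functional[OF F u] VD[OF u]])
        (simp add: u form_to_hom_apply F_def)
  qed
qed

lemma form_to_hom_iso: "form_to_hom V \<in> iso FG HG"
  unfolding iso_def
proof (intro CollectI conjI)
  show "form_to_hom V \<in> hom FG HG"
  proof (rule homI)
    fix F assume "F \<in> carrier FG"
    then show "form_to_hom V F \<in> carrier HG"
      by (simp add: admissible_form_group_def left_module_hom_group_def form_to_hom_in_hom)
  next
    fix F G assume "F \<in> carrier FG" "G \<in> carrier FG"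
    then show "form_to_hom V (F \<otimes>\<^bsub>FG\<^esub> G) = form_to_hom V F \<otimes>\<^bsub>HG\<^esub> form_to_hom V G"
      by (auto simp: admissible_form_group_def left_module_hom_group_def add_D form_to_hom_def
          intro!: restrict_ext)
  qed
  show "bij_betw (form_to_hom V) (carrier FG) (carrier HG)"
  proof (rule bij_betw_imageI)
    show "inj_on (form_to_hom V) (carrier FG)"
    proof (rule inj_onI)
      fix F G assume FG: "F \<in> carrier FG" "G \<in> carrier FG" "form_to_hom V F = form_to_hom V G"
      show "F = G"
      proof (rule forms_eqI)
        fix u v assume "u \<in> carrier V" "v \<in> carrier V"
        then show "F (u, v) = G (u, v)"
          using fun_cong[OF fun_cong[OF FG(3), of u], of v] by (simp add: form_to_hom_apply)
      qed (use FG in \<open>simp_all add: admissible_form_group_def\<close>)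
    qed
    show "form_to_hom V ` carrier FG = carrier HG"
    proof (intro subset_antisym subsetI)
      fix h assume "h \<in> carrier HG"
      then have h: "h \<in> left_module_hom A V D"
        by (simp add: left_module_hom_group_def)
      have "form_to_hom V (\<lambda>x\<in>carrier V \<times> carrier V. h (fst x) (snd x)) \<in> form_to_hom V ` forms"
        by (rule imageI[OF hom_to_form(1)[OF h]])
      then show "h \<in> form_to_hom V ` carrier FG"
        unfolding hom_to_form(2)[OF h] by (simp add: admissible_form_group_def)
    qed (auto simp: admissible_form_group_def left_module_hom_group_def form_to_hom_in_hom)
  qed
qed

text \<open>The group laws are carried over from the forms along a surjective homomorphism. The
  image structure has the image of the unit as its unit, hence the separate equation for
  units.\<close>

lemma comm_group_homs: "comm_group HG"
proof -
  interpret FG: comm_group FG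
    by (rule comm_group_forms)
  have "form_to_hom V \<in> hom FG HG" "form_to_hom V ` carrier FG = carrier HG"
    using form_to_hom_iso by (auto simp: iso_def bij_betw_def)
  moreover have "form_to_hom V \<one>\<^bsub>FG\<^esub> = \<one>\<^bsub>HG\<^esub>"
    by (auto simp: admissible_form_group_def left_module_hom_group_def zero_D form_to_hom_def
        intro!: restrict_ext)
  ultimately show ?thesis
    using FG.hom_imp_img_comm_group[of "form_to_hom V" HG] by simp
qed

end

section \<open>Non-degenerate forms\<close>

context gwa_weight
begin

section \<open>A functional that does not vanish at a given vector\<close>

lemma star_sigma_image: "m \<subseteq> carrier R \<Longrightarrow> star ` \<sigma> ` m = \<sigma> ` star ` m"
  and star_tau_image: "m \<subseteq> carrier R \<Longrightarrow> star ` \<tau> ` m = \<tau> ` star ` m"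
  unfolding image_image by (auto intro!: image_cong simp: subset_iff sigma_star sigma_inv_star)

text \<open>Since \<open>star\<close> commutes with \<sigma>, conjugation permutes orbits as wholes:
  one ideal with its conjugate in \<omega> decides for all.\<close>

lemma star_omega:
  assumes "m0 \<in> \<omega>" "star ` m0 \<in> \<omega>" "m \<in> \<omega>"
  shows "star ` m \<in> \<omega>"
  using assms
  by (rule omega_induct) (simp_all add: star_sigma_image star_tau_image omega_subset omega_sigma omega_tau)

lemma rsub_avoiding:
  assumes v: "v \<in> carrier V" "v \<noteq> \<zero>\<^bsub>V\<^esub>"
  obtains W where "rsub W" "v \<notin> W" "\<And>U. rsub U \<Longrightarrow> v \<notin> U \<Longrightarrow> W \<subseteq> U \<Longrightarrow> U = W"
proof -
  let ?\<A> = "{W. rsub W \<and> v \<notin> W}"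
  have "\<exists>W\<in>?\<A>. \<forall>U\<in>?\<A>. W \<subseteq> U \<longrightarrow> U = W"
  proof (rule subset_Zorn_nonempty)
    have "rsub {\<zero>\<^bsub>V\<^esub>}"
      by (auto simp: rsub_def smul_zero)
    then show "?\<A> \<noteq> {}"
      using v(2) by blast
  next
    fix \<C> assume ne: "\<C> \<noteq> {}" and chain: "subset.chain ?\<A> \<C>"
    have mem: "rsub W \<and> v \<notin> W" if "W \<in> \<C>" for W
      using chain that by (auto simp: subset.chain_def)
    have "x \<oplus>\<^bsub>V\<^esub> y \<in> \<Union>\<C>" if xy: "x \<in> \<Union>\<C>" "y \<in> \<Union>\<C>" for x y
    proof -
      obtain W where "W \<in> \<C>" "x \<in> W" "y \<in> W"
        using xy chain by (auto simp: subset_chain_def) blast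
      then show ?thesis
        using mem rsubD(3) by blast
    qed
    moreover have "\<zero>\<^bsub>V\<^esub> \<in> \<Union>\<C>"
      using ne mem rsubD(2) by blast
    moreover have "\<Union>\<C> \<subseteq> carrier V"
      using mem rsubD(1) by blast
    moreover have "smul r x \<in> \<Union>\<C>" if "r \<in> carrier R" "x \<in> \<Union>\<C>" for r x
      using that mem rsubD(4) by blast
    ultimately have "rsub (\<Union>\<C>)"
      unfolding rsub_def by blast
    then show "\<Union>\<C> \<in> ?\<A>"
      using mem by blast
  qed
  then show thesis
    using that by blast
qed

text \<open>The difference of the two scalars lies in \<open>m\<close> and kills \<open>v\<close>.
  In this way inverses modulo \<open>m\<close> become available on weight vectors.\<close>

lemma wt_coset_smul:
  assumes m: "m \<in> \<omega>" and v: "v \<in> wt m" and ab: "a \<in> carrier R" "b \<in> carrier R" "m +> a = m +> b"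
  shows "smul a v = smul b v"
proof -
  interpret m: ideal m R
    by (rule omega_ideal[OF m])
  have "a \<ominus> b \<in> m"
    using ab quotient_eq_iff_same_a_r_cos[OF m.is_ideal, of a b] by blast
  then have "smul (a \<ominus> b) v = \<zero>\<^bsub>V\<^esub>"
    by (rule wt_smul_zero[OF v])
  moreover have "smul a v = smul (a \<ominus> b) v \<oplus>\<^bsub>V\<^esub> smul b v"
    using ab(1,2) wt_carrier[OF v]
    by (simp flip: add_smul) (simp add: a_minus_def a_assoc l_neg)
  ultimately show ?thesis
    using ab(2) wt_carrier[OF v] by (simp add: smul_closed)
qed

lemma V_diff_zero: "x \<in> carrier V \<Longrightarrow> x \<ominus>\<^bsub>V\<^esub> \<zero>\<^bsub>V\<^esub> = x"
  using V.minus_equality[of "\<zero>\<^bsub>V\<^esub>" "\<zero>\<^bsub>V\<^esub>"] by (simp add: a_minus_def)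

lemma V_diff_sum: "\<lbrakk>x \<in> carrier V; w \<in> carrier V; y \<in> carrier V; x = w \<oplus>\<^bsub>V\<^esub> y\<rbrakk> \<Longrightarrow> y \<ominus>\<^bsub>V\<^esub> x = \<ominus>\<^bsub>V\<^esub> w"
  by (simp add: a_minus_def V.minus_add V.a_lcomm[of y "\<ominus>\<^bsub>V\<^esub> w" "\<ominus>\<^bsub>V\<^esub> y"] V.r_neg)

text \<open>The ideal is found from W: some weight space, at m, is not inside W. A vector w of it
  outside W generates v modulo W, so v inherits the annihilator m; inverting the coefficient modulo
  m then expresses w through v.\<close>

lemma separating_hyperplane:
  assumes v: "v \<in> carrier V" "v \<noteq> \<zero>\<^bsub>V\<^esub>"
  obtains m W where "m \<in> \<omega>" "rsub W" "v \<notin> W" "\<And>r. r \<in> carrier R \<Longrightarrow> smul r v \<in> W \<longleftrightarrow> r \<in> m"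
    "\<And>w. w \<in> carrier V \<Longrightarrow> \<exists>r\<in>carrier R. w \<ominus>\<^bsub>V\<^esub> smul r v \<in> W"
    "\<And>n. n \<in> \<omega> \<Longrightarrow> n \<noteq> m \<Longrightarrow> wt n \<subseteq> W"
proof -
  obtain W where W: "rsub W" "v \<notin> W" and max: "\<And>U. rsub U \<Longrightarrow> v \<notin> U \<Longrightarrow> W \<subseteq> U \<Longrightarrow> U = W"
    using rsub_avoiding[OF v] by blast
  note WD = rsubD[OF W(1)]
  \<comment> \<open>Otherwise W + R w would be a strictly larger submodule that still avoids
    \<open>v\<close>.\<close>
  have decomp: "\<exists>x\<in>W. \<exists>s\<in>carrier R. v = x \<oplus>\<^bsub>V\<^esub> smul s w" if w: "w \<in> carrier V" "w \<notin> W" for w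
  proof (rule ccontr)
    assume no: "\<not> ?thesis"
    let ?U = "{x \<oplus>\<^bsub>V\<^esub> smul s w | x s. x \<in> W \<and> s \<in> carrier R}"
    have "rsub ?U"
      unfolding rsub_def
    proof (intro conjI ballI)
      show "?U \<subseteq> carrier V"
        using w by (auto simp: WD(1) smul_closed)
      show "\<zero>\<^bsub>V\<^esub> \<in> ?U"
        using w WD(2) zero_smul by (intro CollectI exI[of _ "\<zero>\<^bsub>V\<^esub>"] exI[of _ \<zero>]) simp
    next
      fix p q assume "p \<in> ?U" "q \<in> ?U"
      then obtain x s y u where xs: "p = x \<oplus>\<^bsub>V\<^esub> smul s w" "x \<in> W" "s \<in> carrier R"
        and yu: "q = y \<oplus>\<^bsub>V\<^esub> smul u w" "y \<in> W" "u \<in> carrier R"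
        by blast
      then have "p \<oplus>\<^bsub>V\<^esub> q = (x \<oplus>\<^bsub>V\<^esub> y) \<oplus>\<^bsub>V\<^esub> smul (s \<oplus> u) w"
        using w by (simp add: add_smul WD(1) smul_closed V.a_ac)
      then show "p \<oplus>\<^bsub>V\<^esub> q \<in> ?U"
        using xs yu WD(3) by blast
    next
      fix r p assume r: "r \<in> carrier R" and "p \<in> ?U"
      then obtain x s where xs: "p = x \<oplus>\<^bsub>V\<^esub> smul s w" "x \<in> W" "s \<in> carrier R"
        by blast
      then have "smul r p = smul r x \<oplus>\<^bsub>V\<^esub> smul (r \<otimes> s) w"
        using w r by (simp add: smul_add mult_smul WD(1) smul_closed)
      then show "smul r p \<in> ?U"
        using xs r WD(4) by blast
    qed
    moreover have "v \<notin> ?U"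
      using no by blast
    moreover have "W \<subseteq> ?U"
    proof
      fix x assume "x \<in> W"
      then show "x \<in> ?U"
        using w WD(1) zero_smul by (intro CollectI exI[of _ x] exI[of _ \<zero>]) simp
    qed
    ultimately have "?U = W"
      by (rule max)
    moreover have "w \<in> ?U"
      using w WD(2) one_smul by (intro CollectI exI[of _ "\<zero>\<^bsub>V\<^esub>"] exI[of _ \<one>]) simp
    ultimately show False
      using w(2) by blast
  qed
  have "\<exists>m\<in>\<omega>. \<not> wt m \<subseteq> W"
    using rsub_all[OF W(1) _ v(1)] W(2) by blast
  have quot: "smul r v \<in> W \<longleftrightarrow> r \<in> m"
    if m: "m \<in> \<omega>" and w: "w \<in> wt m" "w \<notin> W" and r: "r \<in> carrier R" for m w r
  proof
    obtain x s where xs: "x \<in> W" "s \<in> carrier R" "v = x \<oplus>\<^bsub>V\<^esub> smul s w"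
      using decomp wt_carrier w by blast
    assume "r \<in> m"
    then have "smul (s \<otimes> r) w = \<zero>\<^bsub>V\<^esub>"
      using xs(2) r w wt_smul_zero by (simp add: mult_smul wt_carrier smul_zero)
    then have "smul r (smul s w) = \<zero>\<^bsub>V\<^esub>"
      using xs(2) r w by (simp flip: mult_smul add: m_comm wt_carrier)
    then have "smul r v = smul r x"
      using xs r w WD(1) by (simp add: smul_add smul_closed wt_carrier)
    then show "smul r v \<in> W"
      using WD(4) xs r by simp
  next
    \<comment> \<open>If r were not in m, some u would satisfy u r = 1 modulo m. Multiplying v = x +
      s w by u r fixes s w modulo nothing but changes x inside W, so s w, and then v, would lie in
      W.\<close>
    assume rv: "smul r v \<in> W"
    show "r \<in> m"
    proof (rule ccontr)
      assume "r \<notin> m"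
      then obtain u where u: "u \<in> carrier R" "m +> u \<otimes> r = m +> \<one>"
        using maximalideal_inverse[OF omega_maximal[OF m] r] by blast
      obtain x s where xs: "x \<in> W" "s \<in> carrier R" "v = x \<oplus>\<^bsub>V\<^esub> smul s w"
        using decomp wt_carrier w by blast
      let ?q = "u \<otimes> r"
      have w': "w \<in> carrier V"
        using w by (simp add: wt_carrier)
      have q: "?q \<in> carrier R"
        using u r by simp
      have "smul ?q (smul s w) = smul s (smul ?q w)"
        using q xs w' by (simp flip: mult_smul add: m_comm)
      also have "smul ?q w = w"
        using wt_coset_smul[OF m w(1) q one_closed u(2)] w' by (simp add: one_smul)
      finally have "smul ?q v = smul ?q x \<oplus>\<^bsub>V\<^esub> smul s w"
        using xs q w' WD(1) by (simp add: smul_add smul_closed)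
      moreover have "smul ?q v \<in> W"
        using rv u r v WD(4)[OF u(1) rv] by (simp add: mult_smul)
      moreover have "smul ?q x \<in> W"
        using WD(4) q xs by simp
      ultimately have "smul s w \<in> W"
        using WD(5) WD(3)[of "\<ominus>\<^bsub>V\<^esub> smul ?q x" "smul ?q v"] xs w' WD(1)
        by (simp add: V.r_neg1 smul_closed q)
      then show False
        using xs W(2) WD(3) by simp
    qed
  qed
  obtain m w where m: "m \<in> \<omega>" and w: "w \<in> wt m" "w \<notin> W"
    using \<open>\<exists>m\<in>\<omega>. \<not> wt m \<subseteq> W\<close> by blast
  \<comment> \<open>A second weight space reaching outside W would have the same set of scalars
    carrying v into W, and this set is the ideal itself.\<close>
  have wt_n: "wt n \<subseteq> W" if n: "n \<in> \<omega>" "n \<noteq> m" for n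
  proof
    fix x assume x: "x \<in> wt n"
    show "x \<in> W"
    proof (rule ccontr)
      assume "x \<notin> W"
      then have "r \<in> n \<longleftrightarrow> r \<in> m" if "r \<in> carrier R" for r
        using quot[OF n(1) x _ that] quot[OF m w that] by blast
      then have "n = m"
        using omega_subset n(1) m by blast
      with n(2) show False ..
    qed
  qed
  \<comment> \<open>This set is W + R v, written through differences; it is shown to contain every
    weight space.\<close>
  let ?S = "{x \<in> carrier V. \<exists>r\<in>carrier R. x \<ominus>\<^bsub>V\<^esub> smul r v \<in> W}"
  have "rsub ?S"
    unfolding rsub_def
  proof (intro conjI ballI)
    show "\<zero>\<^bsub>V\<^esub> \<in> ?S"
      using v WD(2) by (auto intro!: bexI[of _ \<zero>] simp: zero_smul V_diff_zero)
  next
    fix x y assume "x \<in> ?S" "y \<in> ?S"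
    then obtain r s where rs: "x \<in> carrier V" "r \<in> carrier R" "x \<ominus>\<^bsub>V\<^esub> smul r v \<in> W"
      "y \<in> carrier V" "s \<in> carrier R" "y \<ominus>\<^bsub>V\<^esub> smul s v \<in> W"
      by blast
    have "(x \<oplus>\<^bsub>V\<^esub> y) \<ominus>\<^bsub>V\<^esub> smul (r \<oplus> s) v = (x \<ominus>\<^bsub>V\<^esub> smul r v) \<oplus>\<^bsub>V\<^esub> (y \<ominus>\<^bsub>V\<^esub> smul s v)"
      using rs v by (simp add: a_minus_def add_smul V.minus_add V.a_ac smul_closed)
    then have "(x \<oplus>\<^bsub>V\<^esub> y) \<ominus>\<^bsub>V\<^esub> smul (r \<oplus> s) v \<in> W"
      using WD(3) rs by simp
    then show "x \<oplus>\<^bsub>V\<^esub> y \<in> ?S"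
      using rs by auto
  next
    fix a x assume a: "a \<in> carrier R" and "x \<in> ?S"
    then obtain r where r: "x \<in> carrier V" "r \<in> carrier R" "x \<ominus>\<^bsub>V\<^esub> smul r v \<in> W"
      by blast
    have "smul a x \<ominus>\<^bsub>V\<^esub> smul (a \<otimes> r) v = smul a (x \<ominus>\<^bsub>V\<^esub> smul r v)"
      using r v a by (simp add: a_minus_def smul_add smul_uminus mult_smul smul_closed)
    then have "smul a x \<ominus>\<^bsub>V\<^esub> smul (a \<otimes> r) v \<in> W"
      using WD(4) r a by simp
    then show "smul a x \<in> ?S"
      using r a smul_closed by auto
  qed simp
  moreover have "wt n \<subseteq> ?S" if n: "n \<in> \<omega>" for n
  proof
    fix y assume y: "y \<in> wt n"
    have y': "y \<in> carrier V"
      using y by (rule wt_carrier)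
    show "y \<in> ?S"
    proof (cases "y \<in> W")
      case True
      then show ?thesis
        using v y' by (auto intro!: bexI[of _ \<zero>] simp: zero_smul V_diff_zero)
    next
      case False
      have "n = m"
        using wt_n[OF n] y False by blast
      obtain x s where xs: "x \<in> W" "s \<in> carrier R" "v = x \<oplus>\<^bsub>V\<^esub> smul s y"
        using decomp[OF y' False] by blast
      have "s \<notin> m"
      proof
        assume "s \<in> m"
        then have "v = x"
          using xs WD(1) wt_smul_zero y \<open>n = m\<close> by simp
        then show False
          using xs W(2) by simp
      qed
      then obtain u where u: "u \<in> carrier R" "m +> u \<otimes> s = m +> \<one>"
        using maximalideal_inverse[OF omega_maximal[OF m] xs(2)] by blast
      \<comment> \<open>The inverse u of s modulo m turns v = x + s y into u v = u x + y, which
        places y in W + R v.\<close>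
      have "smul u (smul s y) = y"
        using wt_coset_smul[OF m, of y "u \<otimes> s" \<one>] y \<open>n = m\<close> u xs y'
        by (simp add: mult_smul one_smul)
      then have "smul u v = smul u x \<oplus>\<^bsub>V\<^esub> y"
        using xs u y' WD(1) by (simp add: smul_add smul_closed)
      then have "y \<ominus>\<^bsub>V\<^esub> smul u v = \<ominus>\<^bsub>V\<^esub> smul u x"
        using V_diff_sum[of "smul u v" "smul u x" y] u v xs y' WD(1) by (simp add: smul_closed)
      then have "y \<ominus>\<^bsub>V\<^esub> smul u v \<in> W"
        using WD(4,5) u xs by simp
      then show ?thesis
        using u y' by auto
    qed
  qed
  ultimately have "w \<in> ?S" if "w \<in> carrier V" for w
    using that by (rule rsub_all)
  then have "\<exists>r\<in>carrier R. w \<ominus>\<^bsub>V\<^esub> smul r v \<in> W" if "w \<in> carrier V" for w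
    using that by blast
  with m W quot[OF m w] wt_n show thesis
    by (intro that[of m W]) auto
qed

text \<open>The coefficient of a vector along \<open>v\<close> is selected by choice and is
  determined only modulo m. Once \<open>f_eq\<close> shows that its conjugate residue is independent
  of the choice, additivity and semilinearity follow by naming a convenient coefficient.\<close>

lemma functional_nonzero:
  assumes star: "\<And>m. m \<in> \<omega> \<Longrightarrow> star ` m \<in> \<omega>" and v: "v \<in> carrier V" "v \<noteq> \<zero>\<^bsub>V\<^esub>"
  obtains \<phi> where "\<phi> \<in> VD" "\<phi> v \<noteq> \<zero>\<^bsub>M\<^esub>"
proof -
  obtain m W where m: "m \<in> \<omega>" and W: "rsub W" "v \<notin> W"
    and quot: "\<And>r. r \<in> carrier R \<Longrightarrow> smul r v \<in> W \<longleftrightarrow> r \<in> m"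
    and ex: "\<And>w. w \<in> carrier V \<Longrightarrow> \<exists>r\<in>carrier R. w \<ominus>\<^bsub>V\<^esub> smul r v \<in> W"
    and wt_n: "\<And>n. n \<in> \<omega> \<Longrightarrow> n \<noteq> m \<Longrightarrow> wt n \<subseteq> W"
    using separating_hyperplane[OF v] by blast
  note WD = rsubD[OF W(1)]
  let ?k = "star ` m"
  have k: "?k \<in> \<omega>"
    by (rule star[OF m])
  interpret k: ideal ?k R
    by (rule omega_ideal[OF k])
  define g where "g w = (SOME r. r \<in> carrier R \<and> w \<ominus>\<^bsub>V\<^esub> smul r v \<in> W)" for w
  have g: "g w \<in> carrier R" "w \<ominus>\<^bsub>V\<^esub> smul (g w) v \<in> W" if "w \<in> carrier V" for w
    using someI_ex[of "\<lambda>r. r \<in> carrier R \<and> w \<ominus>\<^bsub>V\<^esub> smul r v \<in> W"] ex[OF that]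
    unfolding g_def by blast+
  define f where "f w = residue_at ?k (star (g w))" for w
  \<comment> \<open>The difference of two coefficients of the same vector multiplies
    \<open>v\<close> into W, hence lies in m, and its conjugate has zero residue.\<close>
  have f_eq: "f w = residue_at ?k (star r)"
    if w: "w \<in> carrier V" and r: "r \<in> carrier R" "w \<ominus>\<^bsub>V\<^esub> smul r v \<in> W" for w r
  proof -
    have "(w \<ominus>\<^bsub>V\<^esub> smul r v) \<ominus>\<^bsub>V\<^esub> (w \<ominus>\<^bsub>V\<^esub> smul (g w) v) = smul (g w \<ominus> r) v"
      using w r g(1)[OF w] v(1)
      by (simp add: a_minus_def add_smul minus_smul V.minus_add smul_closed V.a_ac V.r_neg1 V.r_neg2 V.r_neg)
    then have "g w \<ominus> r \<in> m"
      using WD(6)[OF r(2) g(2)[OF w]] quot[of "g w \<ominus> r"] g(1)[OF w] r(1) by simp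
    then have "star (g w) \<ominus> star r \<in> ?k"
      using g(1)[OF w] r(1) by (auto simp: a_minus_def star_add star_minus intro!: image_eqI)
    then have "residue_at ?k (star (g w) \<ominus> star r) = \<zero>\<^bsub>M\<^esub>"
      by (rule residue_at_mem[OF k])
    moreover have "star (g w) = (star (g w) \<ominus> star r) \<oplus> star r"
      using g(1)[OF w] r(1) by (simp add: a_minus_def a_assoc l_neg star_closed)
    ultimately show ?thesis
      using residue_at_add[OF k, of "star (g w) \<ominus> star r" "star r"] g(1)[OF w] r(1)
      by (simp add: f_def star_closed residue_at_closed)
  qed
  have "semilinear (\<lambda>w\<in>carrier V. f w)"
  proof (rule semilinearI)
    show "f w \<in> carrier M" if "w \<in> carrier V" for w
      using g(1)[OF that] by (simp add: f_def residue_at_closed star_closed)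
  next
    fix x y assume xy: "x \<in> carrier V" "y \<in> carrier V"
    have "(x \<oplus>\<^bsub>V\<^esub> y) \<ominus>\<^bsub>V\<^esub> smul (g x \<oplus> g y) v = (x \<ominus>\<^bsub>V\<^esub> smul (g x) v) \<oplus>\<^bsub>V\<^esub> (y \<ominus>\<^bsub>V\<^esub> smul (g y) v)"
      using xy g(1) v by (simp add: a_minus_def add_smul V.minus_add V.a_ac smul_closed)
    then have "(x \<oplus>\<^bsub>V\<^esub> y) \<ominus>\<^bsub>V\<^esub> smul (g x \<oplus> g y) v \<in> W"
      using WD(3)[OF g(2)[OF xy(1)] g(2)[OF xy(2)]] by simp
    then have "f (x \<oplus>\<^bsub>V\<^esub> y) = residue_at ?k (star (g x \<oplus> g y))"
      using xy g(1) by (intro f_eq) simp_all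
    then show "f (x \<oplus>\<^bsub>V\<^esub> y) = f x \<oplus>\<^bsub>M\<^esub> f y"
      using xy g(1) by (simp add: f_def star_add residue_at_add[OF k] star_closed)
  next
    fix r x assume r: "r \<in> carrier R" and x: "x \<in> carrier V"
    have "smul r x \<ominus>\<^bsub>V\<^esub> smul (r \<otimes> g x) v = smul r (x \<ominus>\<^bsub>V\<^esub> smul (g x) v)"
      using r v x g(1) by (simp add: a_minus_def smul_add smul_uminus mult_smul smul_closed)
    then have "smul r x \<ominus>\<^bsub>V\<^esub> smul (r \<otimes> g x) v \<in> W"
      using WD(4)[OF r g(2)[OF x]] by simp
    then have "f (smul r x) = residue_at ?k (star (r \<otimes> g x))"
      using x r g(1) by (intro f_eq) (simp_all add: smul_closed)
    then show "f (smul r x) = star r \<odot>\<^bsub>M\<^esub> f x"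
      using x r g(1) by (simp add: f_def star_mult residue_at_smult[OF k] star_closed)
  qed
  moreover have "finite (fsupp (\<lambda>w\<in>carrier V. f w))"
  proof (rule finite_subset)
    show "fsupp (\<lambda>w\<in>carrier V. f w) \<subseteq> {m}"
    proof
      fix n assume "n \<in> fsupp (\<lambda>w\<in>carrier V. f w)"
      then obtain w where w: "n \<in> \<omega>" "w \<in> wt n" "f w \<noteq> \<zero>\<^bsub>M\<^esub>"
        by (auto simp: fsupp_def wt_carrier)
      \<comment> \<open>Weight vectors for other ideals lie in W, where 0 is an admissible
        coefficient; this confines the support to m.\<close>
      have "f w = residue_at ?k (star \<zero>)" if "w \<in> W"
        using that v wt_carrier[OF w(2)] by (intro f_eq) (simp_all add: zero_smul V_diff_zero)
      then have "f w = \<zero>\<^bsub>M\<^esub>" if "w \<in> W"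
        using that residue_at_mem[OF k, of \<zero>] by (simp add: star_zero)
      then show "n \<in> {m}"
        using wt_n[OF w(1)] w by blast
    qed
  qed simp
  ultimately have "(\<lambda>w\<in>carrier V. f w) \<in> VD"
    by (simp add: VD_iff)
  moreover have "f v = residue_at ?k (star \<one>)"
    using v WD(2) by (intro f_eq) (simp_all add: one_smul a_minus_def V.r_neg)
  then have "(\<lambda>w\<in>carrier V. f w) v \<noteq> \<zero>\<^bsub>M\<^esub>"
    using v residue_at_one[OF k] by (simp add: star_one)
  ultimately show thesis
    by (rule that)
qed

section \<open>From isomorphisms to non-degenerate forms\<close>

lemma iso_imp_nondegenerate:
  assumes F: "F \<in> forms" and iso: "form_to_hom V F \<in> left_module_iso A V D"
  shows "nondegenerate R \<omega> V F"
  unfolding nondegenerate_def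
proof (intro ballI impI)
  fix v assume v: "v \<in> carrier V" "v \<noteq> \<zero>\<^bsub>V\<^esub>"
  have bij: "bij_betw (form_to_hom V F) (carrier V) VD"
    using iso by (simp add: left_module_iso_def carrier_D)
  have "\<exists>w\<in>carrier V. F (v, w) \<noteq> \<zero>\<^bsub>M\<^esub>"
  proof (rule ccontr)
    assume no: "\<not> ?thesis"
    have "form_to_hom V F v = form_to_hom V F \<zero>\<^bsub>V\<^esub>"
      using v no forms_zero(1)[OF F]
      by (intro VD_eqI form_functional[OF F]) (simp_all add: form_to_hom_apply)
    then show False
      using bij v by (auto simp: bij_betw_def dest: inj_onD)
  qed
  then obtain w2 where w2: "w2 \<in> carrier V" "F (v, w2) \<noteq> \<zero>\<^bsub>M\<^esub>"
    by blast
  \<comment> \<open>If all conjugate ideals were outside the orbit, every semilinear functional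
    would vanish, and injectivity would fail at the nonzero vector v.\<close>
  have "\<exists>m0\<in>\<omega>. star ` m0 \<in> \<omega>"
  proof (rule ccontr)
    assume no: "\<not> ?thesis"
    have sl: "semilinear (form_to_hom V F v)" "semilinear (form_to_hom V F \<zero>\<^bsub>V\<^esub>)"
      using v by (simp_all add: form_semilinear[OF F])
    have "form_to_hom V F v = form_to_hom V F \<zero>\<^bsub>V\<^esub>"
    proof (rule semilinear_eq_on_weights[OF sl])
      fix m w assume m: "m \<in> \<omega>" and w: "w \<in> wt m"
      have "form_to_hom V F v w = \<zero>\<^bsub>M\<^esub>"
      proof (rule M_eqI)
        fix n assume n: "n \<in> \<omega>"
        have "form_to_hom V F v w n = n"
          using no m n star_image_maximal[OF m] w
            semilinearD(1)[OF sl(1)] semilinear_annihilated[OF sl(1) omega_subset[OF m] w]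
          by (intro annihilated_by_component) (auto simp: wt_carrier)
        then show "form_to_hom V F v w n = \<zero>\<^bsub>M\<^esub> n"
          by (simp add: M_zero n)
      qed (use w semilinearD(1)[OF sl(1)] in \<open>simp_all add: wt_carrier\<close>)
      then show "form_to_hom V F v w = form_to_hom V F \<zero>\<^bsub>V\<^esub> w"
        using w forms_zero(1)[OF F] by (simp add: form_to_hom_apply wt_carrier)
    qed
    then show False
      using bij v by (auto simp: bij_betw_def dest: inj_onD)
  qed
  then obtain m0 where m0: "m0 \<in> \<omega>" "star ` m0 \<in> \<omega>"
    by blast
  obtain \<phi> where \<phi>: "\<phi> \<in> VD" "\<phi> v \<noteq> \<zero>\<^bsub>M\<^esub>"
    using functional_nonzero[OF star_omega[OF m0] v] by blast
  have "\<phi> \<in> form_to_hom V F ` carrier V"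
    using bij \<phi>(1) by (simp add: bij_betw_def)
  then obtain w1 where w1: "w1 \<in> carrier V" "\<phi> = form_to_hom V F w1"
    by (rule imageE)
  then have "F (w1, v) \<noteq> \<zero>\<^bsub>M\<^esub>"
    using \<phi>(2) v(1) by (simp add: form_to_hom_apply)
  then show "\<exists>w\<^sub>1\<in>carrier V. \<exists>w\<^sub>2\<in>carrier V. F (w\<^sub>1, v) \<noteq> \<zero>\<^bsub>M\<^esub> \<and> F (v, w\<^sub>2) \<noteq> \<zero>\<^bsub>M\<^esub>"
    using w1(1) w2 by blast
qed

section \<open>Linear algebra on one weight space\<close>

lemma form_diff:
  assumes F: "F \<in> forms" and "u \<in> carrier V" "v \<in> carrier V" "w \<in> carrier V" "r \<in> carrier R"
  shows "F (u \<ominus>\<^bsub>V\<^esub> smul r v, w) = F (u, w) \<ominus>\<^bsub>M\<^esub> r \<odot>\<^bsub>M\<^esub> F (v, w)"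
    "F (w, u \<ominus>\<^bsub>V\<^esub> smul r v) = F (w, u) \<ominus>\<^bsub>M\<^esub> star r \<odot>\<^bsub>M\<^esub> F (w, v)"
  using assms(2-) biadditive_uminus[OF forms_biadditive[OF F]]
  by (simp_all add: a_minus_def forms_D[OF F] forms_generators[OF F] smul_closed)

lemma wt_rsub:
  assumes "m \<subseteq> carrier R"
  shows "rsub (wt m)"
proof -
  have "smul a (smul r v) = \<zero>\<^bsub>V\<^esub>" if "a \<in> m" "r \<in> carrier R" "v \<in> wt m" for a r v
  proof -
    have "smul (r \<otimes> a) v = \<zero>\<^bsub>V\<^esub>"
      using that assms by (simp add: mult_smul subset_iff wt_carrier wt_smul_zero smul_zero)
    then show ?thesis
      using that assms by (simp add: m_comm subset_iff wt_carrier flip: mult_smul)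
  qed
  then show ?thesis
    using assms by (auto simp: rsub_def weight_space_def smul_zero smul_add smul_closed subset_iff)
qed

lemma annihilated_by_diff:
  assumes "k \<subseteq> carrier R" "x \<in> carrier M" "y \<in> carrier M" "annihilated_by k x" "annihilated_by k y"
  shows "annihilated_by k (x \<ominus>\<^bsub>M\<^esub> y)"
  using assms M.minus_equality[of "\<zero>\<^bsub>M\<^esub>" "\<zero>\<^bsub>M\<^esub>"]
  by (auto simp: annihilated_by_def a_minus_def M.smult_r_distr M.smult_r_minus subset_iff)

context
  fixes F and m
  assumes F: "F \<in> forms" and m: "m \<in> \<omega>"
    and nd: "nondegenerate R \<omega> V F"
begin

text \<open>The vectors pairing to zero with \<open>b\<close> form a submodule containing every
  weight space except possibly the one of the conjugate weight. If it contained that one too, it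
  would be all of V.\<close>

lemma nondegenerate_weight:
  assumes b: "b \<in> wt m" "b \<noteq> \<zero>\<^bsub>V\<^esub>"
  obtains u where "u \<in> wt (star ` m)" "F (u, b) \<noteq> \<zero>\<^bsub>M\<^esub>"
proof -
  have b': "b \<in> carrier V"
    by (rule wt_carrier[OF b(1)])
  obtain w where w: "w \<in> carrier V" "F (w, b) \<noteq> \<zero>\<^bsub>M\<^esub>"
    using nd b b' unfolding nondegenerate_def by blast
  have "\<exists>u\<in>wt (star ` m). F (u, b) \<noteq> \<zero>\<^bsub>M\<^esub>"
  proof (rule ccontr)
    assume no: "\<not> ?thesis"
    let ?W = "{u \<in> carrier V. F (u, b) = \<zero>\<^bsub>M\<^esub>}"
    have "rsub ?W"
      using b' by (auto simp: rsub_def forms_zero[OF F] forms_D[OF F] forms_generators[OF F] smul_closed)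
    moreover have "wt n \<subseteq> ?W" if "n \<in> \<omega>" for n
      using no form_weights[OF F omega_maximal[OF that] _ m b(1)] by (auto simp: wt_carrier)
    ultimately have "w \<in> ?W"
      using w(1) by (rule rsub_all)
    with w(2) show False
      by simp
  qed
  then show thesis
    using that by blast
qed

text \<open>A nonzero value of the form serves as a unit of measurement for everything in the same
  summand, so quotients of values are available as ring elements.\<close>

lemma form_scalar:
  assumes "u \<in> wt (star ` m)" "c \<in> carrier V" "F (u, c) \<noteq> \<zero>\<^bsub>M\<^esub>"
    and "x \<in> carrier M" "annihilated_by (star ` m) x"
  obtains s where "s \<in> carrier R" "x = s \<odot>\<^bsub>M\<^esub> F (u, c)"
  using annihilated_by_scalar[OF star_image_maximal[OF m] _ forms_annihilated[OF F assms(1) maximalideal_subset[OF star_image_maximal[OF m]] assms(2)] assms(3-5)]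
    forms_D(1)[OF F wt_carrier[OF assms(1)] assms(2)] by blast

text \<open>The classical fact that a functional vanishing on the common kernel of finitely many
  functionals is a combination of them.\<close>

lemma span_or_separate:
  assumes "finite B" "B \<subseteq> wt m" "b \<in> wt m"
  shows "(\<forall>W. rsub W \<longrightarrow> B \<subseteq> W \<longrightarrow> b \<in> W) \<or>
    (\<exists>u\<in>wt (star ` m). (\<forall>c\<in>B. F (u, c) = \<zero>\<^bsub>M\<^esub>) \<and> F (u, b) \<noteq> \<zero>\<^bsub>M\<^esub>)"
  using assms
proof (induction B arbitrary: b rule: finite_induct)
  case empty
  show ?case
  proof (cases "b = \<zero>\<^bsub>V\<^esub>")
    case True
    then show ?thesis
      using rsubD(2) by blast
  next
    case False
    then show ?thesis
      using nondegenerate_weight[OF empty.prems(2)] by blast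
  qed
next
  case (insert c B)
  have c: "c \<in> wt m" and B: "B \<subseteq> wt m"
    using insert.prems by auto
  note b = insert.prems(2)
  have car: "b \<in> carrier V" "c \<in> carrier V" "\<And>x. x \<in> B \<Longrightarrow> x \<in> carrier V"
    using b c B wt_carrier by blast+
  note wtD = rsubD[OF wt_rsub[OF omega_subset[OF m]]] rsubD[OF wt_rsub[OF maximalideal_subset[OF star_image_maximal[OF m]]]]
  from insert.IH[OF B c] show ?case
  proof
    \<comment> \<open>Here \<open>c\<close> already lies in the span of B: any \<open>u\<close> that
      vanishes on B vanishes at \<open>c\<close>, and the alternative for B carries over.\<close>
    assume cW: "\<forall>W. rsub W \<longrightarrow> B \<subseteq> W \<longrightarrow> c \<in> W"
    from insert.IH[OF B b] show ?thesis
    proof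
      assume "\<exists>u\<in>wt (star ` m). (\<forall>x\<in>B. F (u, x) = \<zero>\<^bsub>M\<^esub>) \<and> F (u, b) \<noteq> \<zero>\<^bsub>M\<^esub>"
      then obtain u where u: "u \<in> wt (star ` m)" "\<forall>x\<in>B. F (u, x) = \<zero>\<^bsub>M\<^esub>" "F (u, b) \<noteq> \<zero>\<^bsub>M\<^esub>"
        by blast
      have "rsub {v \<in> carrier V. F (u, v) = \<zero>\<^bsub>M\<^esub>}"
        using wt_carrier[OF u(1)]
        by (auto simp: rsub_def forms_zero[OF F] forms_D[OF F] forms_generators[OF F] smul_closed star_closed)
      then have "F (u, c) = \<zero>\<^bsub>M\<^esub>"
        using cW u(2) car by blast
      then show ?thesis
        using u by blast
    qed blast
  next
    assume "\<exists>u\<in>wt (star ` m). (\<forall>x\<in>B. F (u, x) = \<zero>\<^bsub>M\<^esub>) \<and> F (u, c) \<noteq> \<zero>\<^bsub>M\<^esub>"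
    then obtain u where u: "u \<in> wt (star ` m)" "\<And>x. x \<in> B \<Longrightarrow> F (u, x) = \<zero>\<^bsub>M\<^esub>" "F (u, c) \<noteq> \<zero>\<^bsub>M\<^esub>"
      by blast
    have u': "u \<in> carrier V"
      by (rule wt_carrier[OF u(1)])
    obtain s where s: "s \<in> carrier R" "F (u, b) = s \<odot>\<^bsub>M\<^esub> F (u, c)"
      using form_scalar[OF u(1) car(2) u(3), of "F (u, b)"]
        forms_annihilated[OF F u(1) maximalideal_subset[OF star_image_maximal[OF m]] car(1)] forms_D(1)[OF F u' car(1)] by blast
    \<comment> \<open>The multiple of \<open>c\<close> is chosen so that \<open>u\<close> vanishes
      at the corrected vector; the coefficient is conjugated because the second argument is
      conjugate-linear.\<close>
    let ?b = "b \<ominus>\<^bsub>V\<^esub> smul (star s) c"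
    have b': "?b \<in> wt m"
      using b c s by (simp add: wtD star_closed)
    have ub: "F (u, ?b) = \<zero>\<^bsub>M\<^esub>"
      unfolding form_diff(2)[OF F car(1,2) u' star_closed[OF s(1)]]
      using s u' car by (simp add: star_star forms_D[OF F] a_minus_def M.r_neg)
    from insert.IH[OF B b'] show ?thesis
    proof
      assume bW: "\<forall>W. rsub W \<longrightarrow> B \<subseteq> W \<longrightarrow> ?b \<in> W"
      have "b \<in> W" if W: "rsub W" "insert c B \<subseteq> W" for W
      proof -
        have "?b \<oplus>\<^bsub>V\<^esub> smul (star s) c \<in> W"
          using W bW s by (intro rsubD(3)[OF W(1)] rsubD(4)[OF W(1)]) (auto simp: star_closed)
        then show ?thesis
          using car s by (simp add: a_minus_def V.a_assoc V.l_neg smul_closed star_closed)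
      qed
      then show ?thesis
        by blast
    next
      assume "\<exists>v\<in>wt (star ` m). (\<forall>x\<in>B. F (v, x) = \<zero>\<^bsub>M\<^esub>) \<and> F (v, ?b) \<noteq> \<zero>\<^bsub>M\<^esub>"
      then obtain v where v: "v \<in> wt (star ` m)" "\<And>x. x \<in> B \<Longrightarrow> F (v, x) = \<zero>\<^bsub>M\<^esub>" "F (v, ?b) \<noteq> \<zero>\<^bsub>M\<^esub>"
        by blast
      have v': "v \<in> carrier V"
        by (rule wt_carrier[OF v(1)])
      obtain r where r: "r \<in> carrier R" "F (v, c) = r \<odot>\<^bsub>M\<^esub> F (u, c)"
        using form_scalar[OF u(1) car(2) u(3), of "F (v, c)"]
          forms_annihilated[OF F v(1) maximalideal_subset[OF star_image_maximal[OF m]] car(2)] forms_D(1)[OF F v' car(2)] by blast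
      \<comment> \<open>Subtracting this multiple of \<open>u\<close> makes the separating vector
        vanish at \<open>c\<close> as well, and leaves its zeros on B intact because
        \<open>u\<close> vanishes there.\<close>
      let ?v = "v \<ominus>\<^bsub>V\<^esub> smul r u"
      have vv: "?v \<in> wt (star ` m)"
        using u(1) v(1) r by (simp add: wtD)
      have vb: "?b \<in> carrier V"
        by (rule wt_carrier[OF b'])
      have zero: "\<zero>\<^bsub>M\<^esub> \<ominus>\<^bsub>M\<^esub> \<zero>\<^bsub>M\<^esub> = \<zero>\<^bsub>M\<^esub>"
        by (simp add: a_minus_def M.r_neg)
      have "F (?v, x) = \<zero>\<^bsub>M\<^esub>" if "x \<in> B" for x
        using that car u(2) v(2) u' v' r(1) by (simp add: form_diff[OF F] zero)
      moreover have vc: "F (?v, c) = \<zero>\<^bsub>M\<^esub>"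
        unfolding form_diff(1)[OF F v' u' car(2) r(1)]
        using car u' v' r by (simp add: forms_D[OF F] a_minus_def M.r_neg)
      \<comment> \<open>Since \<open>?v\<close> vanishes at \<open>c\<close>, vanishing at b would
        mean vanishing at \<open>?b\<close>; but \<open>u\<close> is zero at \<open>?b\<close>, so
        the value there is still that of v.\<close>
      moreover have "F (?v, b) \<noteq> \<zero>\<^bsub>M\<^esub>"
      proof
        assume "F (?v, b) = \<zero>\<^bsub>M\<^esub>"
        then have "F (?v, ?b) = \<zero>\<^bsub>M\<^esub>"
          using vc car s wt_carrier[OF vv] by (simp add: form_diff(2)[OF F] star_closed zero)
        moreover have "F (?v, ?b) = F (v, ?b) \<ominus>\<^bsub>M\<^esub> r \<odot>\<^bsub>M\<^esub> F (u, ?b)"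
          using vb u' v' r by (intro form_diff(1)[OF F]) simp_all
        ultimately have "F (v, ?b) = \<zero>\<^bsub>M\<^esub>"
          unfolding ub using vb v' r M.minus_equality[of "\<zero>\<^bsub>M\<^esub>" "\<zero>\<^bsub>M\<^esub>"] forms_D(1)[OF F v' vb]
          by (simp add: a_minus_def)
        then show False
          using v(3) by simp
      qed
      ultimately show ?thesis
        using vv by blast
    qed
  qed
qed

text \<open>Points are added one at a time. A point in the span of the earlier ones takes care of
  itself, because span means membership in every submodule and the agreement set is one; any other
  point is corrected by a vector that vanishes on the earlier ones.\<close>

lemma interpolate:
  assumes \<phi>: "\<phi> \<in> VD" and "finite B" "B \<subseteq> wt m"
  shows "\<exists>u\<in>wt (star ` m). \<forall>b\<in>B. F (u, b) = \<phi> b"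
  using assms(2,3)
proof (induction B rule: finite_induct)
  case empty
  then show ?case
    using rsubD(2)[OF wt_rsub[OF maximalideal_subset[OF star_image_maximal[OF m]]]] by blast
next
  case (insert b B)
  then obtain u where u: "u \<in> wt (star ` m)" "\<And>x. x \<in> B \<Longrightarrow> F (u, x) = \<phi> x"
    by auto
  have b: "b \<in> wt m" and B: "B \<subseteq> wt m"
    using insert.prems by auto
  have u': "u \<in> carrier V" and b': "b \<in> carrier V"
    by (rule wt_carrier[OF u(1)], rule wt_carrier[OF b])
  from span_or_separate[OF insert.hyps(1) B b] show ?case
  proof
    assume bW: "\<forall>W. rsub W \<longrightarrow> B \<subseteq> W \<longrightarrow> b \<in> W"
    have "rsub {v \<in> carrier V. form_to_hom V F u v = \<phi> v}"
      by (rule semilinear_agree_rsub[OF form_semilinear[OF F u'] VD_semilinear[OF \<phi>]])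
    moreover have "B \<subseteq> {v \<in> carrier V. form_to_hom V F u v = \<phi> v}"
      using u B u' by (auto simp: form_to_hom_apply wt_carrier subset_iff)
    ultimately have "F (u, b) = \<phi> b"
      using bW u' by (auto simp: form_to_hom_apply)
    then show ?thesis
      using u by auto
  next
    assume "\<exists>w\<in>wt (star ` m). (\<forall>c\<in>B. F (w, c) = \<zero>\<^bsub>M\<^esub>) \<and> F (w, b) \<noteq> \<zero>\<^bsub>M\<^esub>"
    then obtain w where w: "w \<in> wt (star ` m)" "\<And>c. c \<in> B \<Longrightarrow> F (w, c) = \<zero>\<^bsub>M\<^esub>" "F (w, b) \<noteq> \<zero>\<^bsub>M\<^esub>"
      by blast
    have w': "w \<in> carrier V"
      by (rule wt_carrier[OF w(1)])
    note \<phi>b = VD_D(1)[OF \<phi> b'] and Fub = forms_D(1)[OF F u' b']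
    have "annihilated_by (star ` m) (\<phi> b \<ominus>\<^bsub>M\<^esub> F (u, b))"
      by (intro annihilated_by_diff maximalideal_subset[OF star_image_maximal[OF m]] \<phi>b Fub forms_annihilated[OF F u(1) maximalideal_subset[OF star_image_maximal[OF m]] b']
          semilinear_annihilated[OF VD_semilinear[OF \<phi>] omega_subset[OF m] b])
    \<comment> \<open>The scalar s makes the multiple of w supply exactly the missing value at
      b.\<close>
    then obtain s where s: "s \<in> carrier R" "\<phi> b \<ominus>\<^bsub>M\<^esub> F (u, b) = s \<odot>\<^bsub>M\<^esub> F (w, b)"
      using form_scalar[OF w(1) b' w(3), of "\<phi> b \<ominus>\<^bsub>M\<^esub> F (u, b)"] \<phi>b Fub by blast
    let ?u = "u \<oplus>\<^bsub>V\<^esub> smul s w"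
    have "?u \<in> wt (star ` m)"
      using rsubD(3,4)[OF wt_rsub[OF maximalideal_subset[OF star_image_maximal[OF m]]]] u w s by blast
    moreover have "F (?u, x) = F (u, x) \<oplus>\<^bsub>M\<^esub> s \<odot>\<^bsub>M\<^esub> F (w, x)" if "x \<in> carrier V" for x
      using u' w' s that by (simp add: forms_D[OF F] forms_generators[OF F] smul_closed)
    then have "F (?u, x) = \<phi> x" if "x \<in> insert b B" for x
      using that b' u w(2) s B \<phi>b Fub VD_D(1)[OF \<phi>] wt_carrier
      by (auto simp flip: s(2) simp: a_minus_def M.a_ac M.r_neg M.r_neg2 subset_iff)
    ultimately show ?thesis
      by blast
  qed
qed

text \<open>Finite dimension provides a finite spanning set on which to interpolate; agreement then
  spreads to all combinations.\<close>

lemma represent_on_weight: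
  assumes \<phi>: "\<phi> \<in> VD" and fin: "finite_dim_weight_space R \<sigma> t V m"
  obtains u where "u \<in> wt (star ` m)" "\<And>v. v \<in> wt m \<Longrightarrow> F (u, v) = \<phi> v"
proof -
  obtain B where B: "finite B" "B \<subseteq> wt m"
    and span: "\<And>v. v \<in> wt m \<Longrightarrow> \<exists>c\<in>B \<rightarrow> carrier R. v = finsum V (\<lambda>b. smul (c b) b) B"
    using fin unfolding finite_dim_weight_space_def by blast
  obtain u where u: "u \<in> wt (star ` m)" "\<forall>b\<in>B. F (u, b) = \<phi> b"
    using interpolate[OF \<phi> B] by blast
  have u': "u \<in> carrier V"
    by (rule wt_carrier[OF u(1)])
  let ?W = "{v \<in> carrier V. form_to_hom V F u v = \<phi> v}"
  have W: "rsub ?W"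
    by (rule semilinear_agree_rsub[OF form_semilinear[OF F u'] VD_semilinear[OF \<phi>]])
  have "F (u, v) = \<phi> v" if v: "v \<in> wt m" for v
  proof -
    obtain c where c: "c \<in> B \<rightarrow> carrier R" "v = finsum V (\<lambda>b. smul (c b) b) B"
      using span[OF v] by blast
    have "B \<subseteq> ?W"
      using u B u' by (auto simp: form_to_hom_apply wt_carrier subset_iff)
    then have "smul (c b) b \<in> ?W" if "b \<in> B" for b
      using c(1) that by (intro rsubD(4)[OF W]) auto
    then have "v \<in> ?W"
      unfolding c(2) by (rule rsub_finsum[OF W B(1)])
    then show ?thesis
      using u' by (auto simp: form_to_hom_apply)
  qed
  with u(1) show thesis
    by (rule that)
qed

end

section \<open>From non-degenerate forms to isomorphisms\<close>

lemma nondegenerate_imp_iso: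
  assumes F: "F \<in> forms" and nd: "nondegenerate R \<omega> V F"
    and fin: "\<And>m. m \<in> \<omega> \<Longrightarrow> finite_dim_weight_space R \<sigma> t V m"
  shows "form_to_hom V F \<in> left_module_iso A V D"
proof -
  have "inj_on (form_to_hom V F) (carrier V)"
  proof (rule inj_onI)
    fix u v assume uv: "u \<in> carrier V" "v \<in> carrier V" "form_to_hom V F u = form_to_hom V F v"
    have "F (u \<ominus>\<^bsub>V\<^esub> v, w) = \<zero>\<^bsub>M\<^esub>" if w: "w \<in> carrier V" for w
    proof -
      have "F (u, w) = F (v, w)"
        using uv w by (metis form_to_hom_apply)
      then show ?thesis
        using form_diff(1)[OF F uv(1,2) w one_closed] uv w
        unfolding one_smul[OF uv(2)] by (simp add: forms_D[OF F] a_minus_def[of M] M.r_neg)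
    qed
    then have "u \<ominus>\<^bsub>V\<^esub> v = \<zero>\<^bsub>V\<^esub>"
      using nd uv unfolding nondegenerate_def by blast
    then have "(u \<ominus>\<^bsub>V\<^esub> v) \<oplus>\<^bsub>V\<^esub> v = v"
      using uv by simp
    then show "u = v"
      using uv by (simp add: a_minus_def V.a_assoc V.l_neg)
  qed
  moreover have "form_to_hom V F ` carrier V = VD"
  proof (intro subset_antisym subsetI)
    fix \<phi> assume \<phi>: "\<phi> \<in> VD"
    \<comment> \<open>The vector representing \<phi> on the weight space at m has the conjugate
      weight and pairs to zero with all other weights, so the local solutions can be added without
      disturbing one another.\<close>
    have glue: "\<exists>u\<in>carrier V. \<forall>m\<in>\<omega>. \<forall>v\<in>wt m. F (u, v) = (if m \<in> T then \<phi> v else \<zero>\<^bsub>M\<^esub>)"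
      if "finite T" "T \<subseteq> \<omega>" for T
      using that
    proof (induction T rule: finite_induct)
      case empty
      then show ?case
        using forms_zero(1)[OF F] wt_carrier by (intro bexI[of _ "\<zero>\<^bsub>V\<^esub>"]) auto
    next
      case (insert m T)
      then obtain u where u: "u \<in> carrier V"
        and u_eq: "\<And>n v. n \<in> \<omega> \<Longrightarrow> v \<in> wt n \<Longrightarrow> F (u, v) = (if n \<in> T then \<phi> v else \<zero>\<^bsub>M\<^esub>)"
        by auto
      have m: "m \<in> \<omega>"
        using insert.prems by simp
      obtain w where w: "w \<in> wt (star ` m)" "\<And>v. v \<in> wt m \<Longrightarrow> F (w, v) = \<phi> v"
        using represent_on_weight[OF F m nd \<phi> fin[OF m]] by blast
      have w': "w \<in> carrier V"
        by (rule wt_carrier[OF w(1)])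
      have "F (w, v) = \<zero>\<^bsub>M\<^esub>" if n: "n \<in> \<omega>" "n \<noteq> m" and v: "v \<in> wt n" for n v
      proof (rule ccontr)
        assume "F (w, v) \<noteq> \<zero>\<^bsub>M\<^esub>"
        then have "star ` star ` m = star ` star ` n"
          using form_weights[OF F star_image_maximal[OF m] w(1) n(1) v] by simp
        then show False
          using n(2) by (simp add: star_star_image omega_subset m n(1))
      qed
      then have "F (u \<oplus>\<^bsub>V\<^esub> w, v) = (if n \<in> insert m T then \<phi> v else \<zero>\<^bsub>M\<^esub>)"
        if "n \<in> \<omega>" "v \<in> wt n" for n v
        using that u_eq[OF that] w(2) insert.hyps(2) VD_D(1)[OF \<phi> wt_carrier[OF that(2)]]
        by (auto simp: forms_D[OF F] u w' wt_carrier)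
      then show ?case
        using u w' by (intro bexI[of _ "u \<oplus>\<^bsub>V\<^esub> w"]) auto
    qed
    have "finite (fsupp \<phi>)" "fsupp \<phi> \<subseteq> \<omega>"
      using \<phi> by (auto simp: VD_iff fsupp_def)
    from glue[OF this] obtain u where u: "u \<in> carrier V"
      and "\<forall>m\<in>\<omega>. \<forall>v\<in>wt m. F (u, v) = (if m \<in> fsupp \<phi> then \<phi> v else \<zero>\<^bsub>M\<^esub>)"
      by (rule bexE)
    then have u_eq: "F (u, v) = (if m \<in> fsupp \<phi> then \<phi> v else \<zero>\<^bsub>M\<^esub>)" if "m \<in> \<omega>" "v \<in> wt m" for m v
      using that by simp
    have "form_to_hom V F u = \<phi>"
    proof (rule semilinear_eq_on_weights[OF form_semilinear[OF F u] VD_semilinear[OF \<phi>]])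
      fix m v assume mv: "m \<in> \<omega>" "v \<in> wt m"
      then show "form_to_hom V F u v = \<phi> v"
        using u_eq[OF mv] u by (auto simp: form_to_hom_apply wt_carrier fsupp_def)
    qed
    then show "\<phi> \<in> form_to_hom V F ` carrier V"
      using imageI[OF u, of "form_to_hom V F"] by simp
  qed (use form_functional[OF F] in auto)
  ultimately show ?thesis
    using form_to_hom_in_hom[OF F] by (simp add: left_module_iso_def bij_betw_def carrier_D)
qed

end

theorem proposition3p18:
  fixes R :: "'r ring" and star \<sigma> :: "'r \<Rightarrow> 'r" and t :: 'r
    and \<omega> :: "'r set set" and V :: "('r gwa_expr set, 'v) module"
  assumes "gwa_data R star \<sigma> t"
    and "\<omega> \<in> sigma_orbits R \<sigma>"
    and "weight_module R \<sigma> t V"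
    and "weight_support R \<sigma> t V \<subseteq> \<omega>"
  shows "comm_group (admissible_form_group R star \<sigma> t \<omega> V) \<and>
    comm_group (left_module_hom_group (gwa R \<sigma> t) V (finitistic_dual R star \<sigma> t \<omega> V)) \<and>
    form_to_hom V \<in> iso (admissible_form_group R star \<sigma> t \<omega> V)
      (left_module_hom_group (gwa R \<sigma> t) V (finitistic_dual R star \<sigma> t \<omega> V)) \<and>
    (\<forall>F\<in>admissible_forms R star \<sigma> t \<omega> V.
      form_to_hom V F \<in> left_module_iso (gwa R \<sigma> t) V (finitistic_dual R star \<sigma> t \<omega> V)
        \<longrightarrow> nondegenerate R \<omega> V F) \<and>
    ((\<forall>m\<in>\<omega>. finite_dim_weight_space R \<sigma> t V m) \<longrightarrow>
      (\<forall>F\<in>admissible_forms R star \<sigma> t \<omega> V.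
        nondegenerate R \<omega> V F \<longleftrightarrow>
        form_to_hom V F \<in> left_module_iso (gwa R \<sigma> t) V (finitistic_dual R star \<sigma> t \<omega> V)))"
proof -
  interpret gwa_data R star \<sigma> t
    by fact
  interpret gwa_weight R star \<sigma> t \<omega> V
    using assms(2-) by unfold_locales
  show ?thesis
    using comm_group_forms comm_group_homs form_to_hom_iso iso_imp_nondegenerate nondegenerate_imp_iso
    by blast
qed

end
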